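(* Let $\Lambda$ be a row-finite locally convex $k$-graph. (1) Let $1$ denote the identity element of $C^2(\Lambda,\mathbb{T})$ (the constant cocycle with value $1$). Then $C^*_1(\Lambda)$ is canonically isomorphic to the $k$-graph algebra $C^*(\Lambda)$. (2) Let $\psi,\phi\in Z^2(\Lambda,\mathbb{T})$, and suppose that $\alpha\in C^1(\Lambda,\mathbb{T})$ satisfies $\phi=\delta^1(\alpha)\psi$, so that $\phi$ and $\psi$ are cohomologous. Let $\{p^\psi_v:v\in\Lambda^0\}$, $\{s^\psi_\lambda:\lambda\in\bigcup_{i=1}^k\Lambda^{e_i}\}$ be the universal generating Cuntz-Krieger $\psi$-representation of $\Lambda$ in $C^*_\psi(\Lambda)$, and similarly for $\phi$. Then there is an isomorphism $\pi:C^*_\psi(\Lambda)\to C^*_\phi(\Lambda)$ such that $\pi(p^\psi_v)=p^\phi_v$ for all $v\in\Lambda^0$ and $\pi(s^\psi_\lambda)=\alpha(\lambda)s^\phi_\lambda$ for all $\lambda\in\bigcup_{i=1}^k\Lambda^{e_i}$.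
   Context: Conventions: $0\in\mathbb{N}$ and $\mathbb{N}^0=\{0\}$. A $k$-graph is a nonempty countable small category $\Lambda$ with a functor $d:\Lambda\to\mathbb{N}^k$ (the degree) satisfying the factorisation property: whenever $d(\lambda)=m+n$ there are unique $\mu,\nu\in\Lambda$ with $d(\mu)=m$, $d(\nu)=n$, $\lambda=\mu\nu$. Objects are identified with identity morphisms; $\Lambda^n=d^{-1}(n)$, $\Lambda^0$ is the set of vertices; $r,s:\Lambda\to\Lambda^0$ are the codomain and domain maps; $\mu\nu$ is defined when $s(\mu)=r(\nu)$. For $v\in\Lambda^0$, $v\Lambda^n=\{\lambda\in\Lambda^n:r(\lambda)=v\}$. $e_1,\dots,e_k$ are the standard generators of $\mathbb{N}^k$, $\mathbf{1}_k=\sum_ie_i$, $\le$ is coordinatewise, $|n|=\sum_i n_i$. $\Lambda$ is row-finite if every $v\Lambda^n$ is finite, and locally convex if whenever $1\le i\ne j\le k$ and $\lambda\in\Lambda^{e_i}$ with $r(\lambda)\Lambda^{e_j}\ne\emptyset$, also $s(\lambda)\Lambda^{e_j}\ne\emptyset$. Cohomology: $Q_r(\Lambda)=\{\lambda: d(\lambda)\le\mathbf{1}_k,|d(\lambda)|=r\}$. For $\lambda\in Q_r(\Lambda)$ with $d(\lambda)=e_{i_1}+\dots+e_{i_r}$, $i_1<\dots<i_r$, $1\le j\le r$, $F_j^0(\lambda),F_j^1(\lambda)\in Q_{r-1}(\Lambda)$ are the unique elements with $F_j^0(\lambda)\beta=\lambda=\alpha' F_j^1(\lambda)$ for some $\alpha',\beta\in\Lambda^{e_{i_j}}$.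 $C^r(\Lambda,\mathbb{T})$ is the group of functions $f:Q_r(\Lambda)\to\mathbb{T}$ (written multiplicatively), and $\delta^r:C^r(\Lambda,\mathbb{T})\to C^{r+1}(\Lambda,\mathbb{T})$ is $\delta^r(f)(\lambda)=\prod_{i=1}^{r+1}\prod_{\ell=0}^1 f(F_i^\ell(\lambda))^{(-1)^{i+\ell}}$. $Z^2(\Lambda,\mathbb{T})=\ker\delta^2$. For $\Lambda$ row-finite locally convex and $\phi\in Z^2(\Lambda,\mathbb{T})$, a Cuntz-Krieger $\phi$-representation of $\Lambda$ in a $C^*$-algebra $A$ is a set $\{p_v:v\in\Lambda^0\}\subseteq A$ of mutually orthogonal projections and a set $\{s_\lambda:\lambda\in\bigcup_{i=1}^k\Lambda^{e_i}\}\subseteq A$ satisfying: (i) $s_\lambda^*s_\lambda=p_{s(\lambda)}$ for all $\lambda\in\Lambda^{e_i}$; (ii) for all $1\le i<j\le k$ and $\mu,\mu'\in\Lambda^{e_i}$, $\nu,\nu'\in\Lambda^{e_j}$ with $\mu\nu=\nu'\mu'$, $s_{\nu'}s_{\mu'}=\phi(\mu\nu)s_\mu s_\nu$; (iii) for all $v\in\Lambda^0$ and $1\le i\le k$ with $v\Lambda^{e_i}\ne\emptyset$, $p_v=\sum_{\lambda\in v\Lambda^{e_i}}s_\lambda s_\lambda^*$. $C^*_\phi(\Lambda)$ is the universal $C^*$-algebra generated by a Cuntz-Krieger $\phi$-representation of $\Lambda$. The $k$-graph algebra $C^*(\Lambda)$ (Raeburn-Sims-Yeend) is the universal $C^*$-algebra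 generated by partial isometries $\{t_\lambda:\lambda\in\Lambda\}$ such that $\{t_v:v\in\Lambda^0\}$ are mutually orthogonal projections, $t_\lambda t_\mu=t_{\lambda\mu}$ when $s(\lambda)=r(\mu)$, $t_\lambda^*t_\lambda=t_{s(\lambda)}$, and $t_v=\sum_{\lambda\in v\Lambda^{\le m}}t_\lambda t_\lambda^*$ for all $v\in\Lambda^0$, $m\in\mathbb{N}^k$, where $v\Lambda^{\le m}=\{\lambda\in\Lambda: r(\lambda)=v,\ d(\lambda)\le m,\ s(\lambda)\Lambda^{e_i}=\emptyset\text{ whenever }d(\lambda)+e_i\le m\}$. "Canonically isomorphic" means via an isomorphism with $p_v\mapsto t_v$ and $s_\lambda\mapsto t_\lambda$ for $v\in\Lambda^0$ and edges $\lambda\in\bigcup_i\Lambda^{e_i}$. *)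

theory Defs
  imports
    Complex_Main
    "HOL-Algebra.Ring"
    "HOL-Library.Countable_Set"
    "HOL-Library.Function_Algebras"
begin

section \<open>C*-algebras\<close>

text \<open>C*-algebras are not assumed to be unital: the record field \<open>one\<close>, inherited from
  \<open>ring\<close>, carries no information and is never used.\<close>

record 'a cstar = "'a ring" +
  cscale :: "complex \<Rightarrow> 'a \<Rightarrow> 'a" (infixr \<open>\<odot>\<index>\<close> 75)
  adj :: "'a \<Rightarrow> 'a" (\<open>_\<^sup>\<star>\<index>\<close> [1000] 999)
  cnorm :: "'a \<Rightarrow> real"

locale star_algebra = abelian_group A for A :: "'a cstar" (structure) +
  assumes m_closed: "\<lbrakk>x \<in> carrier A; y \<in> carrier A\<rbrakk> \<Longrightarrow> x \<otimes> y \<in> carrier A"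
    and m_assoc: "\<lbrakk>x \<in> carrier A; y \<in> carrier A; z \<in> carrier A\<rbrakk>
      \<Longrightarrow> (x \<otimes> y) \<otimes> z = x \<otimes> (y \<otimes> z)"
    and l_distr: "\<lbrakk>x \<in> carrier A; y \<in> carrier A; z \<in> carrier A\<rbrakk>
      \<Longrightarrow> (x \<oplus> y) \<otimes> z = x \<otimes> z \<oplus> y \<otimes> z"
    and r_distr: "\<lbrakk>x \<in> carrier A; y \<in> carrier A; z \<in> carrier A\<rbrakk>
      \<Longrightarrow> z \<otimes> (x \<oplus> y) = z \<otimes> x \<oplus> z \<otimes> y"
    and scale_closed: "x \<in> carrier A \<Longrightarrow> c \<odot> x \<in> carrier A"
    and scale_add: "\<lbrakk>x \<in> carrier A; y \<in> carrier A\<rbrakk> \<Longrightarrow> c \<odot> (x \<oplus> y) = c \<odot> x \<oplus> c \<odot> y"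
    and add_scale: "x \<in> carrier A \<Longrightarrow> (c + d) \<odot> x = c \<odot> x \<oplus> d \<odot> x"
    and scale_scale: "x \<in> carrier A \<Longrightarrow> c \<odot> (d \<odot> x) = (c * d) \<odot> x"
    and scale_one: "x \<in> carrier A \<Longrightarrow> 1 \<odot> x = x"
    and scale_mult_left: "\<lbrakk>x \<in> carrier A; y \<in> carrier A\<rbrakk> \<Longrightarrow> (c \<odot> x) \<otimes> y = c \<odot> (x \<otimes> y)"
    and scale_mult_right: "\<lbrakk>x \<in> carrier A; y \<in> carrier A\<rbrakk> \<Longrightarrow> x \<otimes> (c \<odot> y) = c \<odot> (x \<otimes> y)"
    and adj_closed: "x \<in> carrier A \<Longrightarrow> x\<^sup>\<star> \<in> carrier A"
    and adj_adj: "x \<in> carrier A \<Longrightarrow> (x\<^sup>\<star>)\<^sup>\<star> = x"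
    and adj_add: "\<lbrakk>x \<in> carrier A; y \<in> carrier A\<rbrakk> \<Longrightarrow> (x \<oplus> y)\<^sup>\<star> = x\<^sup>\<star> \<oplus> y\<^sup>\<star>"
    and adj_scale: "x \<in> carrier A \<Longrightarrow> (c \<odot> x)\<^sup>\<star> = cnj c \<odot> x\<^sup>\<star>"
    and adj_mult: "\<lbrakk>x \<in> carrier A; y \<in> carrier A\<rbrakk> \<Longrightarrow> (x \<otimes> y)\<^sup>\<star> = y\<^sup>\<star> \<otimes> x\<^sup>\<star>"

locale cstar_algebra = star_algebra A for A :: "'a cstar" (structure) +
  assumes norm_zero_iff: "x \<in> carrier A \<Longrightarrow> cnorm A x = 0 \<longleftrightarrow> x = \<zero>"
    and norm_triangle: "\<lbrakk>x \<in> carrier A; y \<in> carrier A\<rbrakk>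
      \<Longrightarrow> cnorm A (x \<oplus> y) \<le> cnorm A x + cnorm A y"
    and norm_scale: "x \<in> carrier A \<Longrightarrow> cnorm A (c \<odot> x) = cmod c * cnorm A x"
    and norm_mult_le: "\<lbrakk>x \<in> carrier A; y \<in> carrier A\<rbrakk>
      \<Longrightarrow> cnorm A (x \<otimes> y) \<le> cnorm A x * cnorm A y"
    and cstar_identity: "x \<in> carrier A \<Longrightarrow> cnorm A (x\<^sup>\<star> \<otimes> x) = (cnorm A x)\<^sup>2"
    and complete: "\<lbrakk>\<And>n. X n \<in> carrier A;
        \<And>e. e > 0 \<Longrightarrow> \<exists>N. \<forall>m\<ge>N. \<forall>n\<ge>N. cnorm A (X m \<ominus> X n) < e\<rbrakk>
      \<Longrightarrow> \<exists>x\<in>carrier A. (\<lambda>n::nat. cnorm A (X n \<ominus> x)) \<longlonglongrightarrow> 0"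

definition star_hom :: "'a cstar \<Rightarrow> 'b cstar \<Rightarrow> ('a \<Rightarrow> 'b) \<Rightarrow> bool" where
  "star_hom A B f \<longleftrightarrow>
     f \<in> carrier A \<rightarrow> carrier B \<and>
     (\<forall>x\<in>carrier A. \<forall>y\<in>carrier A. f (x \<oplus>\<^bsub>A\<^esub> y) = f x \<oplus>\<^bsub>B\<^esub> f y) \<and>
     (\<forall>x\<in>carrier A. \<forall>y\<in>carrier A. f (x \<otimes>\<^bsub>A\<^esub> y) = f x \<otimes>\<^bsub>B\<^esub> f y) \<and>
     (\<forall>c. \<forall>x\<in>carrier A. f (c \<odot>\<^bsub>A\<^esub> x) = c \<odot>\<^bsub>B\<^esub> f x) \<and>
     (\<forall>x\<in>carrier A. f (x\<^sup>\<star>\<^bsub>A\<^esub>) = (f x)\<^sup>\<star>\<^bsub>B\<^esub>)"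

definition star_iso :: "'a cstar \<Rightarrow> 'b cstar \<Rightarrow> ('a \<Rightarrow> 'b) \<Rightarrow> bool" where
  "star_iso A B f \<longleftrightarrow> star_hom A B f \<and> bij_betw f (carrier A) (carrier B)"

definition projection :: "'a cstar \<Rightarrow> 'a \<Rightarrow> bool" where
  "projection A x \<longleftrightarrow> x \<in> carrier A \<and> x\<^sup>\<star>\<^bsub>A\<^esub> = x \<and> x \<otimes>\<^bsub>A\<^esub> x = x"

definition closed_star_subalgebra :: "'a cstar \<Rightarrow> 'a set \<Rightarrow> bool" where
  "closed_star_subalgebra A B \<longleftrightarrow>
     B \<subseteq> carrier A \<and> \<zero>\<^bsub>A\<^esub> \<in> B \<and>
     (\<forall>x\<in>B. \<forall>y\<in>B. x \<oplus>\<^bsub>A\<^esub> y \<in> B) \<and>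
     (\<forall>x\<in>B. \<forall>y\<in>B. x \<otimes>\<^bsub>A\<^esub> y \<in> B) \<and>
     (\<forall>c. \<forall>x\<in>B. c \<odot>\<^bsub>A\<^esub> x \<in> B) \<and>
     (\<forall>x\<in>B. x\<^sup>\<star>\<^bsub>A\<^esub> \<in> B) \<and>
     (\<forall>X. \<forall>x\<in>carrier A. (\<forall>n::nat. X n \<in> B) \<longrightarrow>
        (\<lambda>n. cnorm A (X n \<ominus>\<^bsub>A\<^esub> x)) \<longlonglongrightarrow> 0 \<longrightarrow> x \<in> B)"

definition cstar_generated :: "'a cstar \<Rightarrow> 'a set \<Rightarrow> 'a set" where
  "cstar_generated A S = \<Inter>{B. closed_star_subalgebra A B \<and> S \<subseteq> B}"

text \<open>The \<open>\<ell>\<^sup>\<infinity>\<close>-direct product of a family of C*-algebras. The element 0 is inserted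
  below the supremum only to cover an empty index set.\<close>

definition cstar_product :: "'i set \<Rightarrow> ('i \<Rightarrow> 'a cstar) \<Rightarrow> ('i \<Rightarrow> 'a) cstar" where
  "cstar_product I A =
     \<lparr> carrier = {x \<in> (\<Pi>\<^sub>E i\<in>I. carrier (A i)). bdd_above ((\<lambda>i. cnorm (A i) (x i)) ` I)},
       mult = (\<lambda>x y. \<lambda>i\<in>I. x i \<otimes>\<^bsub>A i\<^esub> y i),
       one = undefined,
       zero = (\<lambda>i\<in>I. \<zero>\<^bsub>A i\<^esub>),
       add = (\<lambda>x y. \<lambda>i\<in>I. x i \<oplus>\<^bsub>A i\<^esub> y i),
       cscale = (\<lambda>c x. \<lambda>i\<in>I. c \<odot>\<^bsub>A i\<^esub> x i),
       adj = (\<lambda>x. \<lambda>i\<in>I. (x i)\<^sup>\<star>\<^bsub>A i\<^esub>),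
       cnorm = (\<lambda>x. Sup (insert 0 ((\<lambda>i. cnorm (A i) (x i)) ` I))) \<rparr>"


section \<open>Universal C*-algebras\<close>

text \<open>
  A notion of representation \<open>P\<close> is a property of a C*-algebra \<open>A\<close> together with a family
  \<open>g\<close> of elements of \<open>A\<close> indexed by a set \<open>G\<close> of generators. The universal C*-algebra
  generated by such a representation is constructed in the usual way: it is the
  C*-subalgebra, generated by the diagonal family, of the product over a set of
  representations that contains every representation up to isomorphism.

  Since HOL cannot quantify over all types inside a definition, the underlying sets of the
  C*-algebras in that product are taken inside one fixed type. Every element of a C*-algebra
  generated by a family indexed by \<open>'g\<close> is the limit of a sequence of *-polynomials
  (without constant term) in the generators, so sequences of such polynomials provide enough
  room; the theorems \<open>CK_universal\<close> and \<open>kgraph_universal\<close> below establish the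
  universal property with respect to C*-algebras of arbitrary type.
\<close>

datatype 'g star_poly =
    Gen 'g
  | Zero
  | Add "'g star_poly" "'g star_poly"
  | Mult "'g star_poly" "'g star_poly"
  | Scale complex "'g star_poly"
  | Adj "'g star_poly"

type_synonym 'g univ_carrier = "nat \<Rightarrow> 'g star_poly"
type_synonym 'g rep = "'g univ_carrier cstar \<times> ('g \<Rightarrow> 'g univ_carrier)"

definition univ_reps ::
    "('g univ_carrier cstar \<Rightarrow> ('g \<Rightarrow> 'g univ_carrier) \<Rightarrow> bool) \<Rightarrow> 'g rep set" where
  "univ_reps P = {(A, g). cstar_algebra A \<and> P A g}"

definition univ_gen ::
    "('g univ_carrier cstar \<Rightarrow> ('g \<Rightarrow> 'g univ_carrier) \<Rightarrow> bool) \<Rightarrow>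
     'g \<Rightarrow> ('g rep \<Rightarrow> 'g univ_carrier)" where
  "univ_gen P a = (\<lambda>\<rho>\<in>univ_reps P. snd \<rho> a)"

definition univ_algebra ::
    "'g set \<Rightarrow> ('g univ_carrier cstar \<Rightarrow> ('g \<Rightarrow> 'g univ_carrier) \<Rightarrow> bool) \<Rightarrow>
     ('g rep \<Rightarrow> 'g univ_carrier) cstar" where
  "univ_algebra G P =
     (cstar_product (univ_reps P) fst)
       \<lparr>carrier := cstar_generated (cstar_product (univ_reps P) fst) (univ_gen P ` G)\<rparr>"


section \<open>Higher-rank graphs\<close>

text \<open>The monoid \<open>\<nat>\<^sup>k\<close> is rendered as the functions \<open>nat \<Rightarrow> nat\<close> supported on
  \<open>{1..k}\<close> with pointwise addition and order, so that \<open>k = 0\<close> is included.\<close>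

definition multi_nat :: "nat \<Rightarrow> (nat \<Rightarrow> nat) set" where
  "multi_nat k = {n. \<forall>i. i \<notin> {1..k} \<longrightarrow> n i = 0}"

definition unit_deg :: "nat \<Rightarrow> (nat \<Rightarrow> nat)" where
  "unit_deg i = (\<lambda>j. if j = i then 1 else 0)"

definition ones_deg :: "nat \<Rightarrow> (nat \<Rightarrow> nat)" where
  "ones_deg k = (\<lambda>j. if j \<in> {1..k} then 1 else 0)"

definition deg_size :: "nat \<Rightarrow> (nat \<Rightarrow> nat) \<Rightarrow> nat" where
  "deg_size k n = (\<Sum>i=1..k. n i)"

text \<open>Objects are identified with their identity morphisms, so \<open>rng\<close> and \<open>src\<close> are maps
  on morphisms; \<open>cmp \<Lambda> \<mu> \<nu>\<close> is the composite \<open>\<mu>\<nu>\<close>, meaningful when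
  \<open>src \<Lambda> \<mu> = rng \<Lambda> \<nu>\<close>.\<close>

record 'e kgraph =
  mor :: "'e set"
  rng :: "'e \<Rightarrow> 'e"
  src :: "'e \<Rightarrow> 'e"
  cmp :: "'e \<Rightarrow> 'e \<Rightarrow> 'e"
  deg :: "'e \<Rightarrow> nat \<Rightarrow> nat"

locale k_graph =
  fixes k :: nat and \<Lambda> :: "'e kgraph"
  assumes nonempty: "mor \<Lambda> \<noteq> {}"
    and countable: "countable (mor \<Lambda>)"
    and rng_closed: "\<mu> \<in> mor \<Lambda> \<Longrightarrow> rng \<Lambda> \<mu> \<in> mor \<Lambda>"
    and src_closed: "\<mu> \<in> mor \<Lambda> \<Longrightarrow> src \<Lambda> \<mu> \<in> mor \<Lambda>"
    and rng_rng: "\<mu> \<in> mor \<Lambda> \<Longrightarrow> rng \<Lambda> (rng \<Lambda> \<mu>) = rng \<Lambda> \<mu>"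
    and src_rng: "\<mu> \<in> mor \<Lambda> \<Longrightarrow> src \<Lambda> (rng \<Lambda> \<mu>) = rng \<Lambda> \<mu>"
    and rng_src: "\<mu> \<in> mor \<Lambda> \<Longrightarrow> rng \<Lambda> (src \<Lambda> \<mu>) = src \<Lambda> \<mu>"
    and src_src: "\<mu> \<in> mor \<Lambda> \<Longrightarrow> src \<Lambda> (src \<Lambda> \<mu>) = src \<Lambda> \<mu>"
    and cmp_closed: "\<lbrakk>\<mu> \<in> mor \<Lambda>; \<nu> \<in> mor \<Lambda>; src \<Lambda> \<mu> = rng \<Lambda> \<nu>\<rbrakk> \<Longrightarrow> cmp \<Lambda> \<mu> \<nu> \<in> mor \<Lambda>"
    and rng_cmp: "\<lbrakk>\<mu> \<in> mor \<Lambda>; \<nu> \<in> mor \<Lambda>; src \<Lambda> \<mu> = rng \<Lambda> \<nu>\<rbrakk> \<Longrightarrow> rng \<Lambda> (cmp \<Lambda> \<mu> \<nu>) = rng \<Lambda> \<mu>"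
    and src_cmp: "\<lbrakk>\<mu> \<in> mor \<Lambda>; \<nu> \<in> mor \<Lambda>; src \<Lambda> \<mu> = rng \<Lambda> \<nu>\<rbrakk> \<Longrightarrow> src \<Lambda> (cmp \<Lambda> \<mu> \<nu>) = src \<Lambda> \<nu>"
    and cmp_assoc: "\<lbrakk>\<mu> \<in> mor \<Lambda>; \<nu> \<in> mor \<Lambda>; \<xi> \<in> mor \<Lambda>;
        src \<Lambda> \<mu> = rng \<Lambda> \<nu>; src \<Lambda> \<nu> = rng \<Lambda> \<xi>\<rbrakk>
      \<Longrightarrow> cmp \<Lambda> (cmp \<Lambda> \<mu> \<nu>) \<xi> = cmp \<Lambda> \<mu> (cmp \<Lambda> \<nu> \<xi>)"
    and cmp_rng: "\<mu> \<in> mor \<Lambda> \<Longrightarrow> cmp \<Lambda> (rng \<Lambda> \<mu>) \<mu> = \<mu>"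
    and cmp_src: "\<mu> \<in> mor \<Lambda> \<Longrightarrow> cmp \<Lambda> \<mu> (src \<Lambda> \<mu>) = \<mu>"
    and deg_closed: "\<mu> \<in> mor \<Lambda> \<Longrightarrow> deg \<Lambda> \<mu> \<in> multi_nat k"
    and deg_rng: "\<mu> \<in> mor \<Lambda> \<Longrightarrow> deg \<Lambda> (rng \<Lambda> \<mu>) = 0"
    and deg_src: "\<mu> \<in> mor \<Lambda> \<Longrightarrow> deg \<Lambda> (src \<Lambda> \<mu>) = 0"
    and deg_cmp: "\<lbrakk>\<mu> \<in> mor \<Lambda>; \<nu> \<in> mor \<Lambda>; src \<Lambda> \<mu> = rng \<Lambda> \<nu>\<rbrakk>
      \<Longrightarrow> deg \<Lambda> (cmp \<Lambda> \<mu> \<nu>) = deg \<Lambda> \<mu> + deg \<Lambda> \<nu>"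
    and factorisation: "\<lbrakk>\<xi> \<in> mor \<Lambda>; m \<in> multi_nat k; n \<in> multi_nat k; deg \<Lambda> \<xi> = m + n\<rbrakk>
      \<Longrightarrow> \<exists>!(\<mu>, \<nu>). \<mu> \<in> mor \<Lambda> \<and> \<nu> \<in> mor \<Lambda> \<and> deg \<Lambda> \<mu> = m \<and> deg \<Lambda> \<nu> = n \<and>
            src \<Lambda> \<mu> = rng \<Lambda> \<nu> \<and> \<xi> = cmp \<Lambda> \<mu> \<nu>"

definition of_deg :: "'e kgraph \<Rightarrow> (nat \<Rightarrow> nat) \<Rightarrow> 'e set" where
  "of_deg \<Lambda> n = {\<mu> \<in> mor \<Lambda>. deg \<Lambda> \<mu> = n}"

definition of_deg_at :: "'e kgraph \<Rightarrow> 'e \<Rightarrow> (nat \<Rightarrow> nat) \<Rightarrow> 'e set" where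
  "of_deg_at \<Lambda> v n = {\<mu> \<in> of_deg \<Lambda> n. rng \<Lambda> \<mu> = v}"

definition vertices :: "'e kgraph \<Rightarrow> 'e set" where
  "vertices \<Lambda> = of_deg \<Lambda> 0"

definition edges :: "nat \<Rightarrow> 'e kgraph \<Rightarrow> 'e set" where
  "edges k \<Lambda> = (\<Union>i\<in>{1..k}. of_deg \<Lambda> (unit_deg i))"

lemma (in k_graph) vertices_eq_identities:
  "vertices \<Lambda> = {v \<in> mor \<Lambda>. rng \<Lambda> v = v \<and> src \<Lambda> v = v}"
proof -
  have "rng \<Lambda> v = v \<and> src \<Lambda> v = v" if v: "v \<in> mor \<Lambda>" and d: "deg \<Lambda> v = 0" for v
  proof -
    have 0: "0 \<in> multi_nat k" by (simp add: multi_nat_def)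
    have "\<exists>!(\<mu>, \<nu>). \<mu> \<in> mor \<Lambda> \<and> \<nu> \<in> mor \<Lambda> \<and> deg \<Lambda> \<mu> = 0 \<and> deg \<Lambda> \<nu> = 0 \<and>
            src \<Lambda> \<mu> = rng \<Lambda> \<nu> \<and> v = cmp \<Lambda> \<mu> \<nu>"
      by (rule factorisation[OF v 0 0]) (simp add: d zero_fun_def plus_fun_def)
    then have "(rng \<Lambda> v, v) = (v, src \<Lambda> v)"
      by (rule ex1E) (use v d in \<open>auto simp: rng_closed src_closed deg_rng deg_src src_rng rng_src cmp_rng cmp_src\<close>)
    then show ?thesis by auto
  qed
  then show ?thesis
    unfolding vertices_def of_deg_def using deg_rng by fastforce
qed

definition row_finite :: "nat \<Rightarrow> 'e kgraph \<Rightarrow> bool" where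
  "row_finite k \<Lambda> \<longleftrightarrow> (\<forall>v\<in>vertices \<Lambda>. \<forall>n\<in>multi_nat k. finite (of_deg_at \<Lambda> v n))"

definition locally_convex :: "nat \<Rightarrow> 'e kgraph \<Rightarrow> bool" where
  "locally_convex k \<Lambda> \<longleftrightarrow>
     (\<forall>i\<in>{1..k}. \<forall>j\<in>{1..k}. i \<noteq> j \<longrightarrow>
        (\<forall>\<mu>\<in>of_deg \<Lambda> (unit_deg i).
           of_deg_at \<Lambda> (rng \<Lambda> \<mu>) (unit_deg j) \<noteq> {} \<longrightarrow>
           of_deg_at \<Lambda> (src \<Lambda> \<mu>) (unit_deg j) \<noteq> {}))"


section \<open>Cubical cohomology with coefficients in the circle\<close>

definition cubes :: "nat \<Rightarrow> 'e kgraph \<Rightarrow> nat \<Rightarrow> 'e set" where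
  "cubes k \<Lambda> r = {\<mu> \<in> mor \<Lambda>. deg \<Lambda> \<mu> \<le> ones_deg k \<and> deg_size k (deg \<Lambda> \<mu>) = r}"

text \<open>For \<open>d(\<mu>) = e\<^bsub>i\<^sub>1\<^esub> + \<dots> + e\<^bsub>i\<^sub>r\<^esub>\<close> with \<open>i\<^sub>1 < \<dots> < i\<^sub>r\<close>, this is
  \<open>i\<^sub>j\<close>, for \<open>1 \<le> j \<le> r\<close>.\<close>

definition cube_dir :: "nat \<Rightarrow> 'e kgraph \<Rightarrow> nat \<Rightarrow> 'e \<Rightarrow> nat" where
  "cube_dir k \<Lambda> j \<mu> = sorted_list_of_set {i \<in> {1..k}. deg \<Lambda> \<mu> i \<noteq> 0} ! (j - 1)"

text \<open>\<open>face k \<Lambda> l j \<mu>\<close> is \<open>F\<^sub>j\<^sup>l(\<mu>)\<close>, for \<open>l \<in> {0, 1}\<close>.\<close>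

definition face :: "nat \<Rightarrow> 'e kgraph \<Rightarrow> nat \<Rightarrow> nat \<Rightarrow> 'e \<Rightarrow> 'e" where
  "face k \<Lambda> l j \<mu> =
     (THE \<nu>. \<nu> \<in> cubes k \<Lambda> (deg_size k (deg \<Lambda> \<mu>) - 1) \<and>
        (\<exists>\<beta>\<in>of_deg \<Lambda> (unit_deg (cube_dir k \<Lambda> j \<mu>)).
           if l = 0 then src \<Lambda> \<nu> = rng \<Lambda> \<beta> \<and> cmp \<Lambda> \<nu> \<beta> = \<mu>
           else src \<Lambda> \<beta> = rng \<Lambda> \<nu> \<and> cmp \<Lambda> \<beta> \<nu> = \<mu>))"

text \<open>Cochains are only constrained on cubes; two functions represent the same cochain iff
  they agree there.\<close>

definition cochains :: "nat \<Rightarrow> 'e kgraph \<Rightarrow> nat \<Rightarrow> ('e \<Rightarrow> complex) set" where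
  "cochains k \<Lambda> r = cubes k \<Lambda> r \<rightarrow> {z. cmod z = 1}"

definition coboundary :: "nat \<Rightarrow> 'e kgraph \<Rightarrow> nat \<Rightarrow> ('e \<Rightarrow> complex) \<Rightarrow> 'e \<Rightarrow> complex" where
  "coboundary k \<Lambda> r f \<mu> =
     (\<Prod>i=1..r+1. \<Prod>l=0..1. f (face k \<Lambda> l i \<mu>) powi ((-1) ^ (i + l)))"

definition cocycles2 :: "nat \<Rightarrow> 'e kgraph \<Rightarrow> ('e \<Rightarrow> complex) set" where
  "cocycles2 k \<Lambda> = {f \<in> cochains k \<Lambda> 2. \<forall>\<mu>\<in>cubes k \<Lambda> 3. coboundary k \<Lambda> 2 f \<mu> = 1}"


section \<open>Twisted and untwisted algebras of a k-graph\<close>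

definition CK_family ::
    "nat \<Rightarrow> 'e kgraph \<Rightarrow> ('e \<Rightarrow> complex) \<Rightarrow> 'a cstar \<Rightarrow> ('e \<Rightarrow> 'a) \<Rightarrow> ('e \<Rightarrow> 'a) \<Rightarrow> bool" where
  "CK_family k \<Lambda> \<phi> A p s \<longleftrightarrow>
     (\<forall>v\<in>vertices \<Lambda>. projection A (p v)) \<and>
     (\<forall>v\<in>vertices \<Lambda>. \<forall>w\<in>vertices \<Lambda>. v \<noteq> w \<longrightarrow> p v \<otimes>\<^bsub>A\<^esub> p w = \<zero>\<^bsub>A\<^esub>) \<and>
     (\<forall>\<mu>\<in>edges k \<Lambda>. s \<mu> \<in> carrier A) \<and>
     (\<forall>\<mu>\<in>edges k \<Lambda>. (s \<mu>)\<^sup>\<star>\<^bsub>A\<^esub> \<otimes>\<^bsub>A\<^esub> s \<mu> = p (src \<Lambda> \<mu>)) \<and>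
     (\<forall>i\<in>{1..k}. \<forall>j\<in>{1..k}. i < j \<longrightarrow>
        (\<forall>\<mu>\<in>of_deg \<Lambda> (unit_deg i). \<forall>\<mu>'\<in>of_deg \<Lambda> (unit_deg i).
         \<forall>\<nu>\<in>of_deg \<Lambda> (unit_deg j). \<forall>\<nu>'\<in>of_deg \<Lambda> (unit_deg j).
           src \<Lambda> \<mu> = rng \<Lambda> \<nu> \<longrightarrow> src \<Lambda> \<nu>' = rng \<Lambda> \<mu>' \<longrightarrow>
           cmp \<Lambda> \<mu> \<nu> = cmp \<Lambda> \<nu>' \<mu>' \<longrightarrow>
           s \<nu>' \<otimes>\<^bsub>A\<^esub> s \<mu>' = \<phi> (cmp \<Lambda> \<mu> \<nu>) \<odot>\<^bsub>A\<^esub> (s \<mu> \<otimes>\<^bsub>A\<^esub> s \<nu>))) \<and>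
     (\<forall>v\<in>vertices \<Lambda>. \<forall>i\<in>{1..k}. of_deg_at \<Lambda> v (unit_deg i) \<noteq> {} \<longrightarrow>
        p v = (\<Oplus>\<^bsub>A\<^esub>\<mu>\<in>of_deg_at \<Lambda> v (unit_deg i). s \<mu> \<otimes>\<^bsub>A\<^esub> (s \<mu>)\<^sup>\<star>\<^bsub>A\<^esub>))"

text \<open>\<open>v\<Lambda>\<^sup>\<le>\<^sup>m\<close>\<close>

definition paths_le :: "nat \<Rightarrow> 'e kgraph \<Rightarrow> 'e \<Rightarrow> (nat \<Rightarrow> nat) \<Rightarrow> 'e set" where
  "paths_le k \<Lambda> v m =
     {\<mu> \<in> mor \<Lambda>. rng \<Lambda> \<mu> = v \<and> deg \<Lambda> \<mu> \<le> m \<and>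
        (\<forall>i\<in>{1..k}. deg \<Lambda> \<mu> + unit_deg i \<le> m \<longrightarrow> of_deg_at \<Lambda> (src \<Lambda> \<mu>) (unit_deg i) = {})}"

definition kgraph_family ::
    "nat \<Rightarrow> 'e kgraph \<Rightarrow> 'a cstar \<Rightarrow> ('e \<Rightarrow> 'a) \<Rightarrow> bool" where
  "kgraph_family k \<Lambda> A t \<longleftrightarrow>
     (\<forall>\<mu>\<in>mor \<Lambda>. t \<mu> \<in> carrier A \<and> t \<mu> \<otimes>\<^bsub>A\<^esub> (t \<mu>)\<^sup>\<star>\<^bsub>A\<^esub> \<otimes>\<^bsub>A\<^esub> t \<mu> = t \<mu>) \<and>
     (\<forall>v\<in>vertices \<Lambda>. projection A (t v)) \<and>
     (\<forall>v\<in>vertices \<Lambda>. \<forall>w\<in>vertices \<Lambda>. v \<noteq> w \<longrightarrow> t v \<otimes>\<^bsub>A\<^esub> t w = \<zero>\<^bsub>A\<^esub>) \<and>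
     (\<forall>\<mu>\<in>mor \<Lambda>. \<forall>\<nu>\<in>mor \<Lambda>. src \<Lambda> \<mu> = rng \<Lambda> \<nu> \<longrightarrow> t \<mu> \<otimes>\<^bsub>A\<^esub> t \<nu> = t (cmp \<Lambda> \<mu> \<nu>)) \<and>
     (\<forall>\<mu>\<in>mor \<Lambda>. (t \<mu>)\<^sup>\<star>\<^bsub>A\<^esub> \<otimes>\<^bsub>A\<^esub> t \<mu> = t (src \<Lambda> \<mu>)) \<and>
     (\<forall>v\<in>vertices \<Lambda>. \<forall>m\<in>multi_nat k.
        t v = (\<Oplus>\<^bsub>A\<^esub>\<mu>\<in>paths_le k \<Lambda> v m. t \<mu> \<otimes>\<^bsub>A\<^esub> (t \<mu>)\<^sup>\<star>\<^bsub>A\<^esub>))"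

text \<open>The twisted algebra \<open>C\<^sup>*\<^sub>\<phi>(\<Lambda>)\<close> has one generator \<open>Inl v\<close> for each vertex and one
  generator \<open>Inr \<mu>\<close> for each edge; \<open>CK_p\<close> and \<open>CK_s\<close> are its universal generating
  representation.\<close>

definition CK_rep ::
    "nat \<Rightarrow> 'e kgraph \<Rightarrow> ('e \<Rightarrow> complex) \<Rightarrow> 'a cstar \<Rightarrow> ('e + 'e \<Rightarrow> 'a) \<Rightarrow> bool" where
  "CK_rep k \<Lambda> \<phi> A g \<longleftrightarrow> CK_family k \<Lambda> \<phi> A (\<lambda>v. g (Inl v)) (\<lambda>\<mu>. g (Inr \<mu>))"

definition CK_algebra ::
    "nat \<Rightarrow> 'e kgraph \<Rightarrow> ('e \<Rightarrow> complex) \<Rightarrow>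
     (('e + 'e) rep \<Rightarrow> ('e + 'e) univ_carrier) cstar" where
  "CK_algebra k \<Lambda> \<phi> = univ_algebra (vertices \<Lambda> <+> edges k \<Lambda>) (CK_rep k \<Lambda> \<phi>)"

definition CK_p ::
    "nat \<Rightarrow> 'e kgraph \<Rightarrow> ('e \<Rightarrow> complex) \<Rightarrow> 'e \<Rightarrow> (('e + 'e) rep \<Rightarrow> ('e + 'e) univ_carrier)" where
  "CK_p k \<Lambda> \<phi> v = univ_gen (CK_rep k \<Lambda> \<phi>) (Inl v)"

definition CK_s ::
    "nat \<Rightarrow> 'e kgraph \<Rightarrow> ('e \<Rightarrow> complex) \<Rightarrow> 'e \<Rightarrow> (('e + 'e) rep \<Rightarrow> ('e + 'e) univ_carrier)" where
  "CK_s k \<Lambda> \<phi> \<mu> = univ_gen (CK_rep k \<Lambda> \<phi>) (Inr \<mu>)"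

definition kgraph_algebra :: "nat \<Rightarrow> 'e kgraph \<Rightarrow> ('e rep \<Rightarrow> 'e univ_carrier) cstar" where
  "kgraph_algebra k \<Lambda> = univ_algebra (mor \<Lambda>) (kgraph_family k \<Lambda>)"

definition kgraph_t :: "nat \<Rightarrow> 'e kgraph \<Rightarrow> 'e \<Rightarrow> ('e rep \<Rightarrow> 'e univ_carrier)" where
  "kgraph_t k \<Lambda> \<mu> = univ_gen (kgraph_family k \<Lambda>) \<mu>"


section \<open>The universal property\<close>


context star_algebra
begin

lemma scale_0_zero: assumes "x \<in> carrier A" shows "0 \<odot> x = \<zero>"
proof -
  have "0 \<odot> x \<oplus> 0 \<odot> x = 0 \<odot> x" using add_scale[OF assms, of 0 0] by simp
  then show ?thesis using scale_closed[OF assms, of 0] by (metis add.r_cancel_one)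
qed

lemma a_inv_eq_scale: assumes "x \<in> carrier A" shows "\<ominus> x = (-1) \<odot> x"
proof -
  have "(-1) \<odot> x \<oplus> x = \<zero>"
    using add_scale[OF assms, of "-1" 1] by (simp add: scale_0_zero scale_one assms)
  then show ?thesis
    using assms by (metis add.inv_equality scale_closed)
qed

lemma minus_eq_scale: "\<lbrakk>x \<in> carrier A; y \<in> carrier A\<rbrakk> \<Longrightarrow> x \<ominus> y = x \<oplus> (-1) \<odot> y"
  by (simp add: a_minus_def a_inv_eq_scale)

end

lemma star_homD:
  assumes "star_hom A B f"
  shows "x \<in> carrier A \<Longrightarrow> f x \<in> carrier B"
    and "\<lbrakk>x \<in> carrier A; y \<in> carrier A\<rbrakk> \<Longrightarrow> f (x \<oplus>\<^bsub>A\<^esub> y) = f x \<oplus>\<^bsub>B\<^esub> f y"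
    and "\<lbrakk>x \<in> carrier A; y \<in> carrier A\<rbrakk> \<Longrightarrow> f (x \<otimes>\<^bsub>A\<^esub> y) = f x \<otimes>\<^bsub>B\<^esub> f y"
    and "x \<in> carrier A \<Longrightarrow> f (c \<odot>\<^bsub>A\<^esub> x) = c \<odot>\<^bsub>B\<^esub> f x"
    and "x \<in> carrier A \<Longrightarrow> f (x\<^sup>\<star>\<^bsub>A\<^esub>) = (f x)\<^sup>\<star>\<^bsub>B\<^esub>"
  using assms by (auto simp: star_hom_def)

lemma star_hom_comp:
  assumes f: "star_hom A B f" and g: "star_hom B C g"
  shows "star_hom A C (\<lambda>x. g (f x))"
  unfolding star_hom_def by (auto simp: star_homD[OF f] star_homD[OF g])

lemma star_hom_zero:
  assumes "star_hom A B f" "star_algebra A" "star_algebra B"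
  shows "f \<zero>\<^bsub>A\<^esub> = \<zero>\<^bsub>B\<^esub>"
proof -
  interpret A: star_algebra A by fact
  interpret B: star_algebra B by fact
  have z: "\<zero>\<^bsub>A\<^esub> \<in> carrier A" by simp
  show ?thesis
    using star_homD(4)[OF assms(1) z, of 0] star_homD(1)[OF assms(1) z]
    by (simp add: A.scale_0_zero B.scale_0_zero)
qed

lemma star_hom_minus:
  assumes f: "star_hom A B f" and "star_algebra A" "star_algebra B"
    and "x \<in> carrier A" "y \<in> carrier A"
  shows "f (x \<ominus>\<^bsub>A\<^esub> y) = f x \<ominus>\<^bsub>B\<^esub> f y"
proof -
  interpret A: star_algebra A by fact
  interpret B: star_algebra B by fact
  show ?thesis using assms(4,5)
    by (simp add: A.minus_eq_scale B.minus_eq_scale star_homD[OF f] A.scale_closed)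
qed

lemma star_hom_finsum:
  assumes f: "star_hom A B f" and "star_algebra A" "star_algebra B"
    and g: "g \<in> S \<rightarrow> carrier A"
  shows "f (finsum A g S) = finsum B (\<lambda>x. f (g x)) S"
proof -
  interpret A: star_algebra A by fact
  interpret B: star_algebra B by fact
  have "f (finsum A g S) = finsum B (\<lambda>x. f (g x)) S" if "finite S"
    using that g
  proof (induction S rule: finite_induct)
    case empty
    then show ?case by (simp add: star_hom_zero[OF assms(1-3)])
  next
    case (insert a S)
    have "finsum A g (insert a S) = g a \<oplus>\<^bsub>A\<^esub> finsum A g S"
      using insert by (intro A.finsum_insert) auto
    moreover have "finsum B (\<lambda>x. f (g x)) (insert a S) = f (g a) \<oplus>\<^bsub>B\<^esub> finsum B (\<lambda>x. f (g x)) S"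
      using insert by (intro B.finsum_insert) (auto intro: star_homD(1)[OF f])
    ultimately show ?case
      using insert by (auto simp: star_homD(2)[OF f])
  qed
  then show ?thesis
    by (cases "finite S") (simp_all add: star_hom_zero[OF assms(1-3)])
qed

lemma star_algebra_jointly:
  fixes A :: "'a cstar" and B :: "'i \<Rightarrow> 'b cstar"
  assumes B: "\<And>i. i \<in> I \<Longrightarrow> star_algebra (B i)"
    and inj: "\<And>x y. \<lbrakk>x \<in> carrier A; y \<in> carrier A; \<And>i. i \<in> I \<Longrightarrow> j i x = j i y\<rbrakk> \<Longrightarrow> x = y"
    and hom: "\<And>i. i \<in> I \<Longrightarrow> star_hom A (B i) (j i)"
    and zero: "\<zero>\<^bsub>A\<^esub> \<in> carrier A" "\<And>i. i \<in> I \<Longrightarrow> j i \<zero>\<^bsub>A\<^esub> = \<zero>\<^bsub>B i\<^esub>"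
    and cl: "\<And>x y. \<lbrakk>x \<in> carrier A; y \<in> carrier A\<rbrakk> \<Longrightarrow> x \<oplus>\<^bsub>A\<^esub> y \<in> carrier A"
      "\<And>x y. \<lbrakk>x \<in> carrier A; y \<in> carrier A\<rbrakk> \<Longrightarrow> x \<otimes>\<^bsub>A\<^esub> y \<in> carrier A"
      "\<And>c x. x \<in> carrier A \<Longrightarrow> c \<odot>\<^bsub>A\<^esub> x \<in> carrier A"
      "\<And>x. x \<in> carrier A \<Longrightarrow> x\<^sup>\<star>\<^bsub>A\<^esub> \<in> carrier A"
  shows "star_algebra A"
proof -
  have ab: "abelian_group (B i)" if "i \<in> I" for i
    using B[OF that] by (simp add: star_algebra_def)
  have abm: "abelian_monoid (B i)" if "i \<in> I" for i
    using ab[OF that] by (simp add: abelian_group_def)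
  note h = star_homD[OF hom]
  note abE = abelian_groupE[OF ab]
  note ax = star_algebra.m_assoc star_algebra.l_distr star_algebra.r_distr
    star_algebra.scale_add star_algebra.add_scale star_algebra.scale_scale star_algebra.scale_one
    star_algebra.scale_mult_left star_algebra.scale_mult_right star_algebra.adj_adj
    star_algebra.adj_add star_algebra.adj_scale star_algebra.adj_mult
  have G: "abelian_group A"
  proof (rule abelian_groupI)
    fix x assume x: "x \<in> carrier A"
    show "\<exists>y\<in>carrier A. y \<oplus>\<^bsub>A\<^esub> x = \<zero>\<^bsub>A\<^esub>"
    proof (rule bexI[where x = "(-1) \<odot>\<^bsub>A\<^esub> x"])
      show "(-1) \<odot>\<^bsub>A\<^esub> x \<oplus>\<^bsub>A\<^esub> x = \<zero>\<^bsub>A\<^esub>"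
      proof (rule inj)
        fix i assume i: "i \<in> I"
        interpret Bi: star_algebra "B i" by (rule B[OF i])
        have jx: "j i x \<in> carrier (B i)" by (rule h(1)[OF i x])
        have "j i ((-1) \<odot>\<^bsub>A\<^esub> x \<oplus>\<^bsub>A\<^esub> x) = (-1) \<odot>\<^bsub>B i\<^esub> j i x \<oplus>\<^bsub>B i\<^esub> j i x"
          using i x by (simp add: h cl)
        also have "\<dots> = \<zero>\<^bsub>B i\<^esub>"
          using Bi.add_scale[OF jx, of "-1" 1] by (simp add: Bi.scale_0_zero Bi.scale_one jx)
        finally show "j i ((-1) \<odot>\<^bsub>A\<^esub> x \<oplus>\<^bsub>A\<^esub> x) = j i \<zero>\<^bsub>A\<^esub>" using zero i by simp
      qed (use x in \<open>auto simp: cl zero\<close>)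
    qed (use x cl in auto)
  next
    fix x y z assume "x \<in> carrier A" "y \<in> carrier A" "z \<in> carrier A"
    then show "x \<oplus>\<^bsub>A\<^esub> y \<oplus>\<^bsub>A\<^esub> z = x \<oplus>\<^bsub>A\<^esub> (y \<oplus>\<^bsub>A\<^esub> z)"
      by (intro inj) (auto simp: h cl abE(3))
  next
    fix x y assume "x \<in> carrier A" "y \<in> carrier A"
    then show "x \<oplus>\<^bsub>A\<^esub> y = y \<oplus>\<^bsub>A\<^esub> x"
      by (intro inj) (auto simp: h cl abE(4))
  next
    fix x assume "x \<in> carrier A"
    then show "\<zero>\<^bsub>A\<^esub> \<oplus>\<^bsub>A\<^esub> x = x"
      by (intro inj) (auto simp: h cl zero abE(5))
  qed (auto simp: cl zero)
  show ?thesis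
    by (intro star_algebra.intro star_algebra_axioms.intro G; (intro inj)?)
      (auto simp: h cl ax[OF B] star_algebra.scale_closed[OF B]
        star_algebra.m_closed[OF B] star_algebra.adj_closed[OF B] abE(1))
qed


context cstar_algebra
begin

lemma norm_zero [simp]: "cnorm A \<zero> = 0"
  using norm_zero_iff by simp

lemma norm_minus_sym: "\<lbrakk>x \<in> carrier A; y \<in> carrier A\<rbrakk> \<Longrightarrow> cnorm A (x \<ominus> y) = cnorm A (y \<ominus> x)"
proof -
  assume xy: "x \<in> carrier A" "y \<in> carrier A"
  have "(-1) \<odot> (y \<ominus> x) = x \<ominus> y"
    using xy by (simp add: minus_eq_scale scale_add scale_scale scale_one scale_closed a_comm)
  then show ?thesis using norm_scale[of "y \<ominus> x" "-1"] xy by simp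
qed

lemma norm_nonneg: "x \<in> carrier A \<Longrightarrow> 0 \<le> cnorm A x"
proof -
  assume x: "x \<in> carrier A"
  have "cnorm A (x \<oplus> (-1) \<odot> x) \<le> cnorm A x + cnorm A x"
    using norm_triangle[of x "(-1) \<odot> x"] norm_scale[of x "-1"] x by (simp add: scale_closed)
  moreover have "x \<oplus> (-1) \<odot> x = \<zero>"
    using x by (simp add: a_inv_eq_scale[symmetric] r_neg)
  ultimately show ?thesis by simp
qed

lemma norm_minus_triangle:
  "\<lbrakk>x \<in> carrier A; y \<in> carrier A; z \<in> carrier A\<rbrakk>
    \<Longrightarrow> cnorm A (x \<ominus> z) \<le> cnorm A (x \<ominus> y) + cnorm A (y \<ominus> z)"
proof -
  assume xyz: "x \<in> carrier A" "y \<in> carrier A" "z \<in> carrier A"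
  have "x \<ominus> z = (x \<ominus> y) \<oplus> (y \<ominus> z)"
    using xyz by (simp add: a_minus_def a_assoc r_neg1 l_neg r_neg2)
  then show ?thesis using norm_triangle[of "x \<ominus> y" "y \<ominus> z"] xyz by simp
qed

lemma norm_le_norm_minus:
  "\<lbrakk>x \<in> carrier A; y \<in> carrier A\<rbrakk> \<Longrightarrow> cnorm A y \<le> cnorm A (x \<ominus> y) + cnorm A x"
  using norm_minus_triangle[of y x \<zero>] norm_minus_sym[of x y]
  by (simp add: a_minus_def minus_equality[of \<zero> \<zero>])

lemma norm_adj: assumes "x \<in> carrier A" shows "cnorm A (x\<^sup>\<star>) = cnorm A x"
proof -
  have le: "cnorm A y \<le> cnorm A (y\<^sup>\<star>)" if y: "y \<in> carrier A" for y
  proof (cases "cnorm A y = 0")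
    case True
    then show ?thesis using norm_nonneg[OF adj_closed[OF y]] by simp
  next
    case False
    then have "cnorm A y > 0" using norm_nonneg[OF y] by simp
    moreover have "cnorm A y * cnorm A y \<le> cnorm A (y\<^sup>\<star>) * cnorm A y"
      using norm_mult_le[OF adj_closed[OF y] y] cstar_identity[OF y] by (simp add: power2_eq_square)
    ultimately show ?thesis by simp
  qed
  show ?thesis using le[OF assms] le[OF adj_closed[OF assms]] adj_adj[OF assms] by simp
qed

lemma limit_unique:
  assumes "x \<in> carrier A" "y \<in> carrier A" "\<And>n. X n \<in> carrier A"
    and "(\<lambda>n. cnorm A (X n \<ominus> x)) \<longlonglongrightarrow> 0" "(\<lambda>n. cnorm A (X n \<ominus> y)) \<longlonglongrightarrow> 0"
  shows "x = y"
proof -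
  have "cnorm A (x \<ominus> y) \<le> 0"
  proof (rule LIMSEQ_le_const)
    show "(\<lambda>n. cnorm A (X n \<ominus> x) + cnorm A (X n \<ominus> y)) \<longlonglongrightarrow> 0"
      using tendsto_add[OF assms(4,5)] by simp
    have "cnorm A (x \<ominus> y) \<le> cnorm A (X n \<ominus> x) + cnorm A (X n \<ominus> y)" for n
      using norm_minus_triangle[of x "X n" y] norm_minus_sym[of x "X n"] assms(1-3) by simp
    then show "\<exists>N. \<forall>n\<ge>N. cnorm A (x \<ominus> y) \<le> cnorm A (X n \<ominus> x) + cnorm A (X n \<ominus> y)" by blast
  qed
  then have "x \<ominus> y = \<zero>"
    using norm_nonneg[of "x \<ominus> y"] norm_zero_iff[of "x \<ominus> y"] assms(1,2) by simp
  then show ?thesis using assms(1,2)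
    by (metis a_minus_def add.inv_closed add.inv_inv add.inv_equality)
qed

lemma projection_norm_le_1: assumes "projection A x" shows "cnorm A x \<le> 1"
proof -
  have x: "x \<in> carrier A" using assms by (simp add: projection_def)
  have "(cnorm A x)\<^sup>2 = cnorm A x"
    using cstar_identity[OF x] assms by (simp add: projection_def)
  then have "cnorm A x * (cnorm A x - 1) = 0" by (simp add: power2_eq_square algebra_simps)
  then show ?thesis by auto
qed

lemma partial_isometry_norm_le_1:
  assumes "x \<in> carrier A" "projection A (x\<^sup>\<star> \<otimes> x)" shows "cnorm A x \<le> 1"
  using projection_norm_le_1[OF assms(2)] cstar_identity[OF assms(1)]
  by (simp add: power_le_one_iff norm_nonneg abs_square_le_1 assms)

end

lemma cstar_algebra_pullback:
  assumes B: "cstar_algebra B"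
    and inj: "inj_on j (carrier A)"
    and hom: "star_hom A B j"
    and zero: "\<zero>\<^bsub>A\<^esub> \<in> carrier A" "j \<zero>\<^bsub>A\<^esub> = \<zero>\<^bsub>B\<^esub>"
    and cl: "\<And>x y. \<lbrakk>x \<in> carrier A; y \<in> carrier A\<rbrakk> \<Longrightarrow> x \<oplus>\<^bsub>A\<^esub> y \<in> carrier A"
      "\<And>x y. \<lbrakk>x \<in> carrier A; y \<in> carrier A\<rbrakk> \<Longrightarrow> x \<otimes>\<^bsub>A\<^esub> y \<in> carrier A"
      "\<And>c x. x \<in> carrier A \<Longrightarrow> c \<odot>\<^bsub>A\<^esub> x \<in> carrier A"
      "\<And>x. x \<in> carrier A \<Longrightarrow> x\<^sup>\<star>\<^bsub>A\<^esub> \<in> carrier A"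
    and norm: "\<And>x. x \<in> carrier A \<Longrightarrow> cnorm A x = cnorm B (j x)"
    and closed: "\<And>X y. \<lbrakk>\<And>n::nat. X n \<in> carrier A; y \<in> carrier B;
        (\<lambda>n. cnorm B (j (X n) \<ominus>\<^bsub>B\<^esub> y)) \<longlonglongrightarrow> 0\<rbrakk> \<Longrightarrow> y \<in> j ` carrier A"
  shows "cstar_algebra A"
proof -
  interpret B: cstar_algebra B by fact
  note Bs = B.star_algebra_axioms
  have A: "star_algebra A"
    by (rule star_algebra_jointly[where I = "{()}" and j = "\<lambda>_. j" and B = "\<lambda>_. B"])
      (use inj in \<open>auto simp: Bs hom zero cl dest: inj_onD\<close>)
  interpret A: star_algebra A by fact
  note h = star_homD[OF hom]
  note hm = star_hom_minus[OF hom A Bs]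
  show ?thesis
  proof (intro cstar_algebra.intro cstar_algebra_axioms.intro A)
    fix x assume x: "x \<in> carrier A"
    show "cnorm A x = 0 \<longleftrightarrow> x = \<zero>\<^bsub>A\<^esub>"
      using x zero inj_on_eq_iff[OF inj x zero(1)] by (simp add: norm B.norm_zero_iff h)
  next
    fix X :: "nat \<Rightarrow> _"
    assume X: "\<And>n. X n \<in> carrier A"
      and C: "\<And>e. e > 0 \<Longrightarrow> \<exists>N. \<forall>m\<ge>N. \<forall>n\<ge>N. cnorm A (X m \<ominus>\<^bsub>A\<^esub> X n) < e"
    have "\<exists>y\<in>carrier B. (\<lambda>n. cnorm B (j (X n) \<ominus>\<^bsub>B\<^esub> y)) \<longlonglongrightarrow> 0"
      by (rule B.complete) (use C X in \<open>auto simp: h norm hm\<close>)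
    then obtain y where y: "y \<in> carrier B" "(\<lambda>n. cnorm B (j (X n) \<ominus>\<^bsub>B\<^esub> y)) \<longlonglongrightarrow> 0" by blast
    then obtain x where x: "x \<in> carrier A" "y = j x" using closed[OF X y] by blast
    show "\<exists>x\<in>carrier A. (\<lambda>n. cnorm A (X n \<ominus>\<^bsub>A\<^esub> x)) \<longlonglongrightarrow> 0"
      using y x X by (intro bexI[of _ x]) (auto simp: norm hm)
  qed (auto simp: norm cl h B.norm_triangle B.norm_scale B.norm_mult_le B.cstar_identity)
qed

lemma closed_star_subalgebraI:
  assumes "C \<subseteq> carrier A" "\<zero>\<^bsub>A\<^esub> \<in> C"
    and "\<And>x y. \<lbrakk>x \<in> C; y \<in> C\<rbrakk> \<Longrightarrow> x \<oplus>\<^bsub>A\<^esub> y \<in> C"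
    and "\<And>x y. \<lbrakk>x \<in> C; y \<in> C\<rbrakk> \<Longrightarrow> x \<otimes>\<^bsub>A\<^esub> y \<in> C"
    and "\<And>c x. x \<in> C \<Longrightarrow> c \<odot>\<^bsub>A\<^esub> x \<in> C"
    and "\<And>x. x \<in> C \<Longrightarrow> x\<^sup>\<star>\<^bsub>A\<^esub> \<in> C"
    and "\<And>X x. \<lbrakk>x \<in> carrier A; \<And>n::nat. X n \<in> C;
      (\<lambda>n. cnorm A (X n \<ominus>\<^bsub>A\<^esub> x)) \<longlonglongrightarrow> 0\<rbrakk> \<Longrightarrow> x \<in> C"
  shows "closed_star_subalgebra A C"
  unfolding closed_star_subalgebra_def
  by (intro conjI ballI allI impI) (simp_all add: assms(1-6), blast intro: assms(7))

lemma closed_star_subalgebraD: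
  assumes "closed_star_subalgebra A C"
  shows "C \<subseteq> carrier A" "\<zero>\<^bsub>A\<^esub> \<in> C"
    and "\<lbrakk>x \<in> C; y \<in> C\<rbrakk> \<Longrightarrow> x \<oplus>\<^bsub>A\<^esub> y \<in> C"
    and "\<lbrakk>x \<in> C; y \<in> C\<rbrakk> \<Longrightarrow> x \<otimes>\<^bsub>A\<^esub> y \<in> C"
    and "x \<in> C \<Longrightarrow> c \<odot>\<^bsub>A\<^esub> x \<in> C"
    and "x \<in> C \<Longrightarrow> x\<^sup>\<star>\<^bsub>A\<^esub> \<in> C"
    and "\<lbrakk>x \<in> carrier A; \<And>n::nat. X n \<in> C;
      (\<lambda>n. cnorm A (X n \<ominus>\<^bsub>A\<^esub> x)) \<longlonglongrightarrow> 0\<rbrakk> \<Longrightarrow> x \<in> C"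
proof -
  note C = assms[unfolded closed_star_subalgebra_def]
  show "C \<subseteq> carrier A" "\<zero>\<^bsub>A\<^esub> \<in> C" using C by simp_all
  show "\<lbrakk>x \<in> C; y \<in> C\<rbrakk> \<Longrightarrow> x \<oplus>\<^bsub>A\<^esub> y \<in> C" "\<lbrakk>x \<in> C; y \<in> C\<rbrakk> \<Longrightarrow> x \<otimes>\<^bsub>A\<^esub> y \<in> C"
    "x \<in> C \<Longrightarrow> c \<odot>\<^bsub>A\<^esub> x \<in> C" "x \<in> C \<Longrightarrow> x\<^sup>\<star>\<^bsub>A\<^esub> \<in> C"
    using C by simp_all
  have "\<forall>X. \<forall>x\<in>carrier A. (\<forall>n::nat. X n \<in> C) \<longrightarrow>
      (\<lambda>n. cnorm A (X n \<ominus>\<^bsub>A\<^esub> x)) \<longlonglongrightarrow> 0 \<longrightarrow> x \<in> C" using C by simp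
  then show "\<lbrakk>x \<in> carrier A; \<And>n::nat. X n \<in> C;
      (\<lambda>n. cnorm A (X n \<ominus>\<^bsub>A\<^esub> x)) \<longlonglongrightarrow> 0\<rbrakk> \<Longrightarrow> x \<in> C" by blast
qed

lemma closed_star_subalgebra_cstar:
  assumes "cstar_algebra A" and C: "closed_star_subalgebra A C"
  shows "cstar_algebra (A\<lparr>carrier := C\<rparr>)" and "star_hom (A\<lparr>carrier := C\<rparr>) A (\<lambda>x. x)"
proof -
  show h: "star_hom (A\<lparr>carrier := C\<rparr>) A (\<lambda>x. x)"
    using C by (auto simp: star_hom_def closed_star_subalgebra_def)
  note D = closed_star_subalgebraD[OF C]
  show "cstar_algebra (A\<lparr>carrier := C\<rparr>)"
  proof (rule cstar_algebra_pullback[OF assms(1) _ h])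
    fix X :: "nat \<Rightarrow> _" and y
    assume "\<And>n. X n \<in> carrier (A\<lparr>carrier := C\<rparr>)" "y \<in> carrier A"
      "(\<lambda>n. cnorm A (X n \<ominus>\<^bsub>A\<^esub> y)) \<longlonglongrightarrow> 0"
    then have "y \<in> C" using D(7)[of y X] by simp
    then show "y \<in> (\<lambda>x. x) ` carrier (A\<lparr>carrier := C\<rparr>)" by simp
  qed (simp_all add: D(2-6))
qed

lemma closed_star_subalgebra_generated:
  assumes "cstar_algebra A" "S \<subseteq> carrier A"
  shows "closed_star_subalgebra A (cstar_generated A S)" and "S \<subseteq> cstar_generated A S"
proof -
  interpret cstar_algebra A by fact
  have top: "closed_star_subalgebra A (carrier A)"
    by (auto simp: closed_star_subalgebra_def m_closed scale_closed adj_closed)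
  have sub: "cstar_generated A S \<subseteq> carrier A"
    using top assms(2) by (auto simp: cstar_generated_def)
  show "closed_star_subalgebra A (cstar_generated A S)"
    by (rule closed_star_subalgebraI[OF sub])
      (auto simp: cstar_generated_def closed_star_subalgebraD(2-6)
        intro: closed_star_subalgebraD(7))
  show "S \<subseteq> cstar_generated A S" by (auto simp: cstar_generated_def)
qed

lemma cstar_product:
  fixes A :: "'i \<Rightarrow> 'a cstar"
  assumes A: "\<And>i. i \<in> I \<Longrightarrow> cstar_algebra (A i)"
  shows "cstar_algebra (cstar_product I A)"
    and "i \<in> I \<Longrightarrow> star_hom (cstar_product I A) (A i) (\<lambda>x. x i)"
    and "\<lbrakk>i \<in> I; x \<in> carrier (cstar_product I A)\<rbrakk>
      \<Longrightarrow> cnorm (A i) (x i) \<le> cnorm (cstar_product I A) x"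
proof -
  let ?P = "cstar_product I A"
  note ax = cstar_algebra.norm_triangle[OF A] cstar_algebra.norm_scale[OF A]
    cstar_algebra.norm_mult_le[OF A] cstar_algebra.norm_adj[OF A] cstar_algebra.norm_nonneg[OF A]
  have As: "star_algebra (A i)" if "i \<in> I" for i
    using A[OF that] by (simp add: cstar_algebra_def)
  have Ag: "abelian_group (A i)" if "i \<in> I" for i
    using As[OF that] by (simp add: star_algebra_def)
  note cl = abelian_groupE(1)[OF Ag] abelian_groupE(2)[OF Ag] star_algebra.m_closed[OF As]
    star_algebra.scale_closed[OF As] star_algebra.adj_closed[OF As]
  have P: "x \<in> carrier ?P \<longleftrightarrow> x \<in> extensional I \<and> (\<forall>i\<in>I. x i \<in> carrier (A i)) \<and>
      (\<exists>c. \<forall>i\<in>I. cnorm (A i) (x i) \<le> c)" for x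
    by (auto simp: cstar_product_def PiE_iff bdd_above_def)
  have ops: "\<zero>\<^bsub>?P\<^esub> = (\<lambda>i\<in>I. \<zero>\<^bsub>A i\<^esub>)" "x \<oplus>\<^bsub>?P\<^esub> y = (\<lambda>i\<in>I. x i \<oplus>\<^bsub>A i\<^esub> y i)"
      "x \<otimes>\<^bsub>?P\<^esub> y = (\<lambda>i\<in>I. x i \<otimes>\<^bsub>A i\<^esub> y i)" "c \<odot>\<^bsub>?P\<^esub> x = (\<lambda>i\<in>I. c \<odot>\<^bsub>A i\<^esub> x i)"
      "x\<^sup>\<star>\<^bsub>?P\<^esub> = (\<lambda>i\<in>I. (x i)\<^sup>\<star>\<^bsub>A i\<^esub>)" for x y c
    by (auto simp: cstar_product_def)
  have in_c: "i \<in> I \<Longrightarrow> x i \<in> carrier (A i)" if "x \<in> carrier ?P" for x i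
    using that P by blast
  have le: "cnorm (A i) (x i) \<le> cnorm ?P x" if "i \<in> I" "x \<in> carrier ?P" for i x
    unfolding cstar_product_def cstar.simps
    by (rule cSup_upper) (use that P in \<open>auto simp: cstar_product_def\<close>)
  have nonneg: "0 \<le> cnorm ?P x" if "x \<in> carrier ?P" for x
    unfolding cstar_product_def cstar.simps
    by (rule cSup_upper) (use that P in \<open>auto simp: cstar_product_def\<close>)
  have least: "cnorm ?P x \<le> c" if "0 \<le> c" "\<And>i. i \<in> I \<Longrightarrow> cnorm (A i) (x i) \<le> c" for x c
    unfolding cstar_product_def cstar.simps
    by (rule cSup_least) (use that in auto)
  have z: "\<zero>\<^bsub>?P\<^esub> \<in> carrier ?P"
    unfolding P using cl(2) A by (auto simp: ops cstar_algebra.norm_zero intro!: exI[of _ 0])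
  have a: "x \<oplus>\<^bsub>?P\<^esub> y \<in> carrier ?P" if "x \<in> carrier ?P" "y \<in> carrier ?P" for x y
    unfolding P
  proof (intro conjI exI ballI)
    fix i assume i: "i \<in> I"
    show "cnorm (A i) ((x \<oplus>\<^bsub>?P\<^esub> y) i) \<le> cnorm ?P x + cnorm ?P y"
      using ax(1)[OF i in_c[OF that(1) i] in_c[OF that(2) i]] le[OF i that(1)] le[OF i that(2)] i
      by (simp add: ops)
  qed (use that in \<open>auto simp: ops in_c cl\<close>)
  have m: "x \<otimes>\<^bsub>?P\<^esub> y \<in> carrier ?P" if "x \<in> carrier ?P" "y \<in> carrier ?P" for x y
    unfolding P
  proof (intro conjI exI ballI)
    fix i assume i: "i \<in> I"
    have "cnorm (A i) (x i) * cnorm (A i) (y i) \<le> cnorm ?P x * cnorm ?P y"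
      using le[OF i that(1)] le[OF i that(2)] i nonneg that
      by (intro mult_mono) (auto simp: ax in_c)
    then show "cnorm (A i) ((x \<otimes>\<^bsub>?P\<^esub> y) i) \<le> cnorm ?P x * cnorm ?P y"
      using ax(3)[OF i in_c[OF that(1) i] in_c[OF that(2) i]] i
      by (simp add: ops)
  qed (use that in \<open>auto simp: ops in_c cl\<close>)
  have s: "c \<odot>\<^bsub>?P\<^esub> x \<in> carrier ?P" if "x \<in> carrier ?P" for x c
    unfolding P
  proof (intro conjI exI ballI)
    fix i assume i: "i \<in> I"
    show "cnorm (A i) ((c \<odot>\<^bsub>?P\<^esub> x) i) \<le> cmod c * cnorm ?P x"
      using le[OF i that] i that by (simp add: ops ax in_c mult_left_mono)
  qed (use that in \<open>auto simp: ops in_c cl\<close>)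
  have st: "x\<^sup>\<star>\<^bsub>?P\<^esub> \<in> carrier ?P" if "x \<in> carrier ?P" for x
    unfolding P
  proof (intro conjI exI ballI)
    fix i assume i: "i \<in> I"
    show "cnorm (A i) ((x\<^sup>\<star>\<^bsub>?P\<^esub>) i) \<le> cnorm ?P x"
      using le[OF i that] i that by (simp add: ops ax in_c)
  qed (use that in \<open>auto simp: ops in_c cl\<close>)
  show hom: "star_hom ?P (A i) (\<lambda>x. x i)" if "i \<in> I" for i
    using that by (auto simp: star_hom_def ops in_c)
  show "\<lbrakk>i \<in> I; x \<in> carrier ?P\<rbrakk> \<Longrightarrow> cnorm (A i) (x i) \<le> cnorm ?P x"
    by (rule le)
  have PS: "star_algebra ?P"
    by (rule star_algebra_jointly[where I = I and B = A and j = "\<lambda>i x. x i"])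
      (auto simp: As hom z a m s st, auto simp: P ops intro: extensionalityI)
  have minus: "(x \<ominus>\<^bsub>?P\<^esub> y) i = x i \<ominus>\<^bsub>A i\<^esub> y i"
    if "i \<in> I" "x \<in> carrier ?P" "y \<in> carrier ?P" for x y i
    using star_hom_minus[OF hom[OF that(1)] PS As[OF that(1)] that(2,3)] .
  have minus_cl: "x \<ominus>\<^bsub>?P\<^esub> y \<in> carrier ?P" if "x \<in> carrier ?P" "y \<in> carrier ?P" for x y
    using PS that by (simp add: abelian_group.minus_closed star_algebra_def)
  show "cstar_algebra ?P"
  proof (intro cstar_algebra.intro cstar_algebra_axioms.intro PS)
    fix x assume x: "x \<in> carrier ?P"
    show "cnorm ?P x = 0 \<longleftrightarrow> x = \<zero>\<^bsub>?P\<^esub>"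
    proof
      assume 0: "cnorm ?P x = 0"
      have "x i = \<zero>\<^bsub>A i\<^esub>" if i: "i \<in> I" for i
        using le[OF i x] ax(5)[OF i in_c[OF x i]] 0
          cstar_algebra.norm_zero_iff[OF A[OF i] in_c[OF x i]] by simp
      then show "x = \<zero>\<^bsub>?P\<^esub>"
        using x P by (auto simp: ops intro!: extensionalityI[of _ I])
    next
      assume "x = \<zero>\<^bsub>?P\<^esub>"
      then have "cnorm ?P x \<le> 0"
        by (intro least) (auto simp: ops cstar_algebra.norm_zero[OF A])
      then show "cnorm ?P x = 0" using nonneg[OF x] by simp
    qed
  next
    fix x y assume xy: "x \<in> carrier ?P" "y \<in> carrier ?P"
    show "cnorm ?P (x \<oplus>\<^bsub>?P\<^esub> y) \<le> cnorm ?P x + cnorm ?P y"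
    proof (rule least)
      fix i assume i: "i \<in> I"
      show "cnorm (A i) ((x \<oplus>\<^bsub>?P\<^esub> y) i) \<le> cnorm ?P x + cnorm ?P y"
        using ax(1)[OF i in_c[OF xy(1) i] in_c[OF xy(2) i]] le[OF i xy(1)] le[OF i xy(2)] i
        by (simp add: ops)
    qed (use nonneg xy in simp)
    show "cnorm ?P (x \<otimes>\<^bsub>?P\<^esub> y) \<le> cnorm ?P x * cnorm ?P y"
    proof (rule least)
      fix i assume i: "i \<in> I"
      have "cnorm (A i) (x i) * cnorm (A i) (y i) \<le> cnorm ?P x * cnorm ?P y"
        using le[OF i xy(1)] le[OF i xy(2)] i nonneg xy
        by (intro mult_mono) (auto simp: ax in_c)
      then show "cnorm (A i) ((x \<otimes>\<^bsub>?P\<^esub> y) i) \<le> cnorm ?P x * cnorm ?P y"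
        using ax(3)[OF i in_c[OF xy(1) i] in_c[OF xy(2) i]] i by (simp add: ops)
    qed (use nonneg xy in simp)
  next
    fix x c assume x: "x \<in> carrier ?P"
    have le1: "cnorm ?P (c \<odot>\<^bsub>?P\<^esub> x) \<le> cmod c * cnorm ?P x"
      by (rule least) (use nonneg x le in \<open>auto simp: ops ax in_c mult_left_mono\<close>)
    show "cnorm ?P (c \<odot>\<^bsub>?P\<^esub> x) = cmod c * cnorm ?P x"
    proof (cases "c = 0")
      case True
      then show ?thesis using le1 nonneg[OF s[OF x, of c]] by simp
    next
      case False
      have "cnorm ?P x \<le> cnorm ?P (c \<odot>\<^bsub>?P\<^esub> x) / cmod c"
      proof (rule least)
        fix i assume i: "i \<in> I"
        have "cmod c * cnorm (A i) (x i) \<le> cnorm ?P (c \<odot>\<^bsub>?P\<^esub> x)"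
          using le[OF i s[OF x, of c]] i x by (simp add: ops ax in_c)
        then show "cnorm (A i) (x i) \<le> cnorm ?P (c \<odot>\<^bsub>?P\<^esub> x) / cmod c"
          using False by (simp add: field_simps)
      qed (use nonneg[OF s[OF x]] in simp)
      then have "cmod c * cnorm ?P x \<le> cnorm ?P (c \<odot>\<^bsub>?P\<^esub> x)"
        using False by (simp add: field_simps)
      then show ?thesis using le1 by simp
    qed
  next
    fix x assume x: "x \<in> carrier ?P"
    let ?y = "x\<^sup>\<star>\<^bsub>?P\<^esub> \<otimes>\<^bsub>?P\<^esub> x"
    have y: "?y \<in> carrier ?P" by (intro m st x)
    have eq: "cnorm (A i) (?y i) = (cnorm (A i) (x i))\<^sup>2" if "i \<in> I" for i
      using cstar_algebra.cstar_identity[OF A[OF that] in_c[OF x that]] that by (simp add: ops)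
    have "cnorm ?P ?y \<le> (cnorm ?P x)\<^sup>2"
    proof (rule least)
      fix i assume i: "i \<in> I"
      show "cnorm (A i) (?y i) \<le> (cnorm ?P x)\<^sup>2"
        unfolding eq[OF i] by (intro power_mono le i x ax in_c)
    qed simp
    moreover have "cnorm ?P x \<le> sqrt (cnorm ?P ?y)"
    proof (rule least)
      fix i assume i: "i \<in> I"
      show "cnorm (A i) (x i) \<le> sqrt (cnorm ?P ?y)"
        using le[OF i y] unfolding eq[OF i] by (rule real_le_rsqrt)
    qed (use nonneg[OF y] in simp)
    then have "(cnorm ?P x)\<^sup>2 \<le> cnorm ?P ?y"
      using nonneg[OF x] nonneg[OF y] by (metis power_mono real_sqrt_pow2)
    ultimately show "cnorm ?P ?y = (cnorm ?P x)\<^sup>2" by simp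
  next
    fix X :: "nat \<Rightarrow> 'i \<Rightarrow> 'a"
    assume X: "\<And>n. X n \<in> carrier ?P"
      and C: "\<And>e. e > 0 \<Longrightarrow> \<exists>N. \<forall>m\<ge>N. \<forall>n\<ge>N. cnorm ?P (X m \<ominus>\<^bsub>?P\<^esub> X n) < e"
    have "\<exists>y\<in>carrier (A i). (\<lambda>n. cnorm (A i) (X n i \<ominus>\<^bsub>A i\<^esub> y)) \<longlonglongrightarrow> 0" if i: "i \<in> I" for i
    proof (rule cstar_algebra.complete[OF A[OF i]])
      show "X n i \<in> carrier (A i)" for n using in_c[OF X i] .
      fix e :: real assume "e > 0"
      then obtain N where N: "\<forall>m\<ge>N. \<forall>n\<ge>N. cnorm ?P (X m \<ominus>\<^bsub>?P\<^esub> X n) < e" using C by blast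
      have "cnorm (A i) (X m i \<ominus>\<^bsub>A i\<^esub> X n i) \<le> cnorm ?P (X m \<ominus>\<^bsub>?P\<^esub> X n)" for m n
        using le[OF i minus_cl[OF X X], of m n] minus[OF i X X, of m n] by simp
      then show "\<exists>N. \<forall>m\<ge>N. \<forall>n\<ge>N. cnorm (A i) (X m i \<ominus>\<^bsub>A i\<^esub> X n i) < e"
        using N by (meson le_less_trans)
    qed
    then obtain y where y: "\<And>i. i \<in> I \<Longrightarrow> y i \<in> carrier (A i)"
      and lim: "\<And>i. i \<in> I \<Longrightarrow> (\<lambda>n. cnorm (A i) (X n i \<ominus>\<^bsub>A i\<^esub> y i)) \<longlonglongrightarrow> 0" by metis
    have unif: "\<exists>N. \<forall>n\<ge>N. \<forall>i\<in>I. cnorm (A i) (X n i \<ominus>\<^bsub>A i\<^esub> y i) \<le> e" if "e > 0" for e :: real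
    proof -
      obtain N where N: "\<forall>m\<ge>N. \<forall>n\<ge>N. cnorm ?P (X m \<ominus>\<^bsub>?P\<^esub> X n) < e" using C \<open>e > 0\<close> by blast
      have "cnorm (A i) (X n i \<ominus>\<^bsub>A i\<^esub> y i) \<le> e" if n: "n \<ge> N" and i: "i \<in> I" for n i
      proof (rule LIMSEQ_le_const)
        show "(\<lambda>m. e + cnorm (A i) (X m i \<ominus>\<^bsub>A i\<^esub> y i)) \<longlonglongrightarrow> e"
          using tendsto_add[OF tendsto_const lim[OF i], of e] by simp
        have "cnorm (A i) (X n i \<ominus>\<^bsub>A i\<^esub> y i) \<le> e + cnorm (A i) (X m i \<ominus>\<^bsub>A i\<^esub> y i)" if "m \<ge> N" for m
        proof -
          have "cnorm (A i) (X n i \<ominus>\<^bsub>A i\<^esub> X m i) \<le> cnorm ?P (X n \<ominus>\<^bsub>?P\<^esub> X m)"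
            using le[OF i minus_cl[OF X X], of n m] minus[OF i X X, of n m] by simp
          also have "\<dots> < e" using N n that by blast
          finally show ?thesis
            using cstar_algebra.norm_minus_triangle[OF A[OF i] in_c[OF X i] in_c[OF X i] y[OF i], of n m]
            by simp
        qed
        then show "\<exists>N. \<forall>m\<ge>N. cnorm (A i) (X n i \<ominus>\<^bsub>A i\<^esub> y i)
            \<le> e + cnorm (A i) (X m i \<ominus>\<^bsub>A i\<^esub> y i)" by blast
      qed
      then show ?thesis by blast
    qed
    define x where "x = (\<lambda>i\<in>I. y i)"
    obtain N where N: "\<forall>n\<ge>N. \<forall>i\<in>I. cnorm (A i) (X n i \<ominus>\<^bsub>A i\<^esub> y i) \<le> 1"
      using unif[of 1] by auto
    have "cnorm (A i) (y i) \<le> 1 + cnorm ?P (X N)" if i: "i \<in> I" for i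
      using cstar_algebra.norm_le_norm_minus[OF A[OF i] in_c[OF X i] y[OF i], of N] N i
        le[OF i X, of N] by fastforce
    then have xP: "x \<in> carrier ?P"
      unfolding P x_def using y by auto
    have "(\<lambda>n. cnorm ?P (X n \<ominus>\<^bsub>?P\<^esub> x)) \<longlonglongrightarrow> 0"
    proof (rule LIMSEQ_I)
      fix e :: real assume e: "e > 0"
      then obtain N where N: "\<forall>n\<ge>N. \<forall>i\<in>I. cnorm (A i) (X n i \<ominus>\<^bsub>A i\<^esub> y i) \<le> e / 2"
        using unif[of "e / 2"] by auto
      have "norm (cnorm ?P (X n \<ominus>\<^bsub>?P\<^esub> x) - 0) < e" if "n \<ge> N" for n
      proof -
        have "cnorm ?P (X n \<ominus>\<^bsub>?P\<^esub> x) \<le> e / 2"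
        proof (rule least)
          fix i assume i: "i \<in> I"
          show "cnorm (A i) ((X n \<ominus>\<^bsub>?P\<^esub> x) i) \<le> e / 2"
            unfolding minus[OF i X xP] using N that i by (simp add: x_def)
        qed (use e in simp)
        then show ?thesis using nonneg[OF minus_cl[OF X xP]] e by (simp add: le_less_trans)
      qed
      then show "\<exists>N. \<forall>n\<ge>N. norm (cnorm ?P (X n \<ominus>\<^bsub>?P\<^esub> x) - 0) < e" by blast
    qed
    then show "\<exists>x\<in>carrier ?P. (\<lambda>n. cnorm ?P (X n \<ominus>\<^bsub>?P\<^esub> x)) \<longlonglongrightarrow> 0"
      using xP by blast
  qed
qed


lemma cstar_generated_idem:
  assumes A: "cstar_algebra A" and S: "S \<subseteq> carrier A"
  defines "C \<equiv> cstar_generated A S"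
  shows "cstar_generated (A\<lparr>carrier := C\<rparr>) S = C"
proof -
  let ?C = "A\<lparr>carrier := C\<rparr>"
  have C: "closed_star_subalgebra A C" and SC: "S \<subseteq> C"
    using closed_star_subalgebra_generated[OF A S] by (auto simp: C_def)
  note sub = closed_star_subalgebra_cstar[OF A C]
  interpret A: cstar_algebra A by fact
  interpret C: cstar_algebra ?C by (rule sub)
  have minus: "x \<ominus>\<^bsub>?C\<^esub> y = x \<ominus>\<^bsub>A\<^esub> y" if "x \<in> C" "y \<in> C" for x y
    using star_hom_minus[OF sub(2) C.star_algebra_axioms A.star_algebra_axioms, of x y] that by simp
  have "closed_star_subalgebra A D" if D: "closed_star_subalgebra ?C D" for D
  proof (rule closed_star_subalgebraI)
    note E = closed_star_subalgebraD[OF D, simplified]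
    show "D \<subseteq> carrier A" using E(1) closed_star_subalgebraD(1)[OF C] by blast
    fix x :: 'a and X :: "nat \<Rightarrow> 'a"
    assume x: "x \<in> carrier A" and X: "\<And>n. X n \<in> D"
      and lim: "(\<lambda>n. cnorm A (X n \<ominus>\<^bsub>A\<^esub> x)) \<longlonglongrightarrow> 0"
    have XC: "X n \<in> C" for n using X E(1) by blast
    then have xC: "x \<in> C" by (rule closed_star_subalgebraD(7)[OF C x _ lim])
    show "x \<in> D"
      by (rule E(7)[of x X, OF xC X]) (use lim XC xC in \<open>simp add: minus\<close>)
  qed (use closed_star_subalgebraD[OF D, simplified] in auto)
  moreover have "closed_star_subalgebra ?C C"
    using C.a_closed C.m_closed C.scale_closed C.adj_closed C.zero_closed
    by (intro closed_star_subalgebraI) simp_all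
  ultimately show ?thesis using SC unfolding C_def cstar_generated_def by blast
qed

primrec poly_eval :: "'b cstar \<Rightarrow> ('g \<Rightarrow> 'b) \<Rightarrow> 'g star_poly \<Rightarrow> 'b" where
  "poly_eval B h (Gen a) = h a"
| "poly_eval B h Zero = \<zero>\<^bsub>B\<^esub>"
| "poly_eval B h (Add p q) = poly_eval B h p \<oplus>\<^bsub>B\<^esub> poly_eval B h q"
| "poly_eval B h (Mult p q) = poly_eval B h p \<otimes>\<^bsub>B\<^esub> poly_eval B h q"
| "poly_eval B h (Scale c p) = c \<odot>\<^bsub>B\<^esub> poly_eval B h p"
| "poly_eval B h (Adj p) = (poly_eval B h p)\<^sup>\<star>\<^bsub>B\<^esub>"

lemma closure_poly_eval:
  fixes B :: "'b cstar" (structure)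
  assumes "cstar_algebra B" and h: "\<And>a. h a \<in> carrier B"
  shows "poly_eval B h p \<in> carrier B"
    and "closed_star_subalgebra B
      {x \<in> carrier B. \<forall>e>0. \<exists>p. cnorm B (x \<ominus> poly_eval B h p) < e}"
proof -
  interpret cstar_algebra B by fact
  let ?v = "poly_eval B h"
  have v: "?v p \<in> carrier B" for p
    by (induction p) (auto simp: h m_closed scale_closed adj_closed)
  show "?v p \<in> carrier B" by (rule v)
  define L where "L = {x \<in> carrier B. \<forall>e>0. \<exists>p. cnorm B (x \<ominus> ?v p) < e}"
  have LI: "x \<in> L" if "x \<in> carrier B" "\<And>e. e > 0 \<Longrightarrow> \<exists>p. cnorm B (x \<ominus> ?v p) < e" for x
    using that by (simp add: L_def)
  have Lc: "x \<in> carrier B" if "x \<in> L" for x using that by (simp add: L_def)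
  have Le: "\<exists>p. cnorm B (x \<ominus> ?v p) < e" if "x \<in> L" "e > 0" for x e using that by (simp add: L_def)
  have *: "?v p \<in> L" for p
  proof (rule LI[OF v])
    fix e :: real assume "e > 0"
    then have "cnorm B (?v p \<ominus> ?v p) < e" using v[of p] by (simp add: a_minus_def r_neg)
    then show "\<exists>q. cnorm B (?v p \<ominus> ?v q) < e" by blast
  qed
  have add: "x \<oplus> y \<in> L" if x: "x \<in> L" and y: "y \<in> L" for x y
  proof (rule LI)
    show "x \<oplus> y \<in> carrier B" using Lc x y by simp
    fix e :: real assume "e > 0"
    then obtain p q where p: "cnorm B (x \<ominus> ?v p) < e/2" and q: "cnorm B (y \<ominus> ?v q) < e/2"
      using Le[OF x, of "e/2"] Le[OF y, of "e/2"] by auto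
    have "(x \<oplus> y) \<ominus> ?v (Add p q) = (x \<ominus> ?v p) \<oplus> (y \<ominus> ?v q)"
      using Lc[OF x] Lc[OF y] v by (simp add: minus_eq_scale scale_add scale_closed a_ac)
    then have "cnorm B ((x \<oplus> y) \<ominus> ?v (Add p q)) < e"
      using norm_triangle[of "x \<ominus> ?v p" "y \<ominus> ?v q"] p q Lc[OF x] Lc[OF y] v by simp
    then show "\<exists>p. cnorm B ((x \<oplus> y) \<ominus> ?v p) < e" by blast
  qed
  have scale: "c \<odot> x \<in> L" if x: "x \<in> L" for x c
  proof (rule LI)
    show "c \<odot> x \<in> carrier B" using Lc[OF x] by (simp add: scale_closed)
    fix e :: real assume e: "e > 0"
    then have "e / (cmod c + 1) > 0" by (simp add: add_nonneg_pos)
    then obtain p where p: "cnorm B (x \<ominus> ?v p) < e / (cmod c + 1)" using Le[OF x] by blast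
    have "(c \<odot> x) \<ominus> ?v (Scale c p) = c \<odot> (x \<ominus> ?v p)"
      using Lc[OF x] v by (simp add: minus_eq_scale scale_add scale_closed scale_scale)
    then have "cnorm B ((c \<odot> x) \<ominus> ?v (Scale c p)) = cmod c * cnorm B (x \<ominus> ?v p)"
      using Lc[OF x] v by (simp add: norm_scale)
    also have "\<dots> \<le> (cmod c + 1) * cnorm B (x \<ominus> ?v p)"
      using Lc[OF x] v by (intro mult_right_mono norm_nonneg) auto
    also have "\<dots> < e" using p by (simp add: pos_less_divide_eq add_nonneg_pos mult.commute)
    finally show "\<exists>p. cnorm B ((c \<odot> x) \<ominus> ?v p) < e" by blast
  qed
  have adj: "x\<^sup>\<star> \<in> L" if x: "x \<in> L" for x
  proof (rule LI)
    show "x\<^sup>\<star> \<in> carrier B" using Lc[OF x] by (simp add: adj_closed)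
    fix e :: real assume e: "e > 0"
    then obtain p where p: "cnorm B (x \<ominus> ?v p) < e" using Le[OF x] by blast
    have "x\<^sup>\<star> \<ominus> ?v (Adj p) = (x \<ominus> ?v p)\<^sup>\<star>"
      using Lc[OF x] v by (simp add: minus_eq_scale scale_closed adj_closed adj_add adj_scale)
    then have "cnorm B (x\<^sup>\<star> \<ominus> ?v (Adj p)) < e"
      using p Lc[OF x] v by (simp add: norm_adj)
    then show "\<exists>p. cnorm B (x\<^sup>\<star> \<ominus> ?v p) < e" by blast
  qed
  have mult: "x \<otimes> y \<in> L" if x: "x \<in> L" and y: "y \<in> L" for x y
  proof (rule LI)
    show "x \<otimes> y \<in> carrier B" using Lc[OF x] Lc[OF y] by (simp add: m_closed)
    have xc: "x \<in> carrier B" and yc: "y \<in> carrier B" using Lc x y by auto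
    fix e :: real assume e: "e > 0"
    let ?K = "cnorm B x + cnorm B y + 1"
    have K: "?K > 0" using norm_nonneg[OF xc] norm_nonneg[OF yc] by simp
    have "\<exists>d>0. d \<le> 1 \<and> d * K \<le> e" if "K > 0" for K :: real
      using e that by (intro exI[of _ "min 1 (e / K)"]) (auto simp: min_def pos_le_divide_eq)
    then obtain d where d: "d > 0" "d \<le> 1" "d * ?K \<le> e" using K by blast
    obtain p q where p: "cnorm B (x \<ominus> ?v p) < d" and q: "cnorm B (y \<ominus> ?v q) < d"
      using Le[OF x d(1)] Le[OF y d(1)] by blast
    have "(x \<otimes> y) \<ominus> ?v (Mult p q) = (x \<ominus> ?v p) \<otimes> y \<oplus> ?v p \<otimes> (y \<ominus> ?v q)"
    proof -
      have "?v p \<otimes> y \<in> carrier B" "x \<otimes> y \<in> carrier B" "?v p \<otimes> ?v q \<in> carrier B"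
        using xc yc v by (auto simp: m_closed)
      moreover have "(x \<ominus> ?v p) \<otimes> y \<oplus> ?v p \<otimes> (y \<ominus> ?v q)
          = (x \<otimes> y \<ominus> ?v p \<otimes> y) \<oplus> (?v p \<otimes> y \<ominus> ?v p \<otimes> ?v q)"
        using xc yc v by (simp add: minus_eq_scale scale_closed l_distr r_distr m_closed
          scale_mult_left scale_mult_right)
      ultimately show ?thesis
        by (simp add: a_minus_def a_assoc r_neg1 l_neg r_neg2)
    qed
    then have "cnorm B ((x \<otimes> y) \<ominus> ?v (Mult p q))
        \<le> cnorm B ((x \<ominus> ?v p) \<otimes> y) + cnorm B (?v p \<otimes> (y \<ominus> ?v q))"
      using norm_triangle[of "(x \<ominus> ?v p) \<otimes> y" "?v p \<otimes> (y \<ominus> ?v q)"] xc yc v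
      by (simp add: m_closed)
    also have "\<dots> \<le> cnorm B (x \<ominus> ?v p) * cnorm B y + cnorm B (?v p) * cnorm B (y \<ominus> ?v q)"
      using xc yc v by (intro add_mono norm_mult_le) auto
    also have "\<dots> < d * ?K"
    proof -
      have n: "0 \<le> cnorm B y" "0 \<le> cnorm B x" "0 \<le> cnorm B (x \<ominus> ?v p)"
          "0 \<le> cnorm B (?v p)" "0 \<le> cnorm B (y \<ominus> ?v q)"
        using xc yc v by (auto intro!: norm_nonneg)
      have vp: "cnorm B (?v p) < cnorm B x + 1"
        using norm_le_norm_minus[OF xc v, of p] p d by simp
      have "cnorm B (x \<ominus> ?v p) * cnorm B y \<le> d * cnorm B y"
        using p n by (intro mult_right_mono) auto
      moreover have "cnorm B (?v p) * cnorm B (y \<ominus> ?v q) \<le> cnorm B (?v p) * d"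
        using q n by (intro mult_left_mono) auto
      moreover have "cnorm B (?v p) * d < (cnorm B x + 1) * d"
        using vp d by simp
      ultimately show ?thesis by (simp add: algebra_simps)
    qed
    finally have "cnorm B ((x \<otimes> y) \<ominus> ?v (Mult p q)) < e" using d by simp
    then show "\<exists>p. cnorm B ((x \<otimes> y) \<ominus> ?v p) < e" by blast
  qed
  have lim: "x \<in> L" if x: "x \<in> carrier B" and X: "\<forall>n::nat. X n \<in> L"
    and l: "(\<lambda>n. cnorm B (X n \<ominus> x)) \<longlonglongrightarrow> 0" for X x
  proof (rule LI)
    fix e :: real assume e: "e > 0"
    then obtain n where n: "norm (cnorm B (X n \<ominus> x)) < e/2"
      using LIMSEQ_D[OF l, of "e/2"] by auto
    obtain p where p: "cnorm B (X n \<ominus> ?v p) < e/2" using Le[of "X n" "e/2"] X e by auto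
    have Xn: "X n \<in> carrier B" using X Lc by blast
    have "cnorm B (x \<ominus> ?v p) < e"
      using norm_minus_triangle[OF x Xn v, of p] norm_minus_sym[OF x Xn] n p by simp
    then show "\<exists>p. cnorm B (x \<ominus> ?v p) < e" by blast
  qed (use x in simp)
  have "closed_star_subalgebra B L"
  proof (rule closed_star_subalgebraI)
    show "L \<subseteq> carrier B" using Lc by blast
    show "\<zero> \<in> L" using *[of Zero] by simp
    show "\<And>x y. \<lbrakk>x \<in> L; y \<in> L\<rbrakk> \<Longrightarrow> x \<oplus> y \<in> L" by (rule add)
    show "\<And>x y. \<lbrakk>x \<in> L; y \<in> L\<rbrakk> \<Longrightarrow> x \<otimes> y \<in> L" by (rule mult)
    show "\<And>c x. x \<in> L \<Longrightarrow> c \<odot> x \<in> L" by (rule scale)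
    show "\<And>x. x \<in> L \<Longrightarrow> x\<^sup>\<star> \<in> L" by (rule adj)
    show "\<And>X x. \<lbrakk>x \<in> carrier B; \<And>n. X n \<in> L;
        (\<lambda>n. cnorm B (X n \<ominus> x)) \<longlonglongrightarrow> 0\<rbrakk> \<Longrightarrow> x \<in> L" by (rule lim) simp_all
  qed
  then show "closed_star_subalgebra B {x \<in> carrier B. \<forall>e>0. \<exists>p. cnorm B (x \<ominus> ?v p) < e}"
    by (simp add: L_def)
qed

lemma univ_carrier_copy:
  fixes B :: "'b cstar" and h :: "'g \<Rightarrow> 'b"
  assumes B: "cstar_algebra B" and h: "\<forall>a\<in>G. h a \<in> carrier B"
  shows "\<exists>(A :: 'g univ_carrier cstar) g j.
    cstar_algebra A \<and> star_hom A B j \<and> inj_on j (carrier A) \<and>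
    (\<forall>x\<in>carrier A. cnorm B (j x) = cnorm A x) \<and>
    (\<forall>a\<in>G. g a \<in> carrier A \<and> j (g a) = h a)"
proof -
  interpret B: cstar_algebra B by fact
  define h' where "h' a = (if a \<in> G then h a else \<zero>\<^bsub>B\<^esub>)" for a
  have h': "h' a \<in> carrier B" for a using h by (simp add: h'_def)
  let ?v = "poly_eval B h'"
  define L where "L = {x \<in> carrier B. \<forall>e>0. \<exists>p. cnorm B (x \<ominus>\<^bsub>B\<^esub> ?v p) < e}"
  have v: "?v p \<in> carrier B" for p by (rule closure_poly_eval(1)[OF B h'])
  have L: "closed_star_subalgebra B L"
    unfolding L_def by (rule closure_poly_eval(2)[OF B h'])
  have hL: "h a \<in> L" if "a \<in> G" for a
    unfolding L_def using bspec[OF h that] that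
    by (auto intro!: exI[of _ "Gen a"] simp: h'_def a_minus_def B.r_neg)
  define f where "f x = (\<lambda>n::nat. SOME p. cnorm B (x \<ominus>\<^bsub>B\<^esub> ?v p) < 1 / (real n + 1))" for x
  have f: "(\<lambda>n. cnorm B (?v (f x n) \<ominus>\<^bsub>B\<^esub> x)) \<longlonglongrightarrow> 0" if x: "x \<in> L" for x
  proof (rule tendsto_sandwich[OF always_eventually always_eventually tendsto_const LIMSEQ_inverse_real_of_nat])
    have xB: "x \<in> carrier B" using x by (simp add: L_def)
    show "\<forall>n. 0 \<le> cnorm B (?v (f x n) \<ominus>\<^bsub>B\<^esub> x)" using xB v by (simp add: B.norm_nonneg)
    show "\<forall>n. cnorm B (?v (f x n) \<ominus>\<^bsub>B\<^esub> x) \<le> inverse (real (Suc n))"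
    proof
      fix n
      have "\<exists>p. cnorm B (x \<ominus>\<^bsub>B\<^esub> ?v p) < 1 / (real n + 1)" using x by (simp add: L_def)
      then have "cnorm B (x \<ominus>\<^bsub>B\<^esub> ?v (f x n)) < 1 / (real n + 1)"
        unfolding f_def by (rule someI_ex)
      then show "cnorm B (?v (f x n) \<ominus>\<^bsub>B\<^esub> x) \<le> inverse (real (Suc n))"
        using B.norm_minus_sym[OF xB v] by (simp add: field_simps)
    qed
  qed
  have f_inj: "inj_on f L"
  proof (rule inj_onI)
    fix x y assume xy: "x \<in> L" "y \<in> L" "f x = f y"
    show "x = y"
      by (rule B.limit_unique[OF _ _ v, of x y "f x"]) (use xy f[of x] f[of y] in \<open>auto simp: L_def\<close>)
  qed
  define j where "j = inv_into L f"
  have jf: "j (f x) = x" if "x \<in> L" for x using f_inj that by (simp add: j_def)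
  define A :: "'g univ_carrier cstar" where "A =
    \<lparr> carrier = f ` L, mult = \<lambda>a b. f (j a \<otimes>\<^bsub>B\<^esub> j b), one = undefined, zero = f \<zero>\<^bsub>B\<^esub>,
      add = \<lambda>a b. f (j a \<oplus>\<^bsub>B\<^esub> j b), cscale = \<lambda>c a. f (c \<odot>\<^bsub>B\<^esub> j a),
      adj = \<lambda>a. f ((j a)\<^sup>\<star>\<^bsub>B\<^esub>), cnorm = \<lambda>a. cnorm B (j a) \<rparr>"
  have LB: "L \<subseteq> carrier B" by (auto simp: L_def)
  have Linner: "\<zero>\<^bsub>B\<^esub> \<in> L" "\<And>x y. x \<in> L \<Longrightarrow> y \<in> L \<Longrightarrow> x \<oplus>\<^bsub>B\<^esub> y \<in> L"
    "\<And>x y. x \<in> L \<Longrightarrow> y \<in> L \<Longrightarrow> x \<otimes>\<^bsub>B\<^esub> y \<in> L" "\<And>c x. x \<in> L \<Longrightarrow> c \<odot>\<^bsub>B\<^esub> x \<in> L"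
    "\<And>x. x \<in> L \<Longrightarrow> x\<^sup>\<star>\<^bsub>B\<^esub> \<in> L"
    by (auto intro: closed_star_subalgebraD[OF L])
  have inj: "inj_on j (carrier A)" by (auto simp: A_def jf intro!: inj_onI)
  have hom: "star_hom A B j"
    using LB by (auto simp: star_hom_def A_def jf Linner)
  have "cstar_algebra A"
  proof (rule cstar_algebra_pullback[OF B inj hom])
    fix X :: "nat \<Rightarrow> _" and y
    assume X: "\<And>n. X n \<in> carrier A" and y: "y \<in> carrier B"
      and lim: "(\<lambda>n. cnorm B (j (X n) \<ominus>\<^bsub>B\<^esub> y)) \<longlonglongrightarrow> 0"
    have "j (X n) \<in> L" for n using X[of n] jf by (auto simp: A_def)
    then have "y \<in> L" by (rule closed_star_subalgebraD(7)[OF L y _ lim])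
    then show "y \<in> j ` carrier A" using jf by (force simp: A_def)
  qed (auto simp: A_def jf Linner)
  moreover have "f (h a) \<in> carrier A \<and> j (f (h a)) = h a" if "a \<in> G" for a
    using hL[OF that] jf by (simp add: A_def)
  moreover have "cnorm B (j x) = cnorm A x" for x by (simp add: A_def)
  ultimately show ?thesis
    using hom inj by (intro exI[of _ A] exI[of _ "\<lambda>a. f (h a)"] exI[of _ j]) simp
qed

lemma univ_algebra:
  assumes gen: "\<forall>A g. cstar_algebra A \<longrightarrow> P A g \<longrightarrow>
      (\<forall>a\<in>G. g a \<in> carrier A \<and> cnorm A (g a) \<le> 1)"
  shows "cstar_algebra (univ_algebra G P)"
    and "a \<in> G \<Longrightarrow> univ_gen P a \<in> carrier (univ_algebra G P)"
    and "cstar_generated (univ_algebra G P) (univ_gen P ` G) = carrier (univ_algebra G P)"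
    and "(A, g) \<in> univ_reps P \<Longrightarrow> star_hom (univ_algebra G P) A (\<lambda>x. x (A, g))"
    and "\<lbrakk>(A, g) \<in> univ_reps P; x \<in> carrier (univ_algebra G P)\<rbrakk>
      \<Longrightarrow> cnorm A (x (A, g)) \<le> cnorm (univ_algebra G P) x"
    and "\<lbrakk>x \<in> carrier (univ_algebra G P); y \<in> carrier (univ_algebra G P);
      \<And>A g. (A, g) \<in> univ_reps P \<Longrightarrow> x (A, g) = y (A, g)\<rbrakk> \<Longrightarrow> x = y"
proof -
  let ?I = "univ_reps P" let ?P = "cstar_product ?I fst" let ?S = "univ_gen P ` G"
  have I: "\<And>\<rho>. \<rho> \<in> ?I \<Longrightarrow> cstar_algebra (fst \<rho>)" by (auto simp: univ_reps_def)
  note prod = cstar_product[where A = fst and I = ?I, OF I]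
  have S: "?S \<subseteq> carrier ?P"
  proof
    fix x assume "x \<in> ?S"
    then obtain a where a: "a \<in> G" "x = univ_gen P a" by blast
    have "snd \<rho> a \<in> carrier (fst \<rho>) \<and> cnorm (fst \<rho>) (snd \<rho> a) \<le> 1" if "\<rho> \<in> ?I" for \<rho>
      using gen a(1) that by (auto simp: univ_reps_def)
    then show "x \<in> carrier ?P"
      unfolding cstar_product_def a(2) univ_gen_def
      by (auto simp: PiE_iff bdd_above_def intro!: exI[of _ 1])
  qed
  note gs = closed_star_subalgebra_generated[OF prod(1) S]
  note sub = closed_star_subalgebra_cstar[OF prod(1) gs(1)]
  have car: "carrier (univ_algebra G P) \<subseteq> carrier ?P"
    using gs(1) by (auto simp: univ_algebra_def closed_star_subalgebra_def)
  show "cstar_algebra (univ_algebra G P)" using sub by (simp add: univ_algebra_def)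
  show "a \<in> G \<Longrightarrow> univ_gen P a \<in> carrier (univ_algebra G P)"
    using gs(2) by (auto simp: univ_algebra_def)
  show "cstar_generated (univ_algebra G P) ?S = carrier (univ_algebra G P)"
    unfolding univ_algebra_def using cstar_generated_idem[OF prod(1) S] by simp
  show "star_hom (univ_algebra G P) A (\<lambda>x. x (A, g))" if "(A, g) \<in> ?I"
    using star_hom_comp[OF sub(2) prod(2)[OF _ that]] by (simp add: univ_algebra_def)
  show "cnorm A (x (A, g)) \<le> cnorm (univ_algebra G P) x"
    if "(A, g) \<in> ?I" "x \<in> carrier (univ_algebra G P)"
    using prod(3)[OF _ that(1)] car that(2) by (fastforce simp: univ_algebra_def)
  show "x = y" if x: "x \<in> carrier (univ_algebra G P)" and y: "y \<in> carrier (univ_algebra G P)"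
    and eq: "\<And>A g. (A, g) \<in> univ_reps P \<Longrightarrow> x (A, g) = y (A, g)"
  proof (rule extensionalityI[of _ ?I])
    show "x \<in> extensional ?I" "y \<in> extensional ?I"
      using x y car by (auto simp: cstar_product_def PiE_iff)
    show "x \<rho> = y \<rho>" if "\<rho> \<in> ?I" for \<rho> using eq that by (cases \<rho>) auto
  qed
qed

lemma univ_gen_apply: "(A, g) \<in> univ_reps P \<Longrightarrow> univ_gen P a (A, g) = g a"
  by (simp add: univ_gen_def)

context k_graph
begin

lemma src_in_vertices: "\<mu> \<in> mor \<Lambda> \<Longrightarrow> src \<Lambda> \<mu> \<in> vertices \<Lambda>"
  by (simp add: vertices_def of_deg_def src_closed deg_src)

lemma of_deg_edges: "\<lbrakk>\<mu> \<in> of_deg \<Lambda> (unit_deg i); i \<in> {1..k}\<rbrakk> \<Longrightarrow> \<mu> \<in> edges k \<Lambda>"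
  by (auto simp: edges_def)

lemma edges_mor: "\<mu> \<in> edges k \<Lambda> \<Longrightarrow> \<mu> \<in> mor \<Lambda>"
  by (auto simp: edges_def of_deg_def)

lemma vertices_mor: "\<mu> \<in> vertices \<Lambda> \<Longrightarrow> \<mu> \<in> mor \<Lambda>"
  by (auto simp: vertices_def of_deg_def)

lemma CK_family_jointly:
  assumes A: "star_algebra A" and B: "\<And>i. i \<in> I \<Longrightarrow> star_algebra (B i)"
    and inj: "\<And>x y. \<lbrakk>x \<in> carrier A; y \<in> carrier A; \<And>i. i \<in> I \<Longrightarrow> j i x = j i y\<rbrakk> \<Longrightarrow> x = y"
    and hom: "\<And>i. i \<in> I \<Longrightarrow> star_hom A (B i) (j i)"
    and p: "\<And>v. v \<in> vertices \<Lambda> \<Longrightarrow> p v \<in> carrier A"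
    and s: "\<And>\<mu>. \<mu> \<in> edges k \<Lambda> \<Longrightarrow> s \<mu> \<in> carrier A"
    and fam: "\<And>i. i \<in> I \<Longrightarrow> CK_family k \<Lambda> \<phi> (B i) (\<lambda>v. j i (p v)) (\<lambda>\<mu>. j i (s \<mu>))"
  shows "CK_family k \<Lambda> \<phi> A p s"
proof -
  interpret star_algebra A by fact
  note h = star_homD[OF hom]
  note h0 = star_hom_zero[OF hom A B]
  note f = fam[unfolded CK_family_def projection_def]
  have fin: "j n (\<Oplus>\<^bsub>A\<^esub>\<mu>\<in>of_deg_at \<Lambda> v (unit_deg i). s \<mu> \<otimes>\<^bsub>A\<^esub> (s \<mu>)\<^sup>\<star>\<^bsub>A\<^esub>)
      = (\<Oplus>\<^bsub>B n\<^esub>\<mu>\<in>of_deg_at \<Lambda> v (unit_deg i). j n (s \<mu>) \<otimes>\<^bsub>B n\<^esub> (j n (s \<mu>))\<^sup>\<star>\<^bsub>B n\<^esub>)"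
    and sc: "(\<Oplus>\<^bsub>A\<^esub>\<mu>\<in>of_deg_at \<Lambda> v (unit_deg i). s \<mu> \<otimes>\<^bsub>A\<^esub> (s \<mu>)\<^sup>\<star>\<^bsub>A\<^esub>) \<in> carrier A"
    if n: "n \<in> I" and i: "i \<in> {1..k}" for n v i
  proof -
    have e: "\<mu> \<in> edges k \<Lambda>" if "\<mu> \<in> of_deg_at \<Lambda> v (unit_deg i)" for \<mu>
      using that i of_deg_edges by (auto simp: of_deg_at_def)
    have c: "(\<lambda>\<mu>. s \<mu> \<otimes>\<^bsub>A\<^esub> (s \<mu>)\<^sup>\<star>\<^bsub>A\<^esub>) \<in> of_deg_at \<Lambda> v (unit_deg i) \<rightarrow> carrier A"
      using e s by (auto simp: m_closed adj_closed)
    interpret Bn: star_algebra "B n" by (rule B[OF n])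
    show "(\<Oplus>\<^bsub>A\<^esub>\<mu>\<in>of_deg_at \<Lambda> v (unit_deg i). s \<mu> \<otimes>\<^bsub>A\<^esub> (s \<mu>)\<^sup>\<star>\<^bsub>A\<^esub>) \<in> carrier A"
      by (rule finsum_closed[OF c])
    have "j n (\<Oplus>\<^bsub>A\<^esub>\<mu>\<in>of_deg_at \<Lambda> v (unit_deg i). s \<mu> \<otimes>\<^bsub>A\<^esub> (s \<mu>)\<^sup>\<star>\<^bsub>A\<^esub>)
      = (\<Oplus>\<^bsub>B n\<^esub>\<mu>\<in>of_deg_at \<Lambda> v (unit_deg i). j n (s \<mu> \<otimes>\<^bsub>A\<^esub> (s \<mu>)\<^sup>\<star>\<^bsub>A\<^esub>))"
      by (rule star_hom_finsum[OF hom[OF n] A B[OF n] c])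
    also have "\<dots> = (\<Oplus>\<^bsub>B n\<^esub>\<mu>\<in>of_deg_at \<Lambda> v (unit_deg i). j n (s \<mu>) \<otimes>\<^bsub>B n\<^esub> (j n (s \<mu>))\<^sup>\<star>\<^bsub>B n\<^esub>)"
      by (rule Bn.finsum_cong')
        (use n e s in \<open>auto simp: h m_closed adj_closed Bn.m_closed Bn.adj_closed\<close>)
    finally show "j n (\<Oplus>\<^bsub>A\<^esub>\<mu>\<in>of_deg_at \<Lambda> v (unit_deg i). s \<mu> \<otimes>\<^bsub>A\<^esub> (s \<mu>)\<^sup>\<star>\<^bsub>A\<^esub>)
      = (\<Oplus>\<^bsub>B n\<^esub>\<mu>\<in>of_deg_at \<Lambda> v (unit_deg i). j n (s \<mu>) \<otimes>\<^bsub>B n\<^esub> (j n (s \<mu>))\<^sup>\<star>\<^bsub>B n\<^esub>)" .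
  qed
  show ?thesis
    unfolding CK_family_def projection_def
  proof (intro conjI ballI impI)
    fix v i assume v: "v \<in> vertices \<Lambda>" and i: "i \<in> {1..k}" and ne: "of_deg_at \<Lambda> v (unit_deg i) \<noteq> {}"
    have e: "\<mu> \<in> edges k \<Lambda>" if "\<mu> \<in> of_deg_at \<Lambda> v (unit_deg i)" for \<mu>
      using that i of_deg_edges by (auto simp: of_deg_at_def)
    show "p v = (\<Oplus>\<^bsub>A\<^esub>\<mu>\<in>of_deg_at \<Lambda> v (unit_deg i). s \<mu> \<otimes>\<^bsub>A\<^esub> (s \<mu>)\<^sup>\<star>\<^bsub>A\<^esub>)"
    proof (rule inj)
      show "(\<Oplus>\<^bsub>A\<^esub>\<mu>\<in>of_deg_at \<Lambda> v (unit_deg i). s \<mu> \<otimes>\<^bsub>A\<^esub> (s \<mu>)\<^sup>\<star>\<^bsub>A\<^esub>) \<in> carrier A"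
        using e s by (intro finsum_closed) (auto simp: m_closed adj_closed)
      show "j n (p v) = j n (\<Oplus>\<^bsub>A\<^esub>\<mu>\<in>of_deg_at \<Lambda> v (unit_deg i). s \<mu> \<otimes>\<^bsub>A\<^esub> (s \<mu>)\<^sup>\<star>\<^bsub>A\<^esub>)"
        if n: "n \<in> I" for n
        unfolding fin[OF n i] using f[OF n] v i ne by blast
    qed (use p v in simp)
  next
    fix i i' \<mu> \<mu>' \<nu> \<nu>'
    assume a: "i \<in> {1..k}" "i' \<in> {1..k}" "i < i'"
      "\<mu> \<in> of_deg \<Lambda> (unit_deg i)" "\<mu>' \<in> of_deg \<Lambda> (unit_deg i)"
      "\<nu> \<in> of_deg \<Lambda> (unit_deg i')" "\<nu>' \<in> of_deg \<Lambda> (unit_deg i')"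
      "src \<Lambda> \<mu> = rng \<Lambda> \<nu>" "src \<Lambda> \<nu>' = rng \<Lambda> \<mu>'" "cmp \<Lambda> \<mu> \<nu> = cmp \<Lambda> \<nu>' \<mu>'"
    have e: "s \<mu> \<in> carrier A" "s \<mu>' \<in> carrier A" "s \<nu> \<in> carrier A" "s \<nu>' \<in> carrier A"
      using a of_deg_edges s by blast+
    show "s \<nu>' \<otimes>\<^bsub>A\<^esub> s \<mu>' = \<phi> (cmp \<Lambda> \<mu> \<nu>) \<odot>\<^bsub>A\<^esub> (s \<mu> \<otimes>\<^bsub>A\<^esub> s \<nu>)"
    proof (rule inj)
      fix n assume n: "n \<in> I"
      have "j n (s \<nu>') \<otimes>\<^bsub>B n\<^esub> j n (s \<mu>') = \<phi> (cmp \<Lambda> \<mu> \<nu>) \<odot>\<^bsub>B n\<^esub> (j n (s \<mu>) \<otimes>\<^bsub>B n\<^esub> j n (s \<nu>))"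
        using f[OF n] a by blast
      then show "j n (s \<nu>' \<otimes>\<^bsub>A\<^esub> s \<mu>') = j n (\<phi> (cmp \<Lambda> \<mu> \<nu>) \<odot>\<^bsub>A\<^esub> (s \<mu> \<otimes>\<^bsub>A\<^esub> s \<nu>))"
        using n e by (simp add: h m_closed)
    qed (use e in \<open>auto simp: m_closed scale_closed\<close>)
  next
    fix \<mu> assume \<mu>: "\<mu> \<in> edges k \<Lambda>"
    show "(s \<mu>)\<^sup>\<star>\<^bsub>A\<^esub> \<otimes>\<^bsub>A\<^esub> s \<mu> = p (src \<Lambda> \<mu>)"
      by (rule inj) (use \<mu> s p f in \<open>auto simp: h m_closed adj_closed src_in_vertices edges_mor\<close>)
  next
    fix v w assume vw: "v \<in> vertices \<Lambda>" "w \<in> vertices \<Lambda>" "v \<noteq> w"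
    show "p v \<otimes>\<^bsub>A\<^esub> p w = \<zero>\<^bsub>A\<^esub>"
      by (rule inj) (use vw p f in \<open>auto simp: h h0 m_closed\<close>)
  next
    fix v assume v: "v \<in> vertices \<Lambda>"
    show "(p v)\<^sup>\<star>\<^bsub>A\<^esub> = p v" "p v \<otimes>\<^bsub>A\<^esub> p v = p v"
      by (rule inj; use v p f in \<open>auto simp: h m_closed adj_closed\<close>)+
  qed (use p s in auto)
qed

lemma kgraph_family_jointly:
  assumes A: "star_algebra A" and B: "\<And>i. i \<in> I \<Longrightarrow> star_algebra (B i)"
    and inj: "\<And>x y. \<lbrakk>x \<in> carrier A; y \<in> carrier A; \<And>i. i \<in> I \<Longrightarrow> j i x = j i y\<rbrakk> \<Longrightarrow> x = y"
    and hom: "\<And>i. i \<in> I \<Longrightarrow> star_hom A (B i) (j i)"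
    and t: "\<And>\<mu>. \<mu> \<in> mor \<Lambda> \<Longrightarrow> t \<mu> \<in> carrier A"
    and fam: "\<And>i. i \<in> I \<Longrightarrow> kgraph_family k \<Lambda> (B i) (\<lambda>\<mu>. j i (t \<mu>))"
  shows "kgraph_family k \<Lambda> A t"
proof -
  interpret star_algebra A by fact
  note h = star_homD[OF hom]
  note h0 = star_hom_zero[OF hom A B]
  note f = fam[unfolded kgraph_family_def projection_def]
  show ?thesis
    unfolding kgraph_family_def projection_def
  proof (intro conjI ballI impI)
    fix v m assume v: "v \<in> vertices \<Lambda>" and m: "m \<in> multi_nat k"
    have tt: "(\<lambda>\<mu>. t \<mu> \<otimes>\<^bsub>A\<^esub> (t \<mu>)\<^sup>\<star>\<^bsub>A\<^esub>) \<in> paths_le k \<Lambda> v m \<rightarrow> carrier A"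
      using t by (auto simp: paths_le_def m_closed adj_closed)
    show "t v = (\<Oplus>\<^bsub>A\<^esub>\<mu>\<in>paths_le k \<Lambda> v m. t \<mu> \<otimes>\<^bsub>A\<^esub> (t \<mu>)\<^sup>\<star>\<^bsub>A\<^esub>)"
    proof (rule inj)
      fix n assume n: "n \<in> I"
      interpret Bn: star_algebra "B n" by (rule B[OF n])
      have "j n (\<Oplus>\<^bsub>A\<^esub>\<mu>\<in>paths_le k \<Lambda> v m. t \<mu> \<otimes>\<^bsub>A\<^esub> (t \<mu>)\<^sup>\<star>\<^bsub>A\<^esub>)
          = (\<Oplus>\<^bsub>B n\<^esub>\<mu>\<in>paths_le k \<Lambda> v m. j n (t \<mu> \<otimes>\<^bsub>A\<^esub> (t \<mu>)\<^sup>\<star>\<^bsub>A\<^esub>))"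
        by (rule star_hom_finsum[OF hom[OF n] A B[OF n] tt])
      also have "\<dots> = (\<Oplus>\<^bsub>B n\<^esub>\<mu>\<in>paths_le k \<Lambda> v m. j n (t \<mu>) \<otimes>\<^bsub>B n\<^esub> (j n (t \<mu>))\<^sup>\<star>\<^bsub>B n\<^esub>)"
        by (rule Bn.finsum_cong')
          (use n t in \<open>auto simp: h m_closed adj_closed Bn.m_closed Bn.adj_closed paths_le_def\<close>)
      also have "\<dots> = j n (t v)" using f[OF n] v m by simp
      finally show "j n (t v) = j n (\<Oplus>\<^bsub>A\<^esub>\<mu>\<in>paths_le k \<Lambda> v m. t \<mu> \<otimes>\<^bsub>A\<^esub> (t \<mu>)\<^sup>\<star>\<^bsub>A\<^esub>)" by simp
    qed (use t v vertices_mor finsum_closed[OF tt] in auto)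
  next
    fix \<mu> assume \<mu>: "\<mu> \<in> mor \<Lambda>"
    show "t \<mu> \<otimes>\<^bsub>A\<^esub> (t \<mu>)\<^sup>\<star>\<^bsub>A\<^esub> \<otimes>\<^bsub>A\<^esub> t \<mu> = t \<mu>"
      by (rule inj) (use \<mu> t f in \<open>auto simp: h m_closed adj_closed\<close>)
    show "(t \<mu>)\<^sup>\<star>\<^bsub>A\<^esub> \<otimes>\<^bsub>A\<^esub> t \<mu> = t (src \<Lambda> \<mu>)"
      by (rule inj) (use \<mu> t f in \<open>auto simp: h m_closed adj_closed src_closed\<close>)
  next
    fix \<mu> \<nu> assume \<mu>: "\<mu> \<in> mor \<Lambda>" "\<nu> \<in> mor \<Lambda>" "src \<Lambda> \<mu> = rng \<Lambda> \<nu>"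
    show "t \<mu> \<otimes>\<^bsub>A\<^esub> t \<nu> = t (cmp \<Lambda> \<mu> \<nu>)"
      by (rule inj) (use \<mu> t f in \<open>auto simp: h m_closed cmp_closed\<close>)
  next
    fix v w assume vw: "v \<in> vertices \<Lambda>" "w \<in> vertices \<Lambda>" "v \<noteq> w"
    show "t v \<otimes>\<^bsub>A\<^esub> t w = \<zero>\<^bsub>A\<^esub>"
      by (rule inj) (use vw t f in \<open>auto simp: h h0 m_closed vertices_mor\<close>)
  next
    fix v assume v: "v \<in> vertices \<Lambda>"
    show "(t v)\<^sup>\<star>\<^bsub>A\<^esub> = t v" "t v \<otimes>\<^bsub>A\<^esub> t v = t v"
      by (rule inj; use v t f in \<open>auto simp: h m_closed adj_closed vertices_mor\<close>)+
  qed (use t vertices_mor in auto)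
qed

lemma CK_rep_bounded:
  assumes "cstar_algebra A" "CK_rep k \<Lambda> \<phi> A g" "a \<in> vertices \<Lambda> <+> edges k \<Lambda>"
  shows "g a \<in> carrier A \<and> cnorm A (g a) \<le> 1"
proof -
  interpret cstar_algebra A by fact
  have f: "CK_family k \<Lambda> \<phi> A (\<lambda>v. g (Inl v)) (\<lambda>\<mu>. g (Inr \<mu>))"
    using assms(2) by (simp add: CK_rep_def)
  consider v where "v \<in> vertices \<Lambda>" "a = Inl v" | \<mu> where "\<mu> \<in> edges k \<Lambda>" "a = Inr \<mu>"
    using assms(3) by blast
  then show ?thesis
  proof cases
    case 1
    then have "projection A (g a)" using f by (simp add: CK_family_def)
    then show ?thesis using projection_norm_le_1 by (simp add: projection_def)
  next
    case 2
    then have c: "g a \<in> carrier A" using f by (simp add: CK_family_def)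
    have "projection A ((g a)\<^sup>\<star>\<^bsub>A\<^esub> \<otimes>\<^bsub>A\<^esub> g a)"
      using f 2 by (simp add: CK_family_def src_in_vertices edges_mor)
    then show ?thesis using partial_isometry_norm_le_1[OF c] c by simp
  qed
qed

lemma kgraph_family_bounded:
  assumes "cstar_algebra A" "kgraph_family k \<Lambda> A t" "\<mu> \<in> mor \<Lambda>"
  shows "t \<mu> \<in> carrier A \<and> cnorm A (t \<mu>) \<le> 1"
proof -
  interpret cstar_algebra A by fact
  have c: "t \<mu> \<in> carrier A" using assms by (simp add: kgraph_family_def)
  have "projection A ((t \<mu>)\<^sup>\<star>\<^bsub>A\<^esub> \<otimes>\<^bsub>A\<^esub> t \<mu>)"
    using assms by (simp add: kgraph_family_def src_in_vertices)
  then show ?thesis using partial_isometry_norm_le_1[OF c] c by simp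
qed

theorem CK_universal:
  shows "cstar_algebra (CK_algebra k \<Lambda> \<phi>)"
    and "CK_family k \<Lambda> \<phi> (CK_algebra k \<Lambda> \<phi>) (CK_p k \<Lambda> \<phi>) (CK_s k \<Lambda> \<phi>)"
    and "cstar_generated (CK_algebra k \<Lambda> \<phi>) (CK_p k \<Lambda> \<phi> ` vertices \<Lambda> \<union> CK_s k \<Lambda> \<phi> ` edges k \<Lambda>)
      = carrier (CK_algebra k \<Lambda> \<phi>)"
    and "\<lbrakk>cstar_algebra (B :: 'b cstar); CK_family k \<Lambda> \<phi> B q r\<rbrakk> \<Longrightarrow>
      \<exists>\<pi>. star_hom (CK_algebra k \<Lambda> \<phi>) B \<pi> \<and>
        (\<forall>x\<in>carrier (CK_algebra k \<Lambda> \<phi>). cnorm B (\<pi> x) \<le> cnorm (CK_algebra k \<Lambda> \<phi>) x) \<and>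
        (\<forall>v\<in>vertices \<Lambda>. \<pi> (CK_p k \<Lambda> \<phi> v) = q v) \<and>
        (\<forall>\<mu>\<in>edges k \<Lambda>. \<pi> (CK_s k \<Lambda> \<phi> \<mu>) = r \<mu>)"
proof -
  let ?G = "vertices \<Lambda> <+> edges k \<Lambda>" let ?R = "CK_rep k \<Lambda> \<phi>"
  have "\<forall>A g. cstar_algebra A \<longrightarrow> ?R A g \<longrightarrow> (\<forall>a\<in>?G. g a \<in> carrier A \<and> cnorm A (g a) \<le> 1)"
    using CK_rep_bounded by blast
  note U = univ_algebra[OF this, folded CK_algebra_def]
  show U1: "cstar_algebra (CK_algebra k \<Lambda> \<phi>)" by (rule U)
  have "univ_gen ?R ` ?G = CK_p k \<Lambda> \<phi> ` vertices \<Lambda> \<union> CK_s k \<Lambda> \<phi> ` edges k \<Lambda>"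
    by (auto simp: CK_p_def CK_s_def Plus_def)
  then show "cstar_generated (CK_algebra k \<Lambda> \<phi>) (CK_p k \<Lambda> \<phi> ` vertices \<Lambda> \<union> CK_s k \<Lambda> \<phi> ` edges k \<Lambda>)
      = carrier (CK_algebra k \<Lambda> \<phi>)" using U(3) by simp
  show "CK_family k \<Lambda> \<phi> (CK_algebra k \<Lambda> \<phi>) (CK_p k \<Lambda> \<phi>) (CK_s k \<Lambda> \<phi>)"
  proof (rule CK_family_jointly[where I = "univ_reps ?R" and B = fst and j = "\<lambda>\<rho> x. x \<rho>"])
    show "star_algebra (CK_algebra k \<Lambda> \<phi>)" using U1 by (simp add: cstar_algebra_def)
    show "CK_family k \<Lambda> \<phi> (fst \<rho>) (\<lambda>v. CK_p k \<Lambda> \<phi> v \<rho>) (\<lambda>\<mu>. CK_s k \<Lambda> \<phi> \<mu> \<rho>)"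
      if "\<rho> \<in> univ_reps ?R" for \<rho>
      using that by (cases \<rho>) (auto simp: CK_p_def CK_s_def univ_gen_apply univ_reps_def CK_rep_def)
    show "x = y" if "x \<in> carrier (CK_algebra k \<Lambda> \<phi>)" "y \<in> carrier (CK_algebra k \<Lambda> \<phi>)"
      "\<And>\<rho>. \<rho> \<in> univ_reps ?R \<Longrightarrow> x \<rho> = y \<rho>" for x y
      using U(6) that by blast
  qed (use U(2,4) in \<open>auto simp: univ_reps_def cstar_algebra_def CK_p_def CK_s_def\<close>)
  assume B: "cstar_algebra B" and F: "CK_family k \<Lambda> \<phi> B q r"
  let ?h = "case_sum q r"
  have R: "CK_rep k \<Lambda> \<phi> B ?h" using F by (simp add: CK_rep_def)
  have hB: "\<forall>a\<in>?G. ?h a \<in> carrier B"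
    using CK_rep_bounded[OF B R] by blast
  obtain A :: "('e + 'e) univ_carrier cstar" and g j where
    A: "cstar_algebra A" "star_hom A B j" "inj_on j (carrier A)"
    "\<forall>x\<in>carrier A. cnorm B (j x) = cnorm A x"
    "\<forall>a\<in>?G. g a \<in> carrier A \<and> j (g a) = ?h a"
    using univ_carrier_copy[where G = ?G and h = ?h, OF B hB] by blast
  have e: "j (g (Inl v)) = q v" if "v \<in> vertices \<Lambda>" for v using bspec[OF A(5), of "Inl v"] that by auto
  have e': "j (g (Inr \<mu>)) = r \<mu>" if "\<mu> \<in> edges k \<Lambda>" for \<mu> using bspec[OF A(5), of "Inr \<mu>"] that by auto
  have cong: "CK_family k \<Lambda> \<phi> B (\<lambda>v. j (g (Inl v))) (\<lambda>\<mu>. j (g (Inr \<mu>)))"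
  proof -
    interpret B: cstar_algebra B by fact
    have sum: "(\<Oplus>\<^bsub>B\<^esub>\<mu>\<in>of_deg_at \<Lambda> v (unit_deg i). j (g (Inr \<mu>)) \<otimes>\<^bsub>B\<^esub> (j (g (Inr \<mu>)))\<^sup>\<star>\<^bsub>B\<^esub>)
        = (\<Oplus>\<^bsub>B\<^esub>\<mu>\<in>of_deg_at \<Lambda> v (unit_deg i). r \<mu> \<otimes>\<^bsub>B\<^esub> (r \<mu>)\<^sup>\<star>\<^bsub>B\<^esub>)" if "i \<in> {1..k}" for v i
      by (rule B.finsum_cong') (use F of_deg_edges that in
        \<open>auto simp: CK_family_def e' of_deg_at_def B.m_closed B.adj_closed\<close>)
    show ?thesis
      using F unfolding CK_family_def
      by (auto simp: e e' sum src_in_vertices edges_mor of_deg_edges)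
  qed
  have "CK_family k \<Lambda> \<phi> A (\<lambda>v. g (Inl v)) (\<lambda>\<mu>. g (Inr \<mu>))"
    by (rule CK_family_jointly[where I = "{()}" and B = "\<lambda>_. B" and j = "\<lambda>_. j"])
      (use A B cong in \<open>auto simp: cstar_algebra_def dest: inj_onD\<close>)
  then have rho: "(A, g) \<in> univ_reps ?R" using A(1) by (simp add: univ_reps_def CK_rep_def)
  have hom: "star_hom (CK_algebra k \<Lambda> \<phi>) B (\<lambda>x. j (x (A, g)))"
    by (rule star_hom_comp[OF U(4)[OF rho] A(2)])
  show "\<exists>\<pi>. star_hom (CK_algebra k \<Lambda> \<phi>) B \<pi> \<and>
        (\<forall>x\<in>carrier (CK_algebra k \<Lambda> \<phi>). cnorm B (\<pi> x) \<le> cnorm (CK_algebra k \<Lambda> \<phi>) x) \<and>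
        (\<forall>v\<in>vertices \<Lambda>. \<pi> (CK_p k \<Lambda> \<phi> v) = q v) \<and>
        (\<forall>\<mu>\<in>edges k \<Lambda>. \<pi> (CK_s k \<Lambda> \<phi> \<mu>) = r \<mu>)"
  proof (rule exI[where x = "\<lambda>x. j (x (A, g))"], intro conjI ballI)
    show "cnorm B (j (x (A, g))) \<le> cnorm (CK_algebra k \<Lambda> \<phi>) x"
      if x: "x \<in> carrier (CK_algebra k \<Lambda> \<phi>)" for x
      using U(5)[OF rho x] A(4) star_homD(1)[OF U(4)[OF rho] x] by simp
  qed (use rho in \<open>simp_all add: hom e e' CK_p_def CK_s_def univ_gen_apply\<close>)
qed

theorem kgraph_universal:
  shows "cstar_algebra (kgraph_algebra k \<Lambda>)"
    and "kgraph_family k \<Lambda> (kgraph_algebra k \<Lambda>) (kgraph_t k \<Lambda>)"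
    and "cstar_generated (kgraph_algebra k \<Lambda>) (kgraph_t k \<Lambda> ` mor \<Lambda>) = carrier (kgraph_algebra k \<Lambda>)"
    and "\<lbrakk>cstar_algebra (B :: 'b cstar); kgraph_family k \<Lambda> B r\<rbrakk> \<Longrightarrow>
      \<exists>\<pi>. star_hom (kgraph_algebra k \<Lambda>) B \<pi> \<and>
        (\<forall>x\<in>carrier (kgraph_algebra k \<Lambda>). cnorm B (\<pi> x) \<le> cnorm (kgraph_algebra k \<Lambda>) x) \<and>
        (\<forall>\<mu>\<in>mor \<Lambda>. \<pi> (kgraph_t k \<Lambda> \<mu>) = r \<mu>)"
proof -
  let ?R = "kgraph_family k \<Lambda>"
  have "\<forall>A g. cstar_algebra A \<longrightarrow> ?R A g \<longrightarrow>
      (\<forall>a\<in>mor \<Lambda>. g a \<in> carrier A \<and> cnorm A (g a) \<le> 1)"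
    using kgraph_family_bounded by blast
  note U = univ_algebra[OF this, folded kgraph_algebra_def]
  have t: "kgraph_t k \<Lambda> = univ_gen ?R" by (auto simp: kgraph_t_def)
  show U1: "cstar_algebra (kgraph_algebra k \<Lambda>)" by (rule U)
  show "cstar_generated (kgraph_algebra k \<Lambda>) (kgraph_t k \<Lambda> ` mor \<Lambda>) = carrier (kgraph_algebra k \<Lambda>)"
    using U(3) by (simp add: t)
  show "kgraph_family k \<Lambda> (kgraph_algebra k \<Lambda>) (kgraph_t k \<Lambda>)"
  proof (rule kgraph_family_jointly[where I = "univ_reps ?R" and B = fst and j = "\<lambda>\<rho> x. x \<rho>"])
    show "star_algebra (kgraph_algebra k \<Lambda>)" using U1 by (simp add: cstar_algebra_def)
    show "kgraph_family k \<Lambda> (fst \<rho>) (\<lambda>\<mu>. kgraph_t k \<Lambda> \<mu> \<rho>)" if "\<rho> \<in> univ_reps ?R" for \<rho>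
      using that by (cases \<rho>) (auto simp: t univ_gen_apply univ_reps_def)
    show "x = y" if "x \<in> carrier (kgraph_algebra k \<Lambda>)" "y \<in> carrier (kgraph_algebra k \<Lambda>)"
      "\<And>\<rho>. \<rho> \<in> univ_reps ?R \<Longrightarrow> x \<rho> = y \<rho>" for x y
      using U(6) that by blast
  qed (use U(2,4) in \<open>auto simp: univ_reps_def cstar_algebra_def t\<close>)
  assume B: "cstar_algebra B" and F: "kgraph_family k \<Lambda> B r"
  have rB: "\<forall>\<mu>\<in>mor \<Lambda>. r \<mu> \<in> carrier B"
    using kgraph_family_bounded[OF B F] by blast
  obtain A :: "'e univ_carrier cstar" and g j where
    A: "cstar_algebra A" "star_hom A B j" "inj_on j (carrier A)"
    "\<forall>x\<in>carrier A. cnorm B (j x) = cnorm A x"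
    "\<forall>a\<in>mor \<Lambda>. g a \<in> carrier A \<and> j (g a) = r a"
    using univ_carrier_copy[where G = "mor \<Lambda>" and h = r, OF B rB] by blast
  have cong: "kgraph_family k \<Lambda> B (\<lambda>\<mu>. j (g \<mu>))"
  proof -
    have e: "j (g \<mu>) = r \<mu>" if "\<mu> \<in> mor \<Lambda>" for \<mu> using A(5) that by auto
    interpret B: cstar_algebra B by fact
    have sum: "(\<Oplus>\<^bsub>B\<^esub>\<mu>\<in>paths_le k \<Lambda> v m. j (g \<mu>) \<otimes>\<^bsub>B\<^esub> (j (g \<mu>))\<^sup>\<star>\<^bsub>B\<^esub>)
        = (\<Oplus>\<^bsub>B\<^esub>\<mu>\<in>paths_le k \<Lambda> v m. r \<mu> \<otimes>\<^bsub>B\<^esub> (r \<mu>)\<^sup>\<star>\<^bsub>B\<^esub>)" for v m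
      by (rule B.finsum_cong') (use F in
        \<open>auto simp: kgraph_family_def e paths_le_def B.m_closed B.adj_closed\<close>)
    show ?thesis
      using F unfolding kgraph_family_def
      by (auto simp: e sum src_closed cmp_closed vertices_mor)
  qed
  have "kgraph_family k \<Lambda> A g"
    by (rule kgraph_family_jointly[where I = "{()}" and B = "\<lambda>_. B" and j = "\<lambda>_. j"])
      (use A B cong in \<open>auto simp: cstar_algebra_def dest: inj_onD\<close>)
  then have rho: "(A, g) \<in> univ_reps ?R" using A(1) by (simp add: univ_reps_def)
  have hom: "star_hom (kgraph_algebra k \<Lambda>) B (\<lambda>x. j (x (A, g)))"
    by (rule star_hom_comp[OF U(4)[OF rho] A(2)])
  show "\<exists>\<pi>. star_hom (kgraph_algebra k \<Lambda>) B \<pi> \<and>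
        (\<forall>x\<in>carrier (kgraph_algebra k \<Lambda>). cnorm B (\<pi> x) \<le> cnorm (kgraph_algebra k \<Lambda>) x) \<and>
        (\<forall>\<mu>\<in>mor \<Lambda>. \<pi> (kgraph_t k \<Lambda> \<mu>) = r \<mu>)"
  proof (rule exI[where x = "\<lambda>x. j (x (A, g))"], intro conjI ballI)
    show "cnorm B (j (x (A, g))) \<le> cnorm (kgraph_algebra k \<Lambda>) x"
      if x: "x \<in> carrier (kgraph_algebra k \<Lambda>)" for x
      using U(5)[OF rho x] A(4) star_homD(1)[OF U(4)[OF rho] x] by simp
  qed (use A(5) rho in \<open>simp_all add: hom t univ_gen_apply\<close>)
qed

end

end

theory Submission
  imports Defs
begin

text \<open>
  Both isomorphisms come from universal properties. If two C*-algebras, each generated by a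
  family of elements, admit *-homomorphisms in both directions that invert each other on the
  generators, then both composites fix a closed *-subalgebra containing the generators, hence
  everything (\<open>star_iso_from_inverse_on_generators\<close>). So it suffices to convert
  one kind of family into the other.

  For cohomologous cocycles the conversion multiplies the edge operators by \<open>\<alpha>\<close>. On a
  commuting square of edges the four values of \<open>\<alpha>\<close> combine to the value of
  \<open>\<delta>\<^sup>1(\<alpha>)\<close>, which is exactly the discrepancy between the two commutation relations
  (\<open>CK_family_twist\<close>). The inverse is multiplication by \<open>\<alpha>\<^sup>-\<^sup>1\<close>.

  For the trivial cocycle, a family indexed by all paths restricts to one indexed by vertices
  and edges (\<open>kgraph_family_restricts\<close>). Conversely, the operator of a path is the product
  of the edge operators along any factorisation into edges; two factorisations differ by
  commuting squares, and with trivial cocycle the product does not notice them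
  (\<open>path_value_unique\<close>). The summation relation over \<open>v\<Lambda>\<^sup>\<le>\<^sup>m\<close> follows by splitting off first
  edges one direction at a time. Local convexity guarantees that every path in \<open>v\<Lambda>\<^sup>\<le>\<^sup>m\<close> has a
  step in direction \<open>i\<close> whenever \<open>m\<^sub>i > 0\<close> and \<open>v\<close> is the range of an edge in that direction
  (\<open>paths_le_first_edge\<close>).

  Multiplicativity of the path operators at a vertex needs \<open>p\<^bsub>r(\<mu>)\<^esub> s\<^sub>\<mu> = s\<^sub>\<mu>\<close>, and this has to be
  extracted from \<open>p\<^sub>v = \<Sum> s\<^sub>\<mu> s\<^sub>\<mu>\<^sup>*\<close>: projections whose sum is a projection lie under that sum. The
  usual argument invokes the order on a C*-algebra. Here it is replaced by a norm estimate
  (\<open>projection_sum_absorbs_summand\<close>) that uses only the C*-identity and rests on the fact that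
  the identity is an extreme point of the unit ball (\<open>self_adjoint_perturbation_zero\<close>).
\<close>


section \<open>Projections in a C*-algebra\<close>

context star_algebra
begin

lemma scale_zero: "c \<odot> \<zero> = \<zero>"
  using scale_scale[of \<zero> c 0] scale_0_zero[of \<zero>] by simp

lemma zero_mult: "x \<in> carrier A \<Longrightarrow> \<zero> \<otimes> x = \<zero>"
  using scale_mult_left[of \<zero> x 0] by (simp add: scale_0_zero m_closed)

lemma mult_zero: "x \<in> carrier A \<Longrightarrow> x \<otimes> \<zero> = \<zero>"
  using scale_mult_right[of x \<zero> 0] by (simp add: scale_0_zero m_closed)

lemma finsum_mult_right:
  assumes "g \<in> S \<rightarrow> carrier A" "x \<in> carrier A"
  shows "finsum A g S \<otimes> x = (\<Oplus>i\<in>S. g i \<otimes> x)"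
  using assms
proof (induction S rule: infinite_finite_induct)
  case (insert i S)
  then have "finsum A g (insert i S) = g i \<oplus> finsum A g S" by (intro finsum_insert) auto
  moreover have "(\<Oplus>j\<in>insert i S. g j \<otimes> x) = g i \<otimes> x \<oplus> (\<Oplus>j\<in>S. g j \<otimes> x)"
    using insert by (intro finsum_insert) (auto simp: Pi_iff m_closed)
  ultimately show ?case using insert by (simp add: l_distr)
qed (simp_all add: zero_mult)

lemma finsum_mult_left:
  assumes "g \<in> S \<rightarrow> carrier A" "x \<in> carrier A"
  shows "x \<otimes> finsum A g S = (\<Oplus>i\<in>S. x \<otimes> g i)"
  using assms
proof (induction S rule: infinite_finite_induct)
  case (insert i S)
  then have "finsum A g (insert i S) = g i \<oplus> finsum A g S" by (intro finsum_insert) auto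
  moreover have "(\<Oplus>j\<in>insert i S. x \<otimes> g j) = x \<otimes> g i \<oplus> (\<Oplus>j\<in>S. x \<otimes> g j)"
    using insert by (intro finsum_insert) (auto simp: Pi_iff m_closed)
  ultimately show ?case using insert by (simp add: r_distr)
qed (simp_all add: mult_zero)

text \<open>Since there is no unit, the operator \<open>1 + zc\<close> is represented by its action
  \<open>x \<mapsto> x + z(cx)\<close>. The next three lemmas are its calculus: convex combination and composition
  of such operators, and the passage to the adjoint.\<close>

lemma average_perturbations:
  assumes "x \<in> carrier A" "u \<in> carrier A" "v \<in> carrier A"
  shows "complex_of_real t \<odot> (x \<oplus> a \<odot> u \<oplus> b \<odot> v)
      \<oplus> complex_of_real (1 - t) \<odot> (x \<oplus> a' \<odot> u \<oplus> b' \<odot> v)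
    = x \<oplus> (complex_of_real t * a + complex_of_real (1 - t) * a') \<odot> u \<oplus> (complex_of_real t * b + complex_of_real (1 - t) * b') \<odot> v"
proof -
  let ?s = "complex_of_real t" let ?s' = "complex_of_real (1 - t)"
  have "?s \<odot> x \<oplus> ?s' \<odot> x = x"
    using add_scale[OF assms(1), of ?s ?s'] by (simp add: scale_one assms)
  then have "x \<oplus> (complex_of_real t * a + complex_of_real (1 - t) * a') \<odot> u \<oplus> (complex_of_real t * b + complex_of_real (1 - t) * b') \<odot> v
    = (?s \<odot> x \<oplus> ?s' \<odot> x) \<oplus> (?s * a + ?s' * a') \<odot> u \<oplus> (?s * b + ?s' * b') \<odot> v"
    by simp
  also have "\<dots> = ?s \<odot> (x \<oplus> a \<odot> u \<oplus> b \<odot> v) \<oplus> ?s' \<odot> (x \<oplus> a' \<odot> u \<oplus> b' \<odot> v)"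
    unfolding add_scale[OF assms(2)] add_scale[OF assms(3)]
    using assms by (simp add: scale_add scale_scale scale_closed a_ac)
  finally show ?thesis by simp
qed

lemma compose_perturbations:
  assumes "x \<in> carrier A" "c \<in> carrier A"
  shows "(x \<oplus> z \<odot> (c \<otimes> x)) \<oplus> w \<odot> (c \<otimes> (x \<oplus> z \<odot> (c \<otimes> x)))
    = x \<oplus> (z + w) \<odot> (c \<otimes> x) \<oplus> (z * w) \<odot> (c \<otimes> (c \<otimes> x))"
  using assms
  by (simp add: r_distr scale_mult_right scale_add add_scale scale_scale scale_closed m_closed a_ac
      mult.commute)

lemma adj_perturbation_mult:
  assumes "x \<in> carrier A" "c \<in> carrier A" "c\<^sup>\<star> = c" "y \<in> carrier A"
  shows "(x \<oplus> z \<odot> (c \<otimes> x))\<^sup>\<star> \<otimes> y = x\<^sup>\<star> \<otimes> (y \<oplus> cnj z \<odot> (c \<otimes> y))"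
  using assms
  by (simp add: adj_add adj_scale adj_mult l_distr r_distr scale_mult_left scale_mult_right
      scale_closed m_closed adj_closed m_assoc)

end

context cstar_algebra
begin

lemma norm_add_scale_le:
  assumes "x \<in> carrier A" "y \<in> carrier A" "cnorm A x \<le> M" "cnorm A y \<le> M" "0 \<le> t" "t \<le> 1"
  shows "cnorm A (complex_of_real t \<odot> x \<oplus> complex_of_real (1 - t) \<odot> y) \<le> M"
proof -
  have "cnorm A (complex_of_real t \<odot> x \<oplus> complex_of_real (1 - t) \<odot> y)
    \<le> t * cnorm A x + (1 - t) * cnorm A y"
    using norm_triangle[of "complex_of_real t \<odot> x" "complex_of_real (1 - t) \<odot> y"] assms
    by (simp add: norm_scale scale_closed del: of_real_diff)
  also have "\<dots> \<le> t * M + (1 - t) * M"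
    using assms by (intro add_mono mult_left_mono) auto
  finally show ?thesis by (simp add: algebra_simps)
qed

lemma norm_average_perturbations_le:
  assumes "x \<in> carrier A" "u \<in> carrier A" "v \<in> carrier A"
    and "cnorm A (x \<oplus> a \<odot> u \<oplus> b \<odot> v) \<le> M" "cnorm A (x \<oplus> a' \<odot> u \<oplus> b' \<odot> v) \<le> M"
    and "0 \<le> t" "t \<le> 1"
  shows "cnorm A (x \<oplus> (complex_of_real t * a + complex_of_real (1 - t) * a') \<odot> u \<oplus> (complex_of_real t * b + complex_of_real (1 - t) * b') \<odot> v) \<le> M"
  unfolding average_perturbations[OF assms(1-3), symmetric]
  by (rule norm_add_scale_le) (use assms in \<open>auto simp: scale_closed\<close>)

lemma norm_convex_perturbation_le:
  assumes "x \<in> carrier A" "u \<in> carrier A"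
    and "cnorm A (x \<oplus> a \<odot> u) \<le> M" "cnorm A (x \<oplus> b \<odot> u) \<le> M" "0 \<le> t" "t \<le> 1"
  shows "cnorm A (x \<oplus> (complex_of_real t * a + complex_of_real (1 - t) * b) \<odot> u) \<le> M"
  using norm_average_perturbations_le[of x u \<zero> a 0 M b 0 t] assms
  by (simp add: scale_zero scale_closed)

text \<open>The identity is an extreme point of the unit ball, in the form: if \<open>1 + c\<close> and \<open>1 - c\<close> are
  contractions on \<open>V\<close> and \<open>c\<close> is self-adjoint, then \<open>c\<close> vanishes on \<open>V\<close>. Averaging the squares
  of \<open>1 \<plusminus> c\<close> shows that \<open>1 + c\<^sup>2 = (1 \<plusminus> \<i>c)\<^sup>*(1 \<plusminus> \<i>c)\<close> is a contraction, so \<open>1 \<plusminus> \<i>c\<close> are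
  contractions by the C*-identity. By convexity \<open>1 + zc\<close> is a contraction for all \<open>z\<close> in a disc.
  The radius of such a disc can be enlarged by the factor \<open>\<surd>2\<close>:
  \<open>1 + yc\<close> is the average of the squares of \<open>1 + (1 \<plusminus> \<i>)(y/2)c\<close>, whose quadratic terms cancel.
  Iterating, \<open>1 + zc\<close> is a contraction for every complex \<open>z\<close>, which forces \<open>cx = 0\<close> for \<open>x\<close> in \<open>V\<close>.\<close>

lemma self_adjoint_perturbation_zero:
  assumes V: "V \<subseteq> carrier A" "\<And>x z. x \<in> V \<Longrightarrow> x \<oplus> z \<odot> (c \<otimes> x) \<in> V"
    and c: "c \<in> carrier A" "c\<^sup>\<star> = c"
    and plus: "\<And>x. x \<in> V \<Longrightarrow> cnorm A (x \<oplus> 1 \<odot> (c \<otimes> x)) \<le> cnorm A x"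
    and minus: "\<And>x. x \<in> V \<Longrightarrow> cnorm A (x \<oplus> (-1) \<odot> (c \<otimes> x)) \<le> cnorm A x"
    and x: "x \<in> V"
  shows "c \<otimes> x = \<zero>"
proof -
  note cl = m_closed scale_closed adj_closed
  define D where "D r \<longleftrightarrow> (\<forall>z. cmod z \<le> r \<longrightarrow>
    (\<forall>x\<in>V. cnorm A (x \<oplus> z \<odot> (c \<otimes> x)) \<le> cnorm A x))" for r
  have comp: "cnorm A (x \<oplus> (z + w) \<odot> (c \<otimes> x) \<oplus> (z * w) \<odot> (c \<otimes> (c \<otimes> x))) \<le> cnorm A x"
    if x: "x \<in> V" and z: "\<And>x. x \<in> V \<Longrightarrow> cnorm A (x \<oplus> z \<odot> (c \<otimes> x)) \<le> cnorm A x"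
      and w: "\<And>x. x \<in> V \<Longrightarrow> cnorm A (x \<oplus> w \<odot> (c \<otimes> x)) \<le> cnorm A x" for x z w
  proof -
    have "x \<in> carrier A" using x V(1) by blast
    from compose_perturbations[OF this c(1), of z w]
    show ?thesis using z[OF x] w[OF V(2)[OF x, of z]] by simp
  qed
  \<comment> \<open>the only place where self-adjointness of \<open>c\<close> enters\<close>
  have imag: "cnorm A (x \<oplus> z \<odot> (c \<otimes> x)) \<le> cnorm A x"
    if x: "x \<in> V" and z: "z = \<i> \<or> z = - \<i>" for x z
  proof -
    have xc: "x \<in> carrier A" using x V(1) by blast
    let ?y = "x \<oplus> z \<odot> (c \<otimes> x)"
    let ?w = "x \<oplus> 0 \<odot> (c \<otimes> x) \<oplus> 1 \<odot> (c \<otimes> (c \<otimes> x))"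
    have yc: "?y \<in> carrier A" using xc c by (simp add: cl)
    have wc: "?w \<in> carrier A" using xc c by (simp add: cl)
    have zz: "z + cnj z = 0" "z * cnj z = 1" using z by auto
    have "cnorm A (x \<oplus> (complex_of_real (1/2) * (1 + 1) + complex_of_real (1 - 1/2) * (-1 + -1)) \<odot> (c \<otimes> x)
       \<oplus> (complex_of_real (1/2) * (1 * 1) + complex_of_real (1 - 1/2) * (-1 * -1)) \<odot> (c \<otimes> (c \<otimes> x))) \<le> cnorm A x"
      using norm_average_perturbations_le[OF _ _ _ comp[OF x plus plus] comp[OF x minus minus], of "1/2"]
        xc c by (simp add: cl)
    then have w: "cnorm A ?w \<le> cnorm A x" by simp
    have "?y\<^sup>\<star> \<otimes> ?y = x\<^sup>\<star> \<otimes> ?w"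
      using adj_perturbation_mult[OF xc c yc, of z] compose_perturbations[OF xc c(1), of z "cnj z"]
      by (simp add: zz)
    then have "(cnorm A ?y)\<^sup>2 = cnorm A (x\<^sup>\<star> \<otimes> ?w)" using cstar_identity[OF yc] by simp
    also have "\<dots> \<le> cnorm A x * cnorm A ?w"
      using norm_mult_le[OF adj_closed[OF xc] wc] by (simp add: norm_adj xc)
    also have "\<dots> \<le> cnorm A x * cnorm A x"
      using w by (intro mult_left_mono norm_nonneg xc)
    finally have "(cnorm A ?y)\<^sup>2 \<le> (cnorm A x)\<^sup>2" by (simp only: power2_eq_square)
    then show ?thesis using norm_nonneg[OF xc] by (rule power2_le_imp_le)
  qed
  have segment: "cnorm A (x \<oplus> (complex_of_real r * z) \<odot> (c \<otimes> x)) \<le> cnorm A x"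
    if x: "x \<in> V" and r: "\<bar>r\<bar> \<le> 1"
      and "cnorm A (x \<oplus> z \<odot> (c \<otimes> x)) \<le> cnorm A x" "cnorm A (x \<oplus> (- z) \<odot> (c \<otimes> x)) \<le> cnorm A x"
    for x r z
  proof -
    have xc: "x \<in> carrier A" using x V(1) by blast
    have "complex_of_real ((1 + r)/2) * z + complex_of_real (1 - (1 + r)/2) * (- z) = complex_of_real r * z"
      by (simp add: field_simps)
    then show ?thesis
      using norm_convex_perturbation_le[of x "c \<otimes> x" z "cnorm A x" "- z" "(1 + r)/2"] that xc c
      by (auto simp: cl)
  qed
  have D0: "D (1/2)"
    unfolding D_def
  proof (intro allI impI ballI)
    fix z x assume z: "cmod z \<le> 1/2" and x: "x \<in> V"
    have xc: "x \<in> carrier A" using x V(1) by blast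
    have "\<bar>2 * Re z\<bar> \<le> 1" "\<bar>2 * Im z\<bar> \<le> 1"
      using z abs_Re_le_cmod[of z] abs_Im_le_cmod[of z] by auto
    then have "cnorm A (x \<oplus> (complex_of_real (2 * Re z) * 1) \<odot> (c \<otimes> x)) \<le> cnorm A x"
      "cnorm A (x \<oplus> (complex_of_real (2 * Im z) * \<i>) \<odot> (c \<otimes> x)) \<le> cnorm A x"
      using segment[OF x, of "2 * Re z" 1, OF _ plus[OF x] minus[OF x]]
        segment[OF x, of "2 * Im z" \<i>, OF _ imag[OF x] imag[OF x]] by auto
    from norm_convex_perturbation_le[OF _ _ this, of "1/2"]
    have "cnorm A (x \<oplus> (complex_of_real (1/2) * (complex_of_real (2 * Re z) * 1)
      + complex_of_real (1 - 1/2) * (complex_of_real (2 * Im z) * \<i>)) \<odot> (c \<otimes> x)) \<le> cnorm A x"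
      using xc c by (simp add: cl)
    also have "complex_of_real (1/2) * (complex_of_real (2 * Re z) * 1)
      + complex_of_real (1 - 1/2) * (complex_of_real (2 * Im z) * \<i>) = z"
      by (simp add: complex_eq_iff)
    finally show "cnorm A (x \<oplus> z \<odot> (c \<otimes> x)) \<le> cnorm A x" .
  qed
  have step: "D (sqrt 2 * r)" if D: "D r" for r
    unfolding D_def
  proof (intro allI impI ballI)
    fix y x assume y: "cmod y \<le> sqrt 2 * r" and x: "x \<in> V"
    have xc: "x \<in> carrier A" using x V(1) by blast
    define z where "z = (1 + \<i>) * (y / 2)"
    define z' where "z' = (1 - \<i>) * (y / 2)"
    have "cmod (1 + \<i>) = sqrt 2" "cmod (1 - \<i>) = sqrt 2" by (simp_all add: cmod_def)
    then have "cmod z = sqrt 2 * cmod y / 2" "cmod z' = sqrt 2 * cmod y / 2"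
      by (simp_all only: z_def z'_def norm_mult norm_divide) simp_all
    moreover have "sqrt 2 * cmod y \<le> sqrt 2 * (sqrt 2 * r)" using y by (intro mult_left_mono) auto
    ultimately have "cmod z \<le> r" "cmod z' \<le> r" by (simp_all add: mult.assoc[symmetric])
    then have zb: "cnorm A (x \<oplus> z \<odot> (c \<otimes> x)) \<le> cnorm A x" "cnorm A (x \<oplus> z' \<odot> (c \<otimes> x)) \<le> cnorm A x"
      if "x \<in> V" for x using D that by (auto simp: D_def)
    have "cnorm A (x \<oplus> (complex_of_real (1/2) * (z + z) + complex_of_real (1 - 1/2) * (z' + z')) \<odot> (c \<otimes> x)
       \<oplus> (complex_of_real (1/2) * (z * z) + complex_of_real (1 - 1/2) * (z' * z')) \<odot> (c \<otimes> (c \<otimes> x))) \<le> cnorm A x"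
      using norm_average_perturbations_le[OF _ _ _ comp[OF x zb(1) zb(1)] comp[OF x zb(2) zb(2)], of "1/2"]
        xc c by (simp add: cl)
    also have "complex_of_real (1/2) * (z + z) + complex_of_real (1 - 1/2) * (z' + z') = y"
      by (simp add: z_def z'_def field_simps)
    also have "complex_of_real (1/2) * (z * z) + complex_of_real (1 - 1/2) * (z' * z') = 0"
      by (simp add: z_def z'_def field_simps)
    finally show "cnorm A (x \<oplus> y \<odot> (c \<otimes> x)) \<le> cnorm A x"
      using xc c by (simp add: scale_0_zero cl)
  qed
  have Dn: "D (sqrt 2 ^ n * (1/2))" for n
  proof (induction n)
    case (Suc n)
    from step[OF this] show ?case by (simp only: power_Suc mult.assoc)
  qed (use D0 in simp)
  have xc: "x \<in> carrier A" using x V(1) by blast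
  have bound: "sqrt 2 ^ n * cnorm A (c \<otimes> x) \<le> 4 * cnorm A x" for n
  proof -
    let ?z = "complex_of_real (sqrt 2 ^ n * (1/2))"
    have "cnorm A (x \<oplus> ?z \<odot> (c \<otimes> x)) \<le> cnorm A x"
      using Dn[of n] x by (simp add: D_def norm_power norm_mult norm_divide)
    moreover have "?z \<odot> (c \<otimes> x) = (x \<oplus> ?z \<odot> (c \<otimes> x)) \<oplus> (-1) \<odot> x"
      using xc c by (simp add: cl a_inv_eq_scale[symmetric] a_ac r_neg1 r_neg2 r_neg)
    ultimately have "cnorm A (?z \<odot> (c \<otimes> x)) \<le> cnorm A x + cnorm A x"
      using norm_triangle[of "x \<oplus> ?z \<odot> (c \<otimes> x)" "(-1) \<odot> x"] xc c
      by (simp add: cl norm_scale del: of_real_mult)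
    then show ?thesis
      using xc c by (simp add: norm_scale cl norm_power norm_mult norm_divide)
  qed
  have "cnorm A (c \<otimes> x) \<le> 0"
  proof (rule ccontr)
    assume "\<not> cnorm A (c \<otimes> x) \<le> 0"
    then have pos: "cnorm A (c \<otimes> x) > 0" by simp
    have "(1::real) < sqrt 2" by simp
    from real_arch_pow[OF this, of "4 * cnorm A x / cnorm A (c \<otimes> x)"]
    obtain n where "4 * cnorm A x / cnorm A (c \<otimes> x) < sqrt 2 ^ n" by blast
    with bound[of n] pos show False by (simp add: field_simps)
  qed
  then show ?thesis
    using norm_nonneg[of "c \<otimes> x"] norm_zero_iff[of "c \<otimes> x"] xc c by (simp add: cl)
qed

text \<open>\<open>1 - 2e\<close> is a self-adjoint involution, hence isometric.\<close>

lemma projection_reflection_norm_le: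
  assumes e: "projection A e" and x: "x \<in> carrier A"
  shows "cnorm A (x \<oplus> (-2) \<odot> (e \<otimes> x)) \<le> cnorm A x"
proof -
  have ec: "e \<in> carrier A" "e\<^sup>\<star> = e" "e \<otimes> e = e" using e by (auto simp: projection_def)
  let ?y = "x \<oplus> (-2) \<odot> (e \<otimes> x)"
  have yc: "?y \<in> carrier A" using x ec by (simp add: m_closed scale_closed)
  have "e \<otimes> (e \<otimes> x) = e \<otimes> x" using m_assoc[OF ec(1) ec(1) x] ec by simp
  moreover have "x \<oplus> (-4) \<odot> (e \<otimes> x) \<oplus> 4 \<odot> (e \<otimes> x) = x \<oplus> (-4 + 4) \<odot> (e \<otimes> x)"
    using x ec add_scale[of "e \<otimes> x" "-4" 4] by (simp only: m_closed scale_closed a_assoc)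
  ultimately have "?y \<oplus> (-2) \<odot> (e \<otimes> ?y) = x"
    using compose_perturbations[OF x ec(1), of "-2" "-2"] x ec by (simp add: scale_0_zero m_closed)
  then have "?y\<^sup>\<star> \<otimes> ?y = x\<^sup>\<star> \<otimes> x"
    using adj_perturbation_mult[OF x ec(1,2) yc, of "-2"] by simp
  then have "(cnorm A ?y)\<^sup>2 = (cnorm A x)\<^sup>2"
    using cstar_identity[OF yc] cstar_identity[OF x] by simp
  then have "(cnorm A ?y)\<^sup>2 \<le> (cnorm A x)\<^sup>2" by (rule eq_refl)
  then show ?thesis using norm_nonneg[OF x] by (rule power2_le_imp_le)
qed

text \<open>\<open>1 - e\<close> is the average of \<open>1\<close> and \<open>1 - 2e\<close>.\<close>

lemma projection_complement_norm_le:
  assumes e: "projection A e" and x: "x \<in> carrier A"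
  shows "cnorm A (x \<oplus> (-1) \<odot> (e \<otimes> x)) \<le> cnorm A x"
proof -
  have ec: "e \<in> carrier A" using e by (simp add: projection_def)
  show ?thesis
    using norm_convex_perturbation_le[OF x m_closed[OF ec x] _ projection_reflection_norm_le[OF e x],
        of 0 "1/2"] x ec by (simp add: scale_0_zero m_closed)
qed

text \<open>On \<open>V = {x. px = 0}\<close> the compressions \<open>(1 - p) q\<^sub>i (1 - p)\<close> add up to zero, while each
  \<open>1 - 2(1 - p) q\<^sub>i (1 - p)\<close> acts as a contraction. Hence so does the average of these over
  \<open>i \<noteq> j\<close>, which is \<open>1 + c\<close> for \<open>c = (2/m) (1 - p) q\<^sub>j (1 - p)\<close> with \<open>m\<close> the number of such
  \<open>i\<close>; and \<open>1 - c\<close> is a convex combination of \<open>1\<close> and \<open>1 - 2(1 - p) q\<^sub>j (1 - p)\<close>.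
  So \<open>c = 0\<close> on \<open>V\<close> by extremality of the identity, and applying this to
  \<open>(1 - p) q\<^sub>j\<close> itself gives \<open>(1 - p) q\<^sub>j = 0\<close>. (If there is no \<open>i \<noteq> j\<close>, then \<open>p = q\<^sub>j\<close>.)\<close>

lemma projection_sum_absorbs_summand:
  assumes I: "finite I" and q: "\<And>i. i \<in> I \<Longrightarrow> projection A (q i)"
    and p: "projection A p" and sum: "p = finsum A q I" and j: "j \<in> I"
  shows "p \<otimes> q j = q j"
proof -
  note cl = m_closed scale_closed adj_closed
  have pc: "p \<in> carrier A" "p\<^sup>\<star> = p" "p \<otimes> p = p" using p by (auto simp: projection_def)
  have qc: "q i \<in> carrier A" "(q i)\<^sup>\<star> = q i" "q i \<otimes> q i = q i" if "i \<in> I" for i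
    using q[OF that] by (auto simp: projection_def)
  define V where "V = {x \<in> carrier A. p \<otimes> x = \<zero>}"
  \<comment> \<open>left multiplication by \<open>1 - p\<close>\<close>
  define R where "R y = y \<oplus> (-1) \<odot> (p \<otimes> y)" for y
  have Rc: "R y \<in> carrier A" if "y \<in> carrier A" for y using that pc by (simp add: R_def cl)
  have pp: "p \<otimes> (p \<otimes> y) = p \<otimes> y" if "y \<in> carrier A" for y
    using m_assoc[OF pc(1) pc(1) that] pc by simp
  have cancel: "y \<oplus> (-1) \<odot> y = \<zero>" if "y \<in> carrier A" for y
    using that by (simp add: a_inv_eq_scale[symmetric] r_neg)
  have pR: "p \<otimes> R y = \<zero>" if "y \<in> carrier A" for y
    using that pc by (simp add: R_def r_distr scale_mult_right cl pp cancel)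
  have Radd: "R (y \<oplus> z) = R y \<oplus> R z" if "y \<in> carrier A" "z \<in> carrier A" for y z
    using that pc by (simp add: R_def r_distr scale_add cl a_ac)
  have Rscale: "R (a \<odot> y) = a \<odot> R y" if "y \<in> carrier A" for a y
    using that pc by (simp add: R_def scale_mult_right scale_add scale_scale cl)
  have RV: "R x = x" if "x \<in> V" for x
    using that pc by (simp add: R_def V_def scale_zero)
  have one: "cnorm A (x \<oplus> (-2) \<odot> R (q i \<otimes> x)) \<le> cnorm A x" if i: "i \<in> I" and x: "x \<in> V" for i x
  proof -
    have xc: "x \<in> carrier A" using x by (simp add: V_def)
    have "R (x \<oplus> (-2) \<odot> (q i \<otimes> x)) = x \<oplus> (-2) \<odot> R (q i \<otimes> x)"
      using xc qc[OF i] RV[OF x] by (simp add: Radd Rscale cl)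
    moreover have "cnorm A (R (x \<oplus> (-2) \<odot> (q i \<otimes> x))) \<le> cnorm A (x \<oplus> (-2) \<odot> (q i \<otimes> x))"
      unfolding R_def by (rule projection_complement_norm_le[OF p]) (use xc qc[OF i] in \<open>simp add: cl\<close>)
    ultimately show ?thesis using projection_reflection_norm_le[OF q[OF i] xc] by simp
  qed
  have many: "cnorm A (of_nat (card J) \<odot> x \<oplus> (-2) \<odot> R (finsum A q J \<otimes> x)) \<le> card J * cnorm A x"
    if J: "J \<subseteq> I" and x: "x \<in> V" for J x
  proof -
    have xc: "x \<in> carrier A" using x by (simp add: V_def)
    have "finite J" using J I finite_subset by blast
    then show ?thesis using J
    proof (induction J rule: finite_induct)
      case empty
      have "R \<zero> = \<zero>" using pc by (simp add: R_def mult_zero scale_zero)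
      then show ?case using xc by (simp add: scale_0_zero zero_mult scale_zero)
    next
      case (insert i J)
      have i: "i \<in> I" and J: "J \<subseteq> I" using insert by auto
      let ?Q = "finsum A q J"
      have Q: "?Q \<in> carrier A" using J qc by (intro finsum_closed) auto
      have "finsum A q (insert i J) = q i \<oplus> ?Q" using insert J qc by (intro finsum_insert) auto
      then have "of_nat (card (insert i J)) \<odot> x \<oplus> (-2) \<odot> R (finsum A q (insert i J) \<otimes> x)
        = (x \<oplus> (-2) \<odot> R (q i \<otimes> x)) \<oplus> (of_nat (card J) \<odot> x \<oplus> (-2) \<odot> R (?Q \<otimes> x))"
        using xc qc[OF i] Q insert(1,2)
        by (simp add: l_distr Radd scale_add add_scale scale_one Rc cl a_ac)
      moreover have "cnorm A \<dots> \<le> cnorm A (x \<oplus> (-2) \<odot> R (q i \<otimes> x))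
          + cnorm A (of_nat (card J) \<odot> x \<oplus> (-2) \<odot> R (?Q \<otimes> x))"
        using xc qc[OF i] Q by (intro norm_triangle) (simp_all add: Rc cl)
      ultimately show ?case
        using one[OF i x] insert(3)[OF J] insert(1,2) by (simp add: algebra_simps)
    qed
  qed
  define J where "J = I - {j}"
  have J: "J \<subseteq> I" "finite J" "j \<notin> J" "I = insert j J" using I j by (auto simp: J_def)
  let ?Q = "finsum A q J"
  have Q: "?Q \<in> carrier A" using J qc by (intro finsum_closed) auto
  have split: "p = q j \<oplus> ?Q"
    unfolding sum J(4) using J qc by (intro finsum_insert) auto
  note qj = qc[OF j]
  show ?thesis
  proof (cases "card J = 0")
    case True
    then have "J = {}" using J(2) by simp
    then have "p = q j" using split qj by simp
    then show ?thesis using qj by simp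
  next
    case False
    define m where "m = real (card J)"
    have m: "m \<ge> 1" using False by (simp add: m_def)
    let ?b = "R (q j)"
    define c where "c = complex_of_real (2 / m) \<odot> (?b \<oplus> (-1) \<odot> (?b \<otimes> p))"
    have bc: "?b \<in> carrier A" using qj by (simp add: Rc)
    have cc: "c \<in> carrier A" using bc pc by (simp add: c_def cl)
    have cs: "c\<^sup>\<star> = c"
      using pc qj by (simp add: c_def R_def adj_scale adj_add adj_mult l_distr r_distr scale_add
          scale_mult_left scale_mult_right scale_scale cl m_assoc a_ac)
    have cx: "c \<otimes> x = complex_of_real (2 / m) \<odot> R (q j \<otimes> x)" if x: "x \<in> V" for x
    proof -
      have xc: "x \<in> carrier A" "p \<otimes> x = \<zero>" using x by (simp_all add: V_def)
      have "?b \<otimes> x = R (q j \<otimes> x)"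
        using xc pc qj by (simp add: R_def l_distr scale_mult_left cl m_assoc)
      then show ?thesis
        using xc pc bc qj by (simp add: c_def l_distr scale_mult_left cl m_assoc mult_zero scale_zero Rc)
    qed
    have VV: "x \<oplus> z \<odot> (c \<otimes> x) \<in> V" if x: "x \<in> V" for x z
    proof -
      have xc: "x \<in> carrier A" "p \<otimes> x = \<zero>" using x by (simp_all add: V_def)
      then show ?thesis
        using pc qj by (simp add: V_def cx[OF x] cl Rc r_distr scale_mult_right pR scale_zero)
    qed
    have plus: "cnorm A (x \<oplus> 1 \<odot> (c \<otimes> x)) \<le> cnorm A x" if x: "x \<in> V" for x
    proof -
      have xc: "x \<in> carrier A" "p \<otimes> x = \<zero>" using x by (simp_all add: V_def)
      have "q j \<otimes> x \<oplus> ?Q \<otimes> x = \<zero>" using split xc qj Q l_distr[of "q j" ?Q x] by simp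
      then have "?Q \<otimes> x = (-1) \<odot> (q j \<otimes> x)"
        using xc qj Q by (metis a_inv_eq_scale m_closed minus_equality a_comm)
      then have "of_nat (card J) \<odot> x \<oplus> (-2) \<odot> R (?Q \<otimes> x) = complex_of_real m \<odot> (x \<oplus> 1 \<odot> (c \<otimes> x))"
        using xc qj m by (simp add: cx[OF x] Rscale scale_scale scale_add cl Rc scale_one m_def)
      then have "m * cnorm A (x \<oplus> 1 \<odot> (c \<otimes> x)) \<le> m * cnorm A x"
        using many[OF J(1) x] xc cc m by (simp add: norm_scale cl m_def[symmetric])
      then show ?thesis using m by simp
    qed
    have minus: "cnorm A (x \<oplus> (-1) \<odot> (c \<otimes> x)) \<le> cnorm A x" if x: "x \<in> V" for x
    proof -
      have xc: "x \<in> carrier A" "p \<otimes> x = \<zero>" using x by (simp_all add: V_def)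
      have "cnorm A (x \<oplus> (complex_of_real (1/m) * (-2) + complex_of_real (1 - 1/m) * 0) \<odot> R (q j \<otimes> x)) \<le> cnorm A x"
        by (rule norm_convex_perturbation_le)
          (use xc qj m one[OF j x] in \<open>auto simp: cl Rc scale_0_zero\<close>)
      then show ?thesis using xc qj by (simp add: cx[OF x] scale_scale Rc cl)
    qed
    have bV: "?b \<in> V" using bc pR qj by (simp add: V_def)
    have "c \<otimes> ?b = \<zero>"
      by (rule self_adjoint_perturbation_zero[OF _ VV cc cs plus minus bV]) (auto simp: V_def)
    then have "complex_of_real (m/2) \<odot> (complex_of_real (2 / m) \<odot> R (q j \<otimes> ?b)) = \<zero>"
      using cx[OF bV] by (simp add: scale_zero)
    then have RqR: "R (q j \<otimes> ?b) = \<zero>"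
      using m qj bc by (simp add: scale_scale Rc cl scale_one)
    have bsa: "?b\<^sup>\<star> = q j \<oplus> (-1) \<odot> (q j \<otimes> p)"
      using pc qj by (simp add: R_def adj_add adj_scale adj_mult cl)
    \<comment> \<open>\<open>d = b\<^sup>*b\<close> is self-adjoint with square zero, so the C*-identity kills \<open>d\<close> and then \<open>b\<close>\<close>
    have e: "?b\<^sup>\<star> \<otimes> ?b = q j \<otimes> ?b"
      using pc qj bc pR[OF qj(1)] by (simp add: bsa l_distr scale_mult_left m_assoc cl mult_zero scale_zero)
    define d where "d = q j \<otimes> ?b"
    have dc: "d \<in> carrier A" using qj bc by (simp add: d_def cl)
    have dsa: "d\<^sup>\<star> = d" unfolding d_def e[symmetric] using bc by (simp add: adj_mult adj_adj cl)
    have qd: "q j \<otimes> d = d" using m_assoc[OF qj(1) qj(1) bc] qj by (simp add: d_def)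
    have "d \<otimes> d = q j \<otimes> R d"
      using qj pc dc m_assoc[of "q j" "?b" d] qd
      by (simp add: d_def[symmetric]) (simp add: d_def R_def l_distr scale_mult_left m_assoc cl)
    then have "d \<otimes> d = \<zero>" using RqR qj by (simp add: d_def mult_zero)
    then have "d = \<zero>" using cstar_identity[OF dc] norm_zero_iff[OF dc] dsa by simp
    then have "?b = \<zero>" using cstar_identity[OF bc] norm_zero_iff[OF bc] e by (simp add: d_def)
    then show ?thesis
      using qj pc unfolding R_def a_inv_eq_scale[OF m_closed[OF pc(1) qj(1)], symmetric]
      by (metis a_inv_closed m_closed minus_equality minus_minus)
  qed
qed

text \<open>With \<open>e = x\<^sup>*x\<close>, the element \<open>y = x - xe\<close> satisfies \<open>x\<^sup>*y = e - e\<^sup>2 = 0\<close>, hence \<open>y\<^sup>*y = 0\<close>.\<close>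

lemma partial_isometry_mult_source:
  assumes x: "x \<in> carrier A" and e: "projection A (x\<^sup>\<star> \<otimes> x)"
  shows "x \<otimes> (x\<^sup>\<star> \<otimes> x) = x"
proof -
  note cl = m_closed scale_closed adj_closed
  let ?e = "x\<^sup>\<star> \<otimes> x"
  have ec: "?e \<in> carrier A" "?e\<^sup>\<star> = ?e" "?e \<otimes> ?e = ?e" using e by (auto simp: projection_def)
  define y where "y = x \<oplus> (-1) \<odot> (x \<otimes> ?e)"
  have yc: "y \<in> carrier A" using x by (simp add: y_def cl)
  have "x\<^sup>\<star> \<otimes> y = ?e \<oplus> (-1) \<odot> (?e \<otimes> ?e)"
    using x by (simp add: y_def r_distr scale_mult_right cl m_assoc)
  also have "\<dots> = \<zero>" unfolding ec(3) using ec(1) by (simp add: a_inv_eq_scale[symmetric] r_neg)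
  finally have xy: "x\<^sup>\<star> \<otimes> y = \<zero>" .
  have "y\<^sup>\<star> = x\<^sup>\<star> \<oplus> (-1) \<odot> (?e \<otimes> x\<^sup>\<star>)"
    using x ec(2) by (simp add: y_def adj_add adj_scale adj_mult[of x ?e] cl)
  then have "y\<^sup>\<star> \<otimes> y = x\<^sup>\<star> \<otimes> y \<oplus> (-1) \<odot> (?e \<otimes> (x\<^sup>\<star> \<otimes> y))"
    using x yc ec(1) by (simp add: l_distr scale_mult_left m_assoc[of ?e "x\<^sup>\<star>" y] cl)
  then have "y\<^sup>\<star> \<otimes> y = \<zero>" using ec(1) by (simp add: xy mult_zero scale_zero)
  then have "y = \<zero>" using cstar_identity[OF yc] norm_zero_iff[OF yc] by simp
  then show ?thesis
    unfolding y_def using x a_inv_eq_scale[of "x \<otimes> ?e"] by (metis cl(1,3) r_neg a_inv_closed add.right_cancel)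
qed

end

section \<open>Paths in a higher-rank graph\<close>

context k_graph
begin

lemma vertexD:
  assumes "v \<in> vertices \<Lambda>"
  shows "v \<in> mor \<Lambda>" "rng \<Lambda> v = v" "src \<Lambda> v = v" "deg \<Lambda> v = 0"
  using assms vertices_eq_identities by (auto simp: vertices_def of_deg_def)

lemma rng_in_vertices: "\<mu> \<in> mor \<Lambda> \<Longrightarrow> rng \<Lambda> \<mu> \<in> vertices \<Lambda>"
  by (simp add: vertices_def of_deg_def rng_closed deg_rng)

lemma of_degD: "\<mu> \<in> of_deg \<Lambda> n \<Longrightarrow> \<mu> \<in> mor \<Lambda>" "\<mu> \<in> of_deg \<Lambda> n \<Longrightarrow> deg \<Lambda> \<mu> = n"
  by (simp_all add: of_deg_def)

lemma edgesE:
  assumes "\<mu> \<in> edges k \<Lambda>"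
  obtains i where "i \<in> {1..k}" "\<mu> \<in> of_deg \<Lambda> (unit_deg i)"
  using assms by (auto simp: edges_def)

lemma unit_deg_multi_nat: "i \<in> {1..k} \<Longrightarrow> unit_deg i \<in> multi_nat k"
  by (auto simp: unit_deg_def multi_nat_def)

lemma factorisation_unique:
  assumes "\<mu> \<in> mor \<Lambda>" "\<nu> \<in> mor \<Lambda>" "src \<Lambda> \<mu> = rng \<Lambda> \<nu>"
    and "\<mu>' \<in> mor \<Lambda>" "\<nu>' \<in> mor \<Lambda>" "src \<Lambda> \<mu>' = rng \<Lambda> \<nu>'"
    and eq: "cmp \<Lambda> \<mu> \<nu> = cmp \<Lambda> \<mu>' \<nu>'" and d: "deg \<Lambda> \<mu> = deg \<Lambda> \<mu>' \<or> deg \<Lambda> \<nu> = deg \<Lambda> \<nu>'"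
  shows "\<mu> = \<mu>'" "\<nu> = \<nu>'"
proof -
  have sum: "deg \<Lambda> \<mu> + deg \<Lambda> \<nu> = deg \<Lambda> \<mu>' + deg \<Lambda> \<nu>'"
    using deg_cmp assms by metis
  then have d': "deg \<Lambda> \<mu> = deg \<Lambda> \<mu>'" "deg \<Lambda> \<nu> = deg \<Lambda> \<nu>'"
    using d by (metis add_left_cancel add_right_cancel)+
  have "\<exists>!(a, b). a \<in> mor \<Lambda> \<and> b \<in> mor \<Lambda> \<and> deg \<Lambda> a = deg \<Lambda> \<mu> \<and> deg \<Lambda> b = deg \<Lambda> \<nu> \<and>
      src \<Lambda> a = rng \<Lambda> b \<and> cmp \<Lambda> \<mu> \<nu> = cmp \<Lambda> a b"
    by (rule factorisation) (use assms(1-3) in \<open>auto simp: cmp_closed deg_closed deg_cmp\<close>)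
  then have "(\<mu>, \<nu>) = (\<mu>', \<nu>')"
    by (rule ex1E) (use assms d' in auto)
  then show "\<mu> = \<mu>'" "\<nu> = \<nu>'" by auto
qed

lemma factor_at_direction:
  assumes "\<xi> \<in> mor \<Lambda>" "i \<in> {1..k}" "deg \<Lambda> \<xi> i \<noteq> 0"
  obtains \<mu> \<nu> where "\<mu> \<in> of_deg \<Lambda> (unit_deg i)" "\<nu> \<in> mor \<Lambda>" "src \<Lambda> \<mu> = rng \<Lambda> \<nu>" "\<xi> = cmp \<Lambda> \<mu> \<nu>"
proof -
  define n where "n = (\<lambda>j. deg \<Lambda> \<xi> j - unit_deg i j)"
  have "deg \<Lambda> \<xi> = unit_deg i + n"
    using assms(3) by (auto simp: n_def unit_deg_def plus_fun_def fun_eq_iff)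
  moreover have "n \<in> multi_nat k"
    using deg_closed[OF assms(1)] by (auto simp: n_def multi_nat_def)
  ultimately have "\<exists>!(\<mu>, \<nu>). \<mu> \<in> mor \<Lambda> \<and> \<nu> \<in> mor \<Lambda> \<and> deg \<Lambda> \<mu> = unit_deg i \<and> deg \<Lambda> \<nu> = n \<and>
      src \<Lambda> \<mu> = rng \<Lambda> \<nu> \<and> \<xi> = cmp \<Lambda> \<mu> \<nu>"
    using factorisation[OF assms(1) unit_deg_multi_nat[OF assms(2)]] by blast
  then show ?thesis using that by (auto simp: of_deg_def)
qed

lemma deg_size_add: "deg_size k (m + n) = deg_size k m + deg_size k n"
  by (simp add: deg_size_def plus_fun_def sum.distrib)

lemma deg_size_unit: "i \<in> {1..k} \<Longrightarrow> deg_size k (unit_deg i) = 1"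
  by (simp add: deg_size_def unit_deg_def)

lemma deg_size_cmp_edge:
  assumes "\<mu> \<in> edges k \<Lambda>" "\<nu> \<in> mor \<Lambda>" "src \<Lambda> \<mu> = rng \<Lambda> \<nu>"
  shows "deg_size k (deg \<Lambda> (cmp \<Lambda> \<mu> \<nu>)) = Suc (deg_size k (deg \<Lambda> \<nu>))"
proof -
  obtain i where "i \<in> {1..k}" "\<mu> \<in> of_deg \<Lambda> (unit_deg i)" using assms(1) by (rule edgesE)
  then show ?thesis
    using assms edges_mor by (simp add: deg_cmp of_degD deg_size_add deg_size_unit)
qed

text \<open>In any direction in which the degree is nonzero a first edge can be split off, which shortens the
  path.\<close>

lemma path_induct [consumes 1, case_names vertex edge]:
  assumes "\<xi> \<in> mor \<Lambda>"
    and vertex: "\<And>v. v \<in> vertices \<Lambda> \<Longrightarrow> P v"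
    and edge: "\<And>\<mu> \<nu>. \<lbrakk>\<mu> \<in> edges k \<Lambda>; \<nu> \<in> mor \<Lambda>; src \<Lambda> \<mu> = rng \<Lambda> \<nu>; P \<nu>\<rbrakk> \<Longrightarrow> P (cmp \<Lambda> \<mu> \<nu>)"
  shows "P \<xi>"
  using assms(1)
proof (induction "deg_size k (deg \<Lambda> \<xi>)" arbitrary: \<xi>)
  case 0
  then have "deg \<Lambda> \<xi> i = 0" for i
    using deg_closed[OF 0(2)] by (cases "i \<in> {1..k}") (auto simp: deg_size_def multi_nat_def)
  then have "\<xi> \<in> vertices \<Lambda>" using 0 by (auto simp: vertices_def of_deg_def zero_fun_def)
  then show ?case by (rule vertex)
next
  case (Suc n)
  then have "\<exists>i\<in>{1..k}. deg \<Lambda> \<xi> i \<noteq> 0"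
    by (metis deg_size_def sum.neutral nat.distinct(1))
  then obtain i where i: "i \<in> {1..k}" "deg \<Lambda> \<xi> i \<noteq> 0" by blast
  obtain \<mu> \<nu> where f: "\<mu> \<in> of_deg \<Lambda> (unit_deg i)" "\<nu> \<in> mor \<Lambda>" "src \<Lambda> \<mu> = rng \<Lambda> \<nu>" "\<xi> = cmp \<Lambda> \<mu> \<nu>"
    using factor_at_direction[OF Suc(3) i] by blast
  have e: "\<mu> \<in> edges k \<Lambda>" using f(1) i(1) by (rule of_deg_edges)
  have "P \<nu>" using Suc f deg_size_cmp_edge[OF e f(2,3)] by simp
  then show ?case unfolding f(4) by (rule edge[OF e f(2,3)])
qed

text \<open>Two ways of splitting off a first edge, in different directions, differ by one commuting square:
  both first edges extend to one path of degree \<open>e\<^sub>i + e\<^sub>j\<close>, and the remainder \<open>\<xi>\<close> is common to both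
  factorisations.\<close>

lemma edge_square:
  assumes \<mu>: "\<mu> \<in> of_deg \<Lambda> (unit_deg i)" and \<nu>: "\<nu> \<in> mor \<Lambda>" and c: "src \<Lambda> \<mu> = rng \<Lambda> \<nu>"
    and \<mu>': "\<mu>' \<in> of_deg \<Lambda> (unit_deg j)" and \<nu>': "\<nu>' \<in> mor \<Lambda>" and c': "src \<Lambda> \<mu>' = rng \<Lambda> \<nu>'"
    and ij: "i \<in> {1..k}" "j \<in> {1..k}" "i \<noteq> j" and eq: "cmp \<Lambda> \<mu> \<nu> = cmp \<Lambda> \<mu>' \<nu>'"
  obtains \<beta> \<gamma> \<xi> where "\<beta> \<in> of_deg \<Lambda> (unit_deg j)" "\<gamma> \<in> of_deg \<Lambda> (unit_deg i)" "\<xi> \<in> mor \<Lambda>"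
    "src \<Lambda> \<mu> = rng \<Lambda> \<beta>" "src \<Lambda> \<mu>' = rng \<Lambda> \<gamma>" "src \<Lambda> \<beta> = rng \<Lambda> \<xi>" "src \<Lambda> \<gamma> = rng \<Lambda> \<xi>"
    "cmp \<Lambda> \<mu> \<beta> = cmp \<Lambda> \<mu>' \<gamma>" "\<nu> = cmp \<Lambda> \<beta> \<xi>" "\<nu>' = cmp \<Lambda> \<gamma> \<xi>"
proof -
  note m = of_degD(1)[OF \<mu>] of_degD(1)[OF \<mu>']
  have "unit_deg i + deg \<Lambda> \<nu> = unit_deg j + deg \<Lambda> \<nu>'"
    using deg_cmp[OF m(1) \<nu> c] deg_cmp[OF m(2) \<nu>' c'] eq of_degD(2)[OF \<mu>] of_degD(2)[OF \<mu>'] by simp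
  then have "unit_deg i j + deg \<Lambda> \<nu> j = unit_deg j j + deg \<Lambda> \<nu>' j"
    by (metis plus_fun_def)
  then have "deg \<Lambda> \<nu> j \<noteq> 0" using ij(3) by (simp add: unit_deg_def)
  then obtain \<beta> \<xi> where b: "\<beta> \<in> of_deg \<Lambda> (unit_deg j)" "\<xi> \<in> mor \<Lambda>" "src \<Lambda> \<beta> = rng \<Lambda> \<xi>" "\<nu> = cmp \<Lambda> \<beta> \<xi>"
    using factor_at_direction[OF \<nu> ij(2)] by blast
  note bm = of_degD(1)[OF b(1)]
  have mb: "src \<Lambda> \<mu> = rng \<Lambda> \<beta>" using c b bm by (simp add: rng_cmp)
  have "deg \<Lambda> (cmp \<Lambda> \<mu> \<beta>) j \<noteq> 0"
    using deg_cmp[OF m(1) bm mb] of_degD(2)[OF b(1)] by (simp add: plus_fun_def unit_deg_def)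
  then obtain \<mu>'' \<gamma> where g: "\<mu>'' \<in> of_deg \<Lambda> (unit_deg j)" "\<gamma> \<in> mor \<Lambda>" "src \<Lambda> \<mu>'' = rng \<Lambda> \<gamma>"
      "cmp \<Lambda> \<mu> \<beta> = cmp \<Lambda> \<mu>'' \<gamma>"
    using factor_at_direction[OF cmp_closed[OF m(1) bm mb] ij(2)] by blast
  note gm = of_degD(1)[OF g(1)]
  have "unit_deg i + unit_deg j = unit_deg j + deg \<Lambda> \<gamma>"
    using deg_cmp[OF m(1) bm mb] deg_cmp[OF gm g(2,3)] g(4) of_degD(2)[OF \<mu>] of_degD(2)[OF b(1)]
      of_degD(2)[OF g(1)] by simp
  then have dg: "deg \<Lambda> \<gamma> = unit_deg i" by (metis add.commute add_left_cancel)
  have gx: "src \<Lambda> \<gamma> = rng \<Lambda> \<xi>"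
    using src_cmp[OF m(1) bm mb] src_cmp[OF gm g(2,3)] g(4) b(3) by simp
  have "cmp \<Lambda> \<mu>' \<nu>' = cmp \<Lambda> (cmp \<Lambda> \<mu> \<beta>) \<xi>"
    using cmp_assoc[OF m(1) bm b(2) mb b(3)] b(4) eq by simp
  also have "\<dots> = cmp \<Lambda> \<mu>'' (cmp \<Lambda> \<gamma> \<xi>)"
    using cmp_assoc[OF gm g(2) b(2) g(3) gx] g(4) by simp
  finally have "cmp \<Lambda> \<mu>' \<nu>' = cmp \<Lambda> \<mu>'' (cmp \<Lambda> \<gamma> \<xi>)" .
  then have "\<mu>' = \<mu>''" "\<nu>' = cmp \<Lambda> \<gamma> \<xi>"
    using factorisation_unique[OF m(2) \<nu>' c' gm cmp_closed[OF g(2) b(2) gx]] g(2,3) b(2) gx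
      of_degD(2)[OF \<mu>'] of_degD(2)[OF g(1)] by (simp_all add: rng_cmp)
  then show ?thesis using that[of \<beta> \<gamma> \<xi>] b mb g dg gx by (auto simp: of_deg_def)
qed

text \<open>Local convexity, propagated from an edge to every path that does not itself move in
  direction \<open>i\<close>.\<close>

lemma edge_direction_persists:
  assumes lc: "locally_convex k \<Lambda>" and "\<xi> \<in> mor \<Lambda>" and i: "i \<in> {1..k}"
    and "deg \<Lambda> \<xi> i = 0" "of_deg_at \<Lambda> (rng \<Lambda> \<xi>) (unit_deg i) \<noteq> {}"
  shows "of_deg_at \<Lambda> (src \<Lambda> \<xi>) (unit_deg i) \<noteq> {}"
  using assms(2,4,5)
proof (induction rule: path_induct)
  case (vertex v)
  then show ?case by (simp add: vertexD)
next
  case (edge \<mu> \<nu>)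
  obtain j where j: "j \<in> {1..k}" "\<mu> \<in> of_deg \<Lambda> (unit_deg j)" using edge(1) by (rule edgesE)
  have \<mu>: "\<mu> \<in> mor \<Lambda>" using edge(1) by (rule edges_mor)
  have "unit_deg j i = 0" "deg \<Lambda> \<nu> i = 0"
    using edge(5) deg_cmp[OF \<mu> edge(2,3)] of_degD(2)[OF j(2)] by (simp_all add: plus_fun_def)
  then have "j \<noteq> i" by (auto simp: unit_deg_def)
  moreover have "of_deg_at \<Lambda> (rng \<Lambda> \<mu>) (unit_deg i) \<noteq> {}"
    using edge(6) \<mu> edge(2,3) by (simp add: rng_cmp)
  ultimately have "of_deg_at \<Lambda> (src \<Lambda> \<mu>) (unit_deg i) \<noteq> {}"
    using lc j i unfolding locally_convex_def by blast
  then show ?case using edge \<mu> \<open>deg \<Lambda> \<nu> i = 0\<close> by (simp add: src_cmp)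
qed

lemma paths_le_zero:
  assumes "v \<in> vertices \<Lambda>"
  shows "paths_le k \<Lambda> v 0 = {v}"
proof -
  have "\<mu> = v" if "\<mu> \<in> mor \<Lambda>" "rng \<Lambda> \<mu> = v" "deg \<Lambda> \<mu> \<le> 0" for \<mu>
  proof -
    have "\<mu> \<in> vertices \<Lambda>"
      using that by (auto simp: vertices_def of_deg_def le_fun_def zero_fun_def)
    then show ?thesis using that vertexD by simp
  qed
  moreover have "\<not> unit_deg i \<le> 0" for i
    by (auto simp: le_fun_def unit_deg_def zero_fun_def intro!: exI[of _ i])
  ultimately show ?thesis using assms by (auto simp: paths_le_def vertexD)
qed

text \<open>A path in \<open>v\<Lambda>\<^sup>\<le>\<^sup>n\<close>, \<open>n = e\<^sub>i + m\<close>, with no step in direction \<open>i\<close> would still have room for one, although an edge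
  in that direction is available at its source by local convexity. So every path in the set has a first
  edge in direction \<open>i\<close>.\<close>

lemma paths_le_first_edge:
  assumes lc: "locally_convex k \<Lambda>" and i: "i \<in> {1..k}"
    and ne: "of_deg_at \<Lambda> v (unit_deg i) \<noteq> {}"
  shows "paths_le k \<Lambda> v (unit_deg i + m)
    = (\<Union>\<mu>\<in>of_deg_at \<Lambda> v (unit_deg i). cmp \<Lambda> \<mu> ` paths_le k \<Lambda> (src \<Lambda> \<mu>) m)"
proof (intro equalityI subsetI)
  fix \<xi> assume "\<xi> \<in> paths_le k \<Lambda> v (unit_deg i + m)"
  then have \<xi>: "\<xi> \<in> mor \<Lambda>" "rng \<Lambda> \<xi> = v" "deg \<Lambda> \<xi> \<le> unit_deg i + m"
    and mx: "\<And>j. \<lbrakk>j \<in> {1..k}; deg \<Lambda> \<xi> + unit_deg j \<le> unit_deg i + m\<rbrakk>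
      \<Longrightarrow> of_deg_at \<Lambda> (src \<Lambda> \<xi>) (unit_deg j) = {}"
    by (auto simp: paths_le_def)
  have "deg \<Lambda> \<xi> i \<noteq> 0"
  proof
    assume 0: "deg \<Lambda> \<xi> i = 0"
    have "(deg \<Lambda> \<xi> + unit_deg i) j \<le> (unit_deg i + m) j" for j
      using le_funD[OF \<xi>(3), of j] 0 by (cases "j = i") (auto simp: plus_fun_def unit_deg_def)
    then have "of_deg_at \<Lambda> (src \<Lambda> \<xi>) (unit_deg i) = {}" using mx[OF i] by (simp add: le_fun_def)
    then show False using edge_direction_persists[OF lc \<xi>(1) i 0] ne \<xi>(2) by simp
  qed
  then obtain \<mu> \<nu> where f: "\<mu> \<in> of_deg \<Lambda> (unit_deg i)" "\<nu> \<in> mor \<Lambda>" "src \<Lambda> \<mu> = rng \<Lambda> \<nu>" "\<xi> = cmp \<Lambda> \<mu> \<nu>"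
    using factor_at_direction[OF \<xi>(1) i] by blast
  note \<mu> = of_degD[OF f(1)]
  have d: "deg \<Lambda> \<xi> = unit_deg i + deg \<Lambda> \<nu>" using f \<mu> by (simp add: deg_cmp)
  have "\<nu> \<in> paths_le k \<Lambda> (src \<Lambda> \<mu>) m"
    using f \<mu> \<xi>(3) mx unfolding d by (auto simp: paths_le_def src_cmp add.assoc)
  moreover have "\<mu> \<in> of_deg_at \<Lambda> v (unit_deg i)" using f \<mu> \<xi>(2) by (simp add: of_deg_at_def rng_cmp)
  ultimately show "\<xi> \<in> (\<Union>\<mu>\<in>of_deg_at \<Lambda> v (unit_deg i). cmp \<Lambda> \<mu> ` paths_le k \<Lambda> (src \<Lambda> \<mu>) m)"
    using f(4) by blast
next
  fix \<xi> assume "\<xi> \<in> (\<Union>\<mu>\<in>of_deg_at \<Lambda> v (unit_deg i). cmp \<Lambda> \<mu> ` paths_le k \<Lambda> (src \<Lambda> \<mu>) m)"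
  then obtain \<mu> \<nu> where f: "\<mu> \<in> of_deg \<Lambda> (unit_deg i)" "rng \<Lambda> \<mu> = v" "\<nu> \<in> paths_le k \<Lambda> (src \<Lambda> \<mu>) m"
      "\<xi> = cmp \<Lambda> \<mu> \<nu>" by (auto simp: of_deg_at_def)
  then show "\<xi> \<in> paths_le k \<Lambda> v (unit_deg i + m)"
    using of_degD[OF f(1)] by (auto simp: paths_le_def cmp_closed rng_cmp src_cmp deg_cmp add.assoc)
qed

text \<open>No path with range \<open>v\<close>, nor any extension of one, can move in direction \<open>i\<close>, so raising the bound in
  that direction changes neither which degrees are admissible nor which paths are maximal.\<close>

lemma paths_le_no_edge:
  assumes i: "i \<in> {1..k}" and none: "of_deg_at \<Lambda> v (unit_deg i) = {}"
  shows "paths_le k \<Lambda> v (unit_deg i + m) = paths_le k \<Lambda> v m"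
proof -
  have d0: "deg \<Lambda> \<xi> i = 0" if \<xi>: "\<xi> \<in> mor \<Lambda>" "rng \<Lambda> \<xi> = v" for \<xi>
  proof (rule ccontr)
    assume "deg \<Lambda> \<xi> i \<noteq> 0"
    then obtain \<mu> \<nu> where f: "\<mu> \<in> of_deg \<Lambda> (unit_deg i)" "\<nu> \<in> mor \<Lambda>" "src \<Lambda> \<mu> = rng \<Lambda> \<nu>" "\<xi> = cmp \<Lambda> \<mu> \<nu>"
      using factor_at_direction[OF \<xi>(1) i] by blast
    then have "\<mu> \<in> of_deg_at \<Lambda> v (unit_deg i)" using \<xi>(2) of_degD[OF f(1)] by (simp add: of_deg_at_def rng_cmp)
    then show False using none by simp
  qed
  have drop: "n \<le> unit_deg i + m \<longleftrightarrow> n \<le> m" if "n i = 0" for n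
  proof -
    have "n j \<le> unit_deg i j + m j \<longleftrightarrow> n j \<le> m j" for j
      using that by (cases "j = i") (auto simp: unit_deg_def)
    then show ?thesis by (simp add: le_fun_def plus_fun_def)
  qed
  have "of_deg_at \<Lambda> (src \<Lambda> \<xi>) (unit_deg i) = {}" if \<xi>: "\<xi> \<in> mor \<Lambda>" "rng \<Lambda> \<xi> = v" for \<xi>
  proof (rule ccontr)
    assume "of_deg_at \<Lambda> (src \<Lambda> \<xi>) (unit_deg i) \<noteq> {}"
    then obtain \<mu> where \<mu>: "\<mu> \<in> of_deg \<Lambda> (unit_deg i)" "src \<Lambda> \<xi> = rng \<Lambda> \<mu>" by (auto simp: of_deg_at_def)
    then have "deg \<Lambda> (cmp \<Lambda> \<xi> \<mu>) i = 0"
      using d0[of "cmp \<Lambda> \<xi> \<mu>"] \<xi> of_degD[OF \<mu>(1)] by (simp add: cmp_closed rng_cmp)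
    then show False using \<xi> \<mu> of_degD[OF \<mu>(1)] by (simp add: deg_cmp plus_fun_def unit_deg_def)
  qed
  moreover have "deg \<Lambda> \<xi> + unit_deg j \<le> unit_deg i + m \<longleftrightarrow> deg \<Lambda> \<xi> + unit_deg j \<le> m"
    if "\<xi> \<in> mor \<Lambda>" "rng \<Lambda> \<xi> = v" "j \<noteq> i" for \<xi> j
    by (rule drop) (use d0 that in \<open>simp add: plus_fun_def unit_deg_def\<close>)
  ultimately show ?thesis
    unfolding paths_le_def using drop d0 by (intro Collect_cong) (metis (no_types, lifting))
qed

end
section \<open>From edge operators to path operators\<close>

locale untwisted_family = k_graph k \<Lambda> + cstar_algebra A
  for k :: nat and \<Lambda> :: "'e kgraph" and A :: "'a cstar" (structure) +
  fixes p s :: "'e \<Rightarrow> 'a"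
  assumes family: "CK_family k \<Lambda> (\<lambda>_. 1) A p s"
    and row_finite: "row_finite k \<Lambda>"
    and locally_convex: "locally_convex k \<Lambda>"
begin

lemma p_projection: "v \<in> vertices \<Lambda> \<Longrightarrow> projection A (p v)"
  using family by (simp add: CK_family_def)

lemma p_closed: "v \<in> vertices \<Lambda> \<Longrightarrow> p v \<in> carrier A"
  and p_adj: "v \<in> vertices \<Lambda> \<Longrightarrow> (p v)\<^sup>\<star> = p v"
  and p_idem: "v \<in> vertices \<Lambda> \<Longrightarrow> p v \<otimes> p v = p v"
  using p_projection by (simp_all add: projection_def)

lemma s_closed: "\<mu> \<in> edges k \<Lambda> \<Longrightarrow> s \<mu> \<in> carrier A"
  using family by (simp add: CK_family_def)

lemma s_source: "\<mu> \<in> edges k \<Lambda> \<Longrightarrow> (s \<mu>)\<^sup>\<star> \<otimes> s \<mu> = p (src \<Lambda> \<mu>)"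
  using family by (simp add: CK_family_def)

lemma p_sum:
  "\<lbrakk>v \<in> vertices \<Lambda>; i \<in> {1..k}; of_deg_at \<Lambda> v (unit_deg i) \<noteq> {}\<rbrakk>
    \<Longrightarrow> p v = (\<Oplus>\<mu>\<in>of_deg_at \<Lambda> v (unit_deg i). s \<mu> \<otimes> (s \<mu>)\<^sup>\<star>)"
  using family by (simp add: CK_family_def)

lemma s_commute_less:
  assumes "i \<in> {1..k}" "j \<in> {1..k}" "i < j"
    and "\<mu> \<in> of_deg \<Lambda> (unit_deg i)" "\<gamma> \<in> of_deg \<Lambda> (unit_deg i)"
    and "\<beta> \<in> of_deg \<Lambda> (unit_deg j)" "\<nu> \<in> of_deg \<Lambda> (unit_deg j)"
    and "src \<Lambda> \<mu> = rng \<Lambda> \<beta>" "src \<Lambda> \<nu> = rng \<Lambda> \<gamma>" "cmp \<Lambda> \<mu> \<beta> = cmp \<Lambda> \<nu> \<gamma>"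
  shows "s \<nu> \<otimes> s \<gamma> = s \<mu> \<otimes> s \<beta>"
proof -
  have "s \<nu> \<otimes> s \<gamma> = 1 \<odot> (s \<mu> \<otimes> s \<beta>)"
    using family assms unfolding CK_family_def by blast
  then show ?thesis
    using s_closed of_deg_edges assms by (simp add: scale_one m_closed)
qed

lemma s_commute:
  assumes "i \<in> {1..k}" "j \<in> {1..k}" "i \<noteq> j"
    and "\<mu> \<in> of_deg \<Lambda> (unit_deg i)" "\<gamma> \<in> of_deg \<Lambda> (unit_deg i)"
    and "\<beta> \<in> of_deg \<Lambda> (unit_deg j)" "\<nu> \<in> of_deg \<Lambda> (unit_deg j)"
    and "src \<Lambda> \<mu> = rng \<Lambda> \<beta>" "src \<Lambda> \<nu> = rng \<Lambda> \<gamma>" "cmp \<Lambda> \<mu> \<beta> = cmp \<Lambda> \<nu> \<gamma>"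
  shows "s \<mu> \<otimes> s \<beta> = s \<nu> \<otimes> s \<gamma>"
proof (cases "i < j")
  case True
  then show ?thesis using s_commute_less[of i j] assms by metis
next
  case False
  then have "j < i" using assms(3) by simp
  then show ?thesis using s_commute_less[of j i] assms by metis
qed

lemma s_mult_p: "\<mu> \<in> edges k \<Lambda> \<Longrightarrow> s \<mu> \<otimes> p (src \<Lambda> \<mu>) = s \<mu>"
  using partial_isometry_mult_source[of "s \<mu>"] s_closed s_source p_projection src_in_vertices edges_mor
  by simp

lemma range_projection:
  assumes "\<mu> \<in> edges k \<Lambda>"
  shows "projection A (s \<mu> \<otimes> (s \<mu>)\<^sup>\<star>)"
proof -
  note c = s_closed[OF assms] adj_closed[OF s_closed[OF assms]]
  have "s \<mu> \<otimes> ((s \<mu>)\<^sup>\<star> \<otimes> (s \<mu> \<otimes> (s \<mu>)\<^sup>\<star>)) = s \<mu> \<otimes> ((s \<mu>)\<^sup>\<star> \<otimes> s \<mu>) \<otimes> (s \<mu>)\<^sup>\<star>"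
    using c by (simp add: m_assoc m_closed)
  also have "\<dots> = s \<mu> \<otimes> (s \<mu>)\<^sup>\<star>" using assms by (simp add: s_source s_mult_p)
  finally show ?thesis
    using c by (simp add: projection_def adj_mult adj_adj m_closed m_assoc)
qed

text \<open>The range projection \<open>s\<^sub>\<mu> s\<^sub>\<mu>\<^sup>*\<close> is one of the projections that add up to \<open>p\<^bsub>r(\<mu>)\<^esub>\<close>, hence absorbed
  by it.\<close>

lemma p_mult_s:
  assumes "\<mu> \<in> edges k \<Lambda>"
  shows "p (rng \<Lambda> \<mu>) \<otimes> s \<mu> = s \<mu>"
proof -
  note c = s_closed[OF assms] adj_closed[OF s_closed[OF assms]]
  obtain i where i: "i \<in> {1..k}" "\<mu> \<in> of_deg \<Lambda> (unit_deg i)" using assms by (rule edgesE)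
  let ?v = "rng \<Lambda> \<mu>" let ?I = "of_deg_at \<Lambda> ?v (unit_deg i)"
  have v: "?v \<in> vertices \<Lambda>" using assms edges_mor rng_in_vertices by blast
  have \<mu>: "\<mu> \<in> ?I" using i by (simp add: of_deg_at_def)
  have "p ?v \<otimes> (s \<mu> \<otimes> (s \<mu>)\<^sup>\<star>) = s \<mu> \<otimes> (s \<mu>)\<^sup>\<star>"
  proof (rule projection_sum_absorbs_summand[OF _ _ p_projection[OF v] p_sum[OF v i(1)] \<mu>])
    show "finite ?I" using row_finite v unit_deg_multi_nat[OF i(1)] by (simp add: row_finite_def)
    show "projection A (s \<nu> \<otimes> (s \<nu>)\<^sup>\<star>)" if "\<nu> \<in> ?I" for \<nu>
      using that i(1) by (intro range_projection) (auto simp: of_deg_at_def intro: of_deg_edges)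
  qed (use \<mu> in blast)
  then have "p ?v \<otimes> (s \<mu> \<otimes> (s \<mu>)\<^sup>\<star>) \<otimes> s \<mu> = s \<mu> \<otimes> (s \<mu>)\<^sup>\<star> \<otimes> s \<mu>" by simp
  then show ?thesis
    using c p_closed[OF v] assms by (simp add: m_assoc m_closed s_source s_mult_p)
qed

text \<open>A relation, rather than a recursive function, avoids choosing one factorisation of a path into edges
  and keeps the uniqueness proof symmetric in the two factorisations compared. The last factor of the
  product is the projection at the source, so that vertices are covered too.\<close>

inductive path_value :: "'e \<Rightarrow> 'a \<Rightarrow> bool" where
  vertex: "v \<in> vertices \<Lambda> \<Longrightarrow> path_value v (p v)"
| edge: "\<lbrakk>\<mu> \<in> edges k \<Lambda>; \<nu> \<in> mor \<Lambda>; src \<Lambda> \<mu> = rng \<Lambda> \<nu>; path_value \<nu> x\<rbrakk>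
    \<Longrightarrow> path_value (cmp \<Lambda> \<mu> \<nu>) (s \<mu> \<otimes> x)"

lemma path_value_closed: "path_value \<xi> x \<Longrightarrow> x \<in> carrier A"
  by (induction rule: path_value.induct) (auto simp: p_closed s_closed m_closed)

lemma path_value_exists: "\<xi> \<in> mor \<Lambda> \<Longrightarrow> \<exists>x. path_value \<xi> x"
  by (induction rule: path_induct) (auto intro: path_value.intros)

text \<open>Induction on the length. If the two factorisations begin with edges in different directions, both tails
  pass through the common remainder of the connecting commuting square; the induction hypothesis
  lets each tail be evaluated along it, and the two initial segments agree because the square commutes.\<close>

lemma path_value_unique: "\<lbrakk>path_value \<xi> x; path_value \<xi> y\<rbrakk> \<Longrightarrow> x = y"
proof (induction "deg_size k (deg \<Lambda> \<xi>)" arbitrary: \<xi> x y rule: less_induct)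
  case less
  have zero: "deg_size k (deg \<Lambda> v) = 0" if "v \<in> vertices \<Lambda>" for v
    using vertexD(4)[OF that] by (simp add: deg_size_def)
  show ?case
    using less(2)
  proof cases
    case vertex
    from less(3) show ?thesis
    proof cases
      case (edge \<mu> \<nu> z)
      then show ?thesis using zero[OF vertex(2)] deg_size_cmp_edge[of \<mu> \<nu>] by simp
    qed (use vertex in simp)
  next
    case (edge \<mu> \<nu> x')
    note e = edge
    have \<xi>: "deg_size k (deg \<Lambda> \<xi>) = Suc (deg_size k (deg \<Lambda> \<nu>))"
      using e deg_size_cmp_edge by simp
    from less(3) show ?thesis
    proof cases
      case vertex
      then show ?thesis using \<xi> zero by simp
    next
      case (edge \<mu>' \<nu>' y')
      note e' = edge
      have \<xi>': "deg_size k (deg \<Lambda> \<xi>) = Suc (deg_size k (deg \<Lambda> \<nu>'))"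
        using e' deg_size_cmp_edge by simp
      obtain i where i: "i \<in> {1..k}" "\<mu> \<in> of_deg \<Lambda> (unit_deg i)" using e(3) by (rule edgesE)
      obtain j where j: "j \<in> {1..k}" "\<mu>' \<in> of_deg \<Lambda> (unit_deg j)" using e'(3) by (rule edgesE)
      note m = of_degD(1)[OF i(2)] of_degD(1)[OF j(2)]
      have eq: "cmp \<Lambda> \<mu> \<nu> = cmp \<Lambda> \<mu>' \<nu>'" using e(1) e'(1) by simp
      show ?thesis
      proof (cases "i = j")
        case True
        then have "\<mu> = \<mu>'" "\<nu> = \<nu>'"
          using factorisation_unique[OF m(1) e(4,5) m(2) e'(4,5) eq] of_degD(2)[OF i(2)] of_degD(2)[OF j(2)]
          by simp_all
        then show ?thesis using less(1)[of \<nu> x' y'] e e' \<xi> by simp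
      next
        case False
        obtain \<beta> \<gamma> \<zeta> where q: "\<beta> \<in> of_deg \<Lambda> (unit_deg j)" "\<gamma> \<in> of_deg \<Lambda> (unit_deg i)" "\<zeta> \<in> mor \<Lambda>"
          "src \<Lambda> \<mu> = rng \<Lambda> \<beta>" "src \<Lambda> \<mu>' = rng \<Lambda> \<gamma>" "src \<Lambda> \<beta> = rng \<Lambda> \<zeta>" "src \<Lambda> \<gamma> = rng \<Lambda> \<zeta>"
          "cmp \<Lambda> \<mu> \<beta> = cmp \<Lambda> \<mu>' \<gamma>" "\<nu> = cmp \<Lambda> \<beta> \<zeta>" "\<nu>' = cmp \<Lambda> \<gamma> \<zeta>"
          using edge_square[OF i(2) e(4,5) j(2) e'(4,5) i(1) j(1) False eq] by blast
        have be: "\<beta> \<in> edges k \<Lambda>" "\<gamma> \<in> edges k \<Lambda>" using q i(1) j(1) of_deg_edges by blast+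
        obtain z where z: "path_value \<zeta> z" using path_value_exists[OF q(3)] by blast
        have zc: "z \<in> carrier A" using z by (rule path_value_closed)
        have "path_value \<nu> (s \<beta> \<otimes> z)" "path_value \<nu>' (s \<gamma> \<otimes> z)"
          unfolding q(9,10) using be q z by (auto intro: path_value.edge)
        then have "x' = s \<beta> \<otimes> z" "y' = s \<gamma> \<otimes> z"
          using less(1)[of \<nu>] less(1)[of \<nu>'] e(6) e'(6) \<xi> \<xi>' by simp_all
        moreover have "s \<mu> \<otimes> s \<beta> = s \<mu>' \<otimes> s \<gamma>"
          by (rule s_commute[OF i(1) j(1) False i(2) q(2,1) j(2) q(4,5,8)])
        ultimately show ?thesis
          using e(2,3) e'(2,3) be zc s_closed by (simp add: m_assoc[symmetric])
      qed
    qed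
  qed
qed

definition path_op :: "'e \<Rightarrow> 'a" where
  "path_op \<xi> = (THE x. path_value \<xi> x)"

lemma path_op_eq: "path_value \<xi> x \<Longrightarrow> path_op \<xi> = x"
  unfolding path_op_def using path_value_unique by blast

lemma path_value_path_op: "\<xi> \<in> mor \<Lambda> \<Longrightarrow> path_value \<xi> (path_op \<xi>)"
  using path_value_exists path_op_eq by metis

lemma path_op_closed: "\<xi> \<in> mor \<Lambda> \<Longrightarrow> path_op \<xi> \<in> carrier A"
  using path_value_path_op path_value_closed by blast

lemma path_op_vertex: "v \<in> vertices \<Lambda> \<Longrightarrow> path_op v = p v"
  by (intro path_op_eq path_value.vertex)

lemma path_op_cmp_edge:
  "\<lbrakk>\<mu> \<in> edges k \<Lambda>; \<nu> \<in> mor \<Lambda>; src \<Lambda> \<mu> = rng \<Lambda> \<nu>\<rbrakk> \<Longrightarrow> path_op (cmp \<Lambda> \<mu> \<nu>) = s \<mu> \<otimes> path_op \<nu>"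
  by (intro path_op_eq path_value.edge path_value_path_op)

lemma path_op_edge: "\<mu> \<in> edges k \<Lambda> \<Longrightarrow> path_op \<mu> = s \<mu>"
  using path_op_cmp_edge[of \<mu> "src \<Lambda> \<mu>"] edges_mor[of \<mu>] src_in_vertices[of \<mu>]
  by (simp add: cmp_src src_closed rng_src path_op_vertex s_mult_p)

lemma p_mult_path_op: "\<xi> \<in> mor \<Lambda> \<Longrightarrow> p (rng \<Lambda> \<xi>) \<otimes> path_op \<xi> = path_op \<xi>"
proof (induction rule: path_induct)
  case (vertex v)
  then show ?case by (simp add: vertexD path_op_vertex p_idem)
next
  case (edge \<mu> \<nu>)
  then have m: "\<mu> \<in> mor \<Lambda>" by (simp add: edges_mor)
  have "p (rng \<Lambda> \<mu>) \<otimes> (s \<mu> \<otimes> path_op \<nu>) = p (rng \<Lambda> \<mu>) \<otimes> s \<mu> \<otimes> path_op \<nu>"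
    using edge m by (simp add: m_assoc p_closed rng_in_vertices s_closed path_op_closed)
  then show ?case using edge m by (simp add: rng_cmp path_op_cmp_edge p_mult_s)
qed

lemma path_op_mult:
  "\<lbrakk>\<xi> \<in> mor \<Lambda>; \<eta> \<in> mor \<Lambda>; src \<Lambda> \<xi> = rng \<Lambda> \<eta>\<rbrakk> \<Longrightarrow> path_op \<xi> \<otimes> path_op \<eta> = path_op (cmp \<Lambda> \<xi> \<eta>)"
proof (induction rule: path_induct)
  case (vertex v)
  then show ?case
    using p_mult_path_op[of \<eta>] cmp_rng[of \<eta>] by (simp add: vertexD path_op_vertex)
next
  case (edge \<mu> \<nu>)
  then have m: "\<mu> \<in> mor \<Lambda>" and c: "src \<Lambda> \<nu> = rng \<Lambda> \<eta>" by (simp_all add: edges_mor src_cmp)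
  have "path_op (cmp \<Lambda> \<mu> \<nu>) \<otimes> path_op \<eta> = s \<mu> \<otimes> (path_op \<nu> \<otimes> path_op \<eta>)"
    using edge by (simp add: path_op_cmp_edge m_assoc s_closed path_op_closed)
  also have "\<dots> = path_op (cmp \<Lambda> \<mu> (cmp \<Lambda> \<nu> \<eta>))"
    using edge c by (simp add: path_op_cmp_edge cmp_closed rng_cmp)
  also have "\<dots> = path_op (cmp \<Lambda> (cmp \<Lambda> \<mu> \<nu>) \<eta>)"
    using cmp_assoc[OF m edge(2,5,3) c] by simp
  finally show ?case .
qed

lemma path_op_source: "\<xi> \<in> mor \<Lambda> \<Longrightarrow> (path_op \<xi>)\<^sup>\<star> \<otimes> path_op \<xi> = p (src \<Lambda> \<xi>)"
proof (induction rule: path_induct)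
  case (vertex v)
  then show ?case by (simp add: vertexD path_op_vertex p_adj p_idem)
next
  case (edge \<mu> \<nu>)
  then have m: "\<mu> \<in> mor \<Lambda>" by (simp add: edges_mor)
  note c = s_closed[OF edge(1)] path_op_closed[OF edge(2)]
  have "(s \<mu> \<otimes> path_op \<nu>)\<^sup>\<star> \<otimes> (s \<mu> \<otimes> path_op \<nu>) = (path_op \<nu>)\<^sup>\<star> \<otimes> (((s \<mu>)\<^sup>\<star> \<otimes> s \<mu>) \<otimes> path_op \<nu>)"
    using c by (simp add: adj_mult adj_closed m_closed m_assoc)
  also have "\<dots> = p (src \<Lambda> \<nu>)" using edge by (simp add: s_source p_mult_path_op)
  finally show ?case using edge m by (simp add: path_op_cmp_edge src_cmp)
qed

text \<open>Induction on \<open>|m|\<close>, removing one unit in a direction \<open>i\<close>. If \<open>v\<close> is the range of an edge in that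
  direction, expand \<open>p\<^sub>v = \<Sum> s\<^sub>\<mu> p\<^bsub>s(\<mu>)\<^esub> s\<^sub>\<mu>\<^sup>*\<close> and insert the hypothesis at each source; otherwise the set of paths does
  not change. Finiteness is carried along because \<open>finsum\<close> is zero on infinite sets.\<close>

lemma path_op_sum:
  assumes "v \<in> vertices \<Lambda>" "m \<in> multi_nat k"
  shows "finite (paths_le k \<Lambda> v m)"
    and "p v = (\<Oplus>\<xi>\<in>paths_le k \<Lambda> v m. path_op \<xi> \<otimes> (path_op \<xi>)\<^sup>\<star>)"
proof -
  have "finite (paths_le k \<Lambda> v m) \<and>
      p v = (\<Oplus>\<xi>\<in>paths_le k \<Lambda> v m. path_op \<xi> \<otimes> (path_op \<xi>)\<^sup>\<star>)"
    using assms
  proof (induction "deg_size k m" arbitrary: v m)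
    case 0
    then have "m i = 0" for i
      by (cases "i \<in> {1..k}") (auto simp: deg_size_def multi_nat_def)
    then have "m = 0" by (simp add: fun_eq_iff zero_fun_def)
    show ?case
      unfolding \<open>m = 0\<close> paths_le_zero[OF 0(2)]
      using 0(2) by (simp add: path_op_vertex p_closed p_adj p_idem)
  next
    case (Suc n)
    then have "\<exists>i\<in>{1..k}. m i \<noteq> 0"
      by (metis deg_size_def sum.neutral nat.distinct(1))
    then obtain i where i: "i \<in> {1..k}" "m i \<noteq> 0" by blast
    define m' where "m' = (\<lambda>j. m j - unit_deg i j)"
    have m: "m = unit_deg i + m'"
      using i(2) by (auto simp: m'_def unit_deg_def plus_fun_def fun_eq_iff)
    have m': "m' \<in> multi_nat k" using Suc(4) by (auto simp: m'_def multi_nat_def)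
    have n: "n = deg_size k m'" using Suc(2) i(1) unfolding m by (simp add: deg_size_add deg_size_unit)
    note IH = Suc(1)[OF n _ m']
    let ?E = "of_deg_at \<Lambda> v (unit_deg i)"
    show ?case
    proof (cases "?E = {}")
      case True
      then show ?thesis using IH[OF Suc(3)] paths_le_no_edge[OF i(1) True] by (simp add: m)
    next
      case False
      let ?f = "\<lambda>\<xi>. path_op \<xi> \<otimes> (path_op \<xi>)\<^sup>\<star>"
      let ?P = "\<lambda>\<mu>. paths_le k \<Lambda> (src \<Lambda> \<mu>) m'"
      have fE: "finite ?E"
        using row_finite Suc(3) unit_deg_multi_nat[OF i(1)] by (simp add: row_finite_def)
      have E: "\<mu> \<in> edges k \<Lambda>" "\<mu> \<in> mor \<Lambda>" "deg \<Lambda> \<mu> = unit_deg i" "src \<Lambda> \<mu> \<in> vertices \<Lambda>"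
        if "\<mu> \<in> ?E" for \<mu>
        using that i(1) of_deg_edges of_degD src_in_vertices by (auto simp: of_deg_at_def)
      have P: "\<nu> \<in> mor \<Lambda>" "src \<Lambda> \<mu> = rng \<Lambda> \<nu>" if "\<nu> \<in> ?P \<mu>" for \<mu> \<nu>
        using that by (auto simp: paths_le_def)
      have split: "paths_le k \<Lambda> v m = (\<Union>\<mu>\<in>?E. cmp \<Lambda> \<mu> ` ?P \<mu>)"
        unfolding m by (rule paths_le_first_edge[OF locally_convex i(1) False])
      have fin: "finite (cmp \<Lambda> \<mu> ` ?P \<mu>)" if "\<mu> \<in> ?E" for \<mu>
        using IH[OF E(4)[OF that]] by blast
      have cl: "?f (cmp \<Lambda> \<mu> \<nu>) \<in> carrier A" if "\<mu> \<in> ?E" "\<nu> \<in> ?P \<mu>" for \<mu> \<nu>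
        using E[OF that(1)] P[OF that(2)] by (simp add: path_op_closed cmp_closed m_closed adj_closed)
      have disj: "pairwise (\<lambda>\<mu> \<mu>'. disjnt (cmp \<Lambda> \<mu> ` ?P \<mu>) (cmp \<Lambda> \<mu>' ` ?P \<mu>')) ?E"
      proof (rule pairwiseI)
        fix \<mu> \<mu>' assume e: "\<mu> \<in> ?E" "\<mu>' \<in> ?E" "\<mu> \<noteq> \<mu>'"
        have "cmp \<Lambda> \<mu> \<nu> \<noteq> cmp \<Lambda> \<mu>' \<nu>'" if "\<nu> \<in> ?P \<mu>" "\<nu>' \<in> ?P \<mu>'" for \<nu> \<nu>'
          using factorisation_unique(1)[of \<mu> \<nu> \<mu>' \<nu>'] E[OF e(1)] E[OF e(2)] P[OF that(1)] P[OF that(2)] e(3)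
          by auto
        then show "disjnt (cmp \<Lambda> \<mu> ` ?P \<mu>) (cmp \<Lambda> \<mu>' ` ?P \<mu>')"
          by (auto simp: disjnt_def)
      qed
      have inner: "finsum A ?f (cmp \<Lambda> \<mu> ` ?P \<mu>) = s \<mu> \<otimes> (s \<mu>)\<^sup>\<star>" if \<mu>: "\<mu> \<in> ?E" for \<mu>
      proof -
        have inj: "inj_on (cmp \<Lambda> \<mu>) (?P \<mu>)"
          using factorisation_unique(2)[of \<mu> _ \<mu>] E[OF \<mu>] P by (intro inj_onI) metis
        have sc: "s \<mu> \<in> carrier A" "(s \<mu>)\<^sup>\<star> \<in> carrier A" using s_closed E \<mu> adj_closed by blast+
        have fc: "?f \<nu> \<in> carrier A" if "\<nu> \<in> ?P \<mu>" for \<nu>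
          using P[OF that] by (simp add: path_op_closed m_closed adj_closed)
        have "finsum A ?f (cmp \<Lambda> \<mu> ` ?P \<mu>) = (\<Oplus>\<nu>\<in>?P \<mu>. ?f (cmp \<Lambda> \<mu> \<nu>))"
          using inj cl[OF \<mu>] by (intro finsum_reindex) auto
        also have "\<dots> = (\<Oplus>\<nu>\<in>?P \<mu>. s \<mu> \<otimes> ?f \<nu> \<otimes> (s \<mu>)\<^sup>\<star>)"
        proof (rule finsum_cong')
          show "?f (cmp \<Lambda> \<mu> \<nu>) = s \<mu> \<otimes> ?f \<nu> \<otimes> (s \<mu>)\<^sup>\<star>" if \<nu>: "\<nu> \<in> ?P \<mu>" for \<nu>
            using sc E[OF \<mu>] P[OF \<nu>] path_op_closed[of \<nu>]
            by (simp add: path_op_cmp_edge adj_mult m_assoc m_closed adj_closed)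
        qed (use sc fc in \<open>auto simp: m_closed\<close>)
        also have "\<dots> = s \<mu> \<otimes> finsum A ?f (?P \<mu>) \<otimes> (s \<mu>)\<^sup>\<star>"
          using sc fc by (simp add: finsum_mult_left finsum_mult_right m_closed Pi_iff)
        also have "\<dots> = s \<mu> \<otimes> p (src \<Lambda> \<mu>) \<otimes> (s \<mu>)\<^sup>\<star>" using IH[OF E(4)[OF \<mu>]] by simp
        also have "\<dots> = s \<mu> \<otimes> (s \<mu>)\<^sup>\<star>" using E[OF \<mu>] by (simp add: s_mult_p)
        finally show ?thesis .
      qed
      have "finsum A ?f (paths_le k \<Lambda> v m) = (\<Oplus>\<mu>\<in>?E. finsum A ?f (cmp \<Lambda> \<mu> ` ?P \<mu>))"
        unfolding split by (rule add.finprod_UN_disjoint[OF fE fin disj]) (use cl in auto)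
      also have "\<dots> = (\<Oplus>\<mu>\<in>?E. s \<mu> \<otimes> (s \<mu>)\<^sup>\<star>)"
        using inner E s_closed by (intro finsum_cong') (auto simp: m_closed adj_closed)
      also have "\<dots> = p v" using p_sum[OF Suc(3) i(1) False] by simp
      finally show ?thesis using fE fin unfolding split by auto
    qed
  qed
  then show "finite (paths_le k \<Lambda> v m)"
    "p v = (\<Oplus>\<xi>\<in>paths_le k \<Lambda> v m. path_op \<xi> \<otimes> (path_op \<xi>)\<^sup>\<star>)" by auto
qed

lemma path_op_family: "kgraph_family k \<Lambda> A path_op"
  unfolding kgraph_family_def
proof (intro conjI ballI impI)
  fix \<xi> assume \<xi>: "\<xi> \<in> mor \<Lambda>"
  have v: "src \<Lambda> \<xi> \<in> vertices \<Lambda>" using \<xi> by (rule src_in_vertices)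
  note c = path_op_closed[OF \<xi>]
  show "path_op \<xi> \<in> carrier A" by (rule c)
  have "path_op \<xi> \<otimes> ((path_op \<xi>)\<^sup>\<star> \<otimes> path_op \<xi>) = path_op \<xi>"
    by (rule partial_isometry_mult_source[OF c]) (simp add: path_op_source \<xi> p_projection v)
  then show "path_op \<xi> \<otimes> (path_op \<xi>)\<^sup>\<star> \<otimes> path_op \<xi> = path_op \<xi>"
    using c by (simp add: m_assoc adj_closed)
  show "(path_op \<xi>)\<^sup>\<star> \<otimes> path_op \<xi> = path_op (src \<Lambda> \<xi>)"
    using \<xi> v by (simp add: path_op_source path_op_vertex)
next
  fix v w assume "v \<in> vertices \<Lambda>" "w \<in> vertices \<Lambda>" "v \<noteq> w"
  then show "path_op v \<otimes> path_op w = \<zero>"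
    using family by (simp add: path_op_vertex CK_family_def)
qed (simp_all add: path_op_vertex p_projection path_op_mult path_op_sum(2)[symmetric])

end
section \<open>Isomorphisms from universal properties\<close>

text \<open>The fixed points of a norm-decreasing *-homomorphism form a closed *-subalgebra.\<close>

lemma star_hom_fixing_generators:
  assumes "cstar_algebra A" and h: "star_hom A A h"
    and contractive: "\<And>x. x \<in> carrier A \<Longrightarrow> cnorm A (h x) \<le> cnorm A x"
    and S: "S \<subseteq> carrier A" "cstar_generated A S = carrier A"
    and fixes_S: "\<And>x. x \<in> S \<Longrightarrow> h x = x"
    and x: "x \<in> carrier A"
  shows "h x = x"
proof -
  interpret cstar_algebra A by fact
  let ?F = "{x \<in> carrier A. h x = x}"
  have "closed_star_subalgebra A ?F"
  proof (rule closed_star_subalgebraI)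
    show "\<zero>\<^bsub>A\<^esub> \<in> ?F"
      using star_hom_zero[OF h star_algebra_axioms star_algebra_axioms] by simp
    fix X y assume y: "y \<in> carrier A" and X: "\<And>n::nat. X n \<in> ?F"
      and lim: "(\<lambda>n. cnorm A (X n \<ominus>\<^bsub>A\<^esub> y)) \<longlonglongrightarrow> 0"
    have hy: "h y \<in> carrier A" using h y by (rule star_homD)
    have "cnorm A (X n \<ominus>\<^bsub>A\<^esub> h y) \<le> cnorm A (X n \<ominus>\<^bsub>A\<^esub> y)" for n
      using contractive[of "X n \<ominus>\<^bsub>A\<^esub> y"] star_hom_minus[OF h star_algebra_axioms star_algebra_axioms, of "X n" y]
        X[of n] y by simp
    then have "(\<lambda>n. cnorm A (X n \<ominus>\<^bsub>A\<^esub> h y)) \<longlonglongrightarrow> 0"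
      using X hy by (intro tendsto_sandwich[OF _ _ tendsto_const lim]) (auto intro!: norm_nonneg always_eventually)
    then have "h y = y" using limit_unique[OF hy y _ _ lim] X by simp
    then show "y \<in> ?F" using y by simp
  qed (auto simp: star_homD[OF h] m_closed scale_closed adj_closed)
  moreover have "S \<subseteq> ?F" using S fixes_S by auto
  ultimately have "cstar_generated A S \<subseteq> ?F" unfolding cstar_generated_def by blast
  then show ?thesis using S(2) x by blast
qed

lemma star_iso_from_inverse_on_generators:
  assumes A: "cstar_algebra A" and B: "cstar_algebra B"
    and f: "star_hom A B f" "\<And>x. x \<in> carrier A \<Longrightarrow> cnorm B (f x) \<le> cnorm A x"
    and g: "star_hom B A g" "\<And>y. y \<in> carrier B \<Longrightarrow> cnorm A (g y) \<le> cnorm B y"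
    and S: "S \<subseteq> carrier A" "cstar_generated A S = carrier A" "\<And>x. x \<in> S \<Longrightarrow> g (f x) = x"
    and T: "T \<subseteq> carrier B" "cstar_generated B T = carrier B" "\<And>y. y \<in> T \<Longrightarrow> f (g y) = y"
  shows "star_iso A B f"
proof -
  have "g (f x) = x" if "x \<in> carrier A" for x
    using star_hom_fixing_generators[OF A star_hom_comp[OF f(1) g(1)] _ S that] f g star_homD(1)[OF f(1)]
    by (meson order_trans)
  moreover have "f (g y) = y" if "y \<in> carrier B" for y
    using star_hom_fixing_generators[OF B star_hom_comp[OF g(1) f(1)] _ T that] f g star_homD(1)[OF g(1)]
    by (meson order_trans)
  ultimately have "bij_betw f (carrier A) (carrier B)"
    using star_homD(1)[OF f(1)] star_homD(1)[OF g(1)] by (intro bij_betw_byWitness[where f' = g]) auto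
  then show ?thesis using f(1) by (simp add: star_iso_def)
qed

context k_graph
begin

lemma edges_eq_cubes_1: "edges k \<Lambda> = cubes k \<Lambda> 1"
proof (intro equalityI subsetI)
  fix \<mu> assume "\<mu> \<in> edges k \<Lambda>"
  then show "\<mu> \<in> cubes k \<Lambda> 1"
    by (auto simp: edges_def of_deg_def cubes_def deg_size_unit)
      (auto simp: le_fun_def unit_deg_def ones_deg_def)
next
  fix \<mu> assume "\<mu> \<in> cubes k \<Lambda> 1"
  then have \<mu>: "\<mu> \<in> mor \<Lambda>" "deg_size k (deg \<Lambda> \<mu>) = 1" by (auto simp: cubes_def)
  then obtain i where i: "i \<in> {1..k}" "deg \<Lambda> \<mu> i \<noteq> 0"
    by (metis deg_size_def sum.neutral zero_neq_one)
  then obtain \<alpha> \<beta> where f: "\<alpha> \<in> of_deg \<Lambda> (unit_deg i)" "\<beta> \<in> mor \<Lambda>" "src \<Lambda> \<alpha> = rng \<Lambda> \<beta>" "\<mu> = cmp \<Lambda> \<alpha> \<beta>"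
    using factor_at_direction[OF \<mu>(1)] by blast
  have \<alpha>: "\<alpha> \<in> edges k \<Lambda>" using f(1) i(1) by (rule of_deg_edges)
  have "deg_size k (deg \<Lambda> \<beta>) = 0" using deg_size_cmp_edge[OF \<alpha> f(2,3)] f(4) \<mu>(2) by simp
  then have "deg \<Lambda> \<beta> j = 0" for j
    using deg_closed[OF f(2)] by (cases "j \<in> {1..k}") (auto simp: deg_size_def multi_nat_def)
  then have "\<beta> \<in> vertices \<Lambda>" using f(2) by (auto simp: vertices_def of_deg_def zero_fun_def)
  then have "\<mu> = \<alpha>" using f cmp_src[of \<alpha>] of_degD[OF f(1)] by (simp add: vertexD)
  then show "\<mu> \<in> edges k \<Lambda>" using \<alpha> by simp
qed

text \<open>The faces of the square \<open>\<mu>\<nu> = \<nu>'\<mu>'\<close> are \<open>F\<^sub>1\<^sup>0 = \<nu>'\<close>, \<open>F\<^sub>1\<^sup>1 = \<nu>\<close>, \<open>F\<^sub>2\<^sup>0 = \<mu>\<close> and \<open>F\<^sub>2\<^sup>1 = \<mu>'\<close>: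
  direction 1 is that of \<open>\<mu>\<close> and \<open>\<mu>'\<close>, because \<open>i < j\<close>.\<close>

lemma coboundary_square:
  assumes ij: "i \<in> {1..k}" "j \<in> {1..k}" "i < j"
    and \<mu>: "\<mu> \<in> of_deg \<Lambda> (unit_deg i)" and \<mu>': "\<mu>' \<in> of_deg \<Lambda> (unit_deg i)"
    and \<nu>: "\<nu> \<in> of_deg \<Lambda> (unit_deg j)" and \<nu>': "\<nu>' \<in> of_deg \<Lambda> (unit_deg j)"
    and c: "src \<Lambda> \<mu> = rng \<Lambda> \<nu>" and c': "src \<Lambda> \<nu>' = rng \<Lambda> \<mu>'"
    and eq: "cmp \<Lambda> \<mu> \<nu> = cmp \<Lambda> \<nu>' \<mu>'"
  shows "cmp \<Lambda> \<mu> \<nu> \<in> cubes k \<Lambda> 2"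
    and "coboundary k \<Lambda> 1 \<alpha> (cmp \<Lambda> \<mu> \<nu>) = \<alpha> \<mu> * \<alpha> \<nu> / (\<alpha> \<nu>' * \<alpha> \<mu>')"
proof -
  let ?\<xi> = "cmp \<Lambda> \<mu> \<nu>"
  note m = of_degD(1)[OF \<mu>] of_degD(1)[OF \<mu>'] of_degD(1)[OF \<nu>] of_degD(1)[OF \<nu>']
  note d = of_degD(2)[OF \<mu>] of_degD(2)[OF \<mu>'] of_degD(2)[OF \<nu>] of_degD(2)[OF \<nu>']
  have e: "\<mu> \<in> edges k \<Lambda>" "\<mu>' \<in> edges k \<Lambda>" "\<nu> \<in> edges k \<Lambda>" "\<nu>' \<in> edges k \<Lambda>"
    using \<mu> \<mu>' \<nu> \<nu>' ij of_deg_edges by blast+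
  have \<xi>: "deg \<Lambda> ?\<xi> = unit_deg i + unit_deg j" using m c d by (simp add: deg_cmp)
  have size: "deg_size k (deg \<Lambda> ?\<xi>) = 2" using ij unfolding \<xi> by (simp add: deg_size_add deg_size_unit)
  show "?\<xi> \<in> cubes k \<Lambda> 2"
    using size m c ij unfolding cubes_def
    by (auto simp: cmp_closed \<xi> le_fun_def plus_fun_def unit_deg_def ones_deg_def)
  have "{l \<in> {1..k}. deg \<Lambda> ?\<xi> l \<noteq> 0} = {i, j}"
    using ij unfolding \<xi> by (auto simp: plus_fun_def unit_deg_def split: if_splits)
  moreover have "sorted_list_of_set {i, j} = [i, j]"
    using ij(3) by simp
  ultimately have dir: "cube_dir k \<Lambda> 1 ?\<xi> = i" "cube_dir k \<Lambda> 2 ?\<xi> = j" by (simp_all add: cube_dir_def)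
  have one: "cubes k \<Lambda> (deg_size k (deg \<Lambda> ?\<xi>) - 1) = edges k \<Lambda>"
    by (simp add: size edges_eq_cubes_1)
  have front: "face k \<Lambda> 0 n ?\<xi> = a"
    if a: "a \<in> edges k \<Lambda>" "b \<in> of_deg \<Lambda> (unit_deg (cube_dir k \<Lambda> n ?\<xi>))" "src \<Lambda> a = rng \<Lambda> b" "cmp \<Lambda> a b = ?\<xi>"
    for n a b
    unfolding face_def one
  proof (rule the_equality)
    fix a'
    assume "a' \<in> edges k \<Lambda> \<and> (\<exists>b\<in>of_deg \<Lambda> (unit_deg (cube_dir k \<Lambda> n ?\<xi>)).
      if (0::nat) = 0 then src \<Lambda> a' = rng \<Lambda> b \<and> cmp \<Lambda> a' b = ?\<xi> else src \<Lambda> b = rng \<Lambda> a' \<and> cmp \<Lambda> b a' = ?\<xi>)"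
    then obtain b' where "a' \<in> edges k \<Lambda>" "b' \<in> of_deg \<Lambda> (unit_deg (cube_dir k \<Lambda> n ?\<xi>))"
      "src \<Lambda> a' = rng \<Lambda> b'" "cmp \<Lambda> a' b' = ?\<xi>" by auto
    then show "a' = a"
      using factorisation_unique(1)[of a' b' a b] a edges_mor by (simp add: of_deg_def)
  qed (use a in auto)
  have rear: "face k \<Lambda> 1 n ?\<xi> = a"
    if a: "a \<in> edges k \<Lambda>" "b \<in> of_deg \<Lambda> (unit_deg (cube_dir k \<Lambda> n ?\<xi>))" "src \<Lambda> b = rng \<Lambda> a" "cmp \<Lambda> b a = ?\<xi>"
    for n a b
    unfolding face_def one
  proof (rule the_equality)
    fix a'
    assume "a' \<in> edges k \<Lambda> \<and> (\<exists>b\<in>of_deg \<Lambda> (unit_deg (cube_dir k \<Lambda> n ?\<xi>)).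
      if (1::nat) = 0 then src \<Lambda> a' = rng \<Lambda> b \<and> cmp \<Lambda> a' b = ?\<xi> else src \<Lambda> b = rng \<Lambda> a' \<and> cmp \<Lambda> b a' = ?\<xi>)"
    then obtain b' where "a' \<in> edges k \<Lambda>" "b' \<in> of_deg \<Lambda> (unit_deg (cube_dir k \<Lambda> n ?\<xi>))"
      "src \<Lambda> b' = rng \<Lambda> a'" "cmp \<Lambda> b' a' = ?\<xi>" by auto
    then show "a' = a"
      using factorisation_unique(2)[of b' a' b a] a edges_mor by (simp add: of_deg_def)
  qed (use a in auto)
  have "face k \<Lambda> 0 1 ?\<xi> = \<nu>'" "face k \<Lambda> 1 1 ?\<xi> = \<nu>" "face k \<Lambda> 0 2 ?\<xi> = \<mu>" "face k \<Lambda> 1 2 ?\<xi> = \<mu>'"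
    using front[of \<nu>' \<mu>' 1] rear[of \<nu> \<mu> 1] front[of \<mu> \<nu> 2] rear[of \<mu>' \<nu>' 2]
      e c c' eq \<mu> \<mu>' \<nu> \<nu>' unfolding dir by simp_all
  then show "coboundary k \<Lambda> 1 \<alpha> ?\<xi> = \<alpha> \<mu> * \<alpha> \<nu> / (\<alpha> \<nu>' * \<alpha> \<mu>')"
    by (simp add: coboundary_def numeral_2_eq_2 divide_simps power_int_minus)
qed

text \<open>Scalars of modulus one cancel in \<open>s\<^sup>*s\<close> and \<open>s s\<^sup>*\<close>, so only the commutation relation changes, and
  there \<open>coboundary_square\<close> accounts for the change.\<close>

lemma CK_family_twist:
  assumes A: "star_algebra A" and fam: "CK_family k \<Lambda> \<phi> A p s"
    and \<alpha>: "\<And>\<mu>. \<mu> \<in> edges k \<Lambda> \<Longrightarrow> cmod (\<alpha> \<mu>) = 1"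
    and coh: "\<And>\<xi>. \<xi> \<in> cubes k \<Lambda> 2 \<Longrightarrow> \<phi> \<xi> = coboundary k \<Lambda> 1 \<alpha> \<xi> * \<psi> \<xi>"
  shows "CK_family k \<Lambda> \<psi> A p (\<lambda>\<mu>. \<alpha> \<mu> \<odot>\<^bsub>A\<^esub> s \<mu>)"
proof -
  interpret star_algebra A by (rule A)
  have s: "s \<mu> \<in> carrier A" if "\<mu> \<in> edges k \<Lambda>" for \<mu>
    using fam that by (simp add: CK_family_def)
  have \<alpha>1: "cnj (\<alpha> \<mu>) * \<alpha> \<mu> = 1" "\<alpha> \<mu> * cnj (\<alpha> \<mu>) = 1" "\<alpha> \<mu> \<noteq> 0" if "\<mu> \<in> edges k \<Lambda>" for \<mu>
  proof -
    have "\<alpha> \<mu> * cnj (\<alpha> \<mu>) = complex_of_real ((cmod (\<alpha> \<mu>))\<^sup>2)" by (rule complex_norm_square[symmetric])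
    then show "\<alpha> \<mu> * cnj (\<alpha> \<mu>) = 1" unfolding \<alpha>[OF that] by simp
    then show "cnj (\<alpha> \<mu>) * \<alpha> \<mu> = 1" "\<alpha> \<mu> \<noteq> 0" by (simp_all only: mult.commute) auto
  qed
  have src: "(\<alpha> \<mu> \<odot>\<^bsub>A\<^esub> s \<mu>)\<^sup>\<star>\<^bsub>A\<^esub> \<otimes>\<^bsub>A\<^esub> (\<alpha> \<mu> \<odot>\<^bsub>A\<^esub> s \<mu>) = p (src \<Lambda> \<mu>)" if \<mu>: "\<mu> \<in> edges k \<Lambda>" for \<mu>
  proof -
    have "(\<alpha> \<mu> \<odot>\<^bsub>A\<^esub> s \<mu>)\<^sup>\<star>\<^bsub>A\<^esub> \<otimes>\<^bsub>A\<^esub> (\<alpha> \<mu> \<odot>\<^bsub>A\<^esub> s \<mu>) = (s \<mu>)\<^sup>\<star>\<^bsub>A\<^esub> \<otimes>\<^bsub>A\<^esub> s \<mu>"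
      using s[OF \<mu>] by (simp add: adj_scale scale_mult_left scale_mult_right scale_scale scale_closed
          adj_closed m_closed \<alpha>1[OF \<mu>] scale_one)
    also have "\<dots> = p (src \<Lambda> \<mu>)" using fam \<mu> by (simp add: CK_family_def)
    finally show ?thesis .
  qed
  have rng: "(\<alpha> \<mu> \<odot>\<^bsub>A\<^esub> s \<mu>) \<otimes>\<^bsub>A\<^esub> (\<alpha> \<mu> \<odot>\<^bsub>A\<^esub> s \<mu>)\<^sup>\<star>\<^bsub>A\<^esub> = s \<mu> \<otimes>\<^bsub>A\<^esub> (s \<mu>)\<^sup>\<star>\<^bsub>A\<^esub>" if \<mu>: "\<mu> \<in> edges k \<Lambda>" for \<mu>
    using s[OF \<mu>] by (simp add: adj_scale scale_mult_left scale_mult_right scale_scale scale_closed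
        adj_closed m_closed \<alpha>1[OF \<mu>] scale_one)
  have square: "(\<alpha> \<nu>' \<odot>\<^bsub>A\<^esub> s \<nu>') \<otimes>\<^bsub>A\<^esub> (\<alpha> \<mu>' \<odot>\<^bsub>A\<^esub> s \<mu>')
      = \<psi> (cmp \<Lambda> \<mu> \<nu>) \<odot>\<^bsub>A\<^esub> ((\<alpha> \<mu> \<odot>\<^bsub>A\<^esub> s \<mu>) \<otimes>\<^bsub>A\<^esub> (\<alpha> \<nu> \<odot>\<^bsub>A\<^esub> s \<nu>))"
    if ij: "i \<in> {1..k}" "j \<in> {1..k}" "i < j"
      and q: "\<mu> \<in> of_deg \<Lambda> (unit_deg i)" "\<mu>' \<in> of_deg \<Lambda> (unit_deg i)"
        "\<nu> \<in> of_deg \<Lambda> (unit_deg j)" "\<nu>' \<in> of_deg \<Lambda> (unit_deg j)"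
        "src \<Lambda> \<mu> = rng \<Lambda> \<nu>" "src \<Lambda> \<nu>' = rng \<Lambda> \<mu>'" "cmp \<Lambda> \<mu> \<nu> = cmp \<Lambda> \<nu>' \<mu>'" for i j \<mu> \<mu>' \<nu> \<nu>'
  proof -
    have e: "\<mu> \<in> edges k \<Lambda>" "\<mu>' \<in> edges k \<Lambda>" "\<nu> \<in> edges k \<Lambda>" "\<nu>' \<in> edges k \<Lambda>"
      using q ij of_deg_edges by blast+
    have ss: "s \<nu>' \<otimes>\<^bsub>A\<^esub> s \<mu>' = \<phi> (cmp \<Lambda> \<mu> \<nu>) \<odot>\<^bsub>A\<^esub> (s \<mu> \<otimes>\<^bsub>A\<^esub> s \<nu>)"
      using fam ij q unfolding CK_family_def by blast
    have "\<phi> (cmp \<Lambda> \<mu> \<nu>) = \<alpha> \<mu> * \<alpha> \<nu> / (\<alpha> \<nu>' * \<alpha> \<mu>') * \<psi> (cmp \<Lambda> \<mu> \<nu>)"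
      using coh[OF coboundary_square(1)[OF ij q]] unfolding coboundary_square(2)[OF ij q, of \<alpha>] .
    then have "\<alpha> \<nu>' * \<alpha> \<mu>' * \<phi> (cmp \<Lambda> \<mu> \<nu>) = \<psi> (cmp \<Lambda> \<mu> \<nu>) * (\<alpha> \<mu> * \<alpha> \<nu>)"
      using \<alpha>1(3) e by simp
    then show ?thesis
      using s e by (simp add: scale_mult_left scale_mult_right scale_scale scale_closed m_closed ss mult_ac)
  qed
  have sum: "(\<Oplus>\<^bsub>A\<^esub>\<mu>\<in>of_deg_at \<Lambda> v (unit_deg i). (\<alpha> \<mu> \<odot>\<^bsub>A\<^esub> s \<mu>) \<otimes>\<^bsub>A\<^esub> (\<alpha> \<mu> \<odot>\<^bsub>A\<^esub> s \<mu>)\<^sup>\<star>\<^bsub>A\<^esub>)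
      = (\<Oplus>\<^bsub>A\<^esub>\<mu>\<in>of_deg_at \<Lambda> v (unit_deg i). s \<mu> \<otimes>\<^bsub>A\<^esub> (s \<mu>)\<^sup>\<star>\<^bsub>A\<^esub>)" if "i \<in> {1..k}" for v i
    by (rule finsum_cong')
      (use that of_deg_edges s rng in \<open>auto simp: of_deg_at_def m_closed adj_closed\<close>)
  show ?thesis
    unfolding CK_family_def
  proof (intro conjI ballI impI)
    show "projection A (p v)" if "v \<in> vertices \<Lambda>" for v
      using fam that by (simp add: CK_family_def)
    show "p v \<otimes>\<^bsub>A\<^esub> p w = \<zero>\<^bsub>A\<^esub>" if "v \<in> vertices \<Lambda>" "w \<in> vertices \<Lambda>" "v \<noteq> w" for v w
      using fam that by (simp add: CK_family_def)
    show "p v = (\<Oplus>\<^bsub>A\<^esub>\<mu>\<in>of_deg_at \<Lambda> v (unit_deg i). (\<alpha> \<mu> \<odot>\<^bsub>A\<^esub> s \<mu>) \<otimes>\<^bsub>A\<^esub> (\<alpha> \<mu> \<odot>\<^bsub>A\<^esub> s \<mu>)\<^sup>\<star>\<^bsub>A\<^esub>)"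
      if "v \<in> vertices \<Lambda>" "i \<in> {1..k}" "of_deg_at \<Lambda> v (unit_deg i) \<noteq> {}" for v i
      unfolding sum[OF that(2)] using fam that by (simp add: CK_family_def)
    show "\<alpha> \<mu> \<odot>\<^bsub>A\<^esub> s \<mu> \<in> carrier A" if "\<mu> \<in> edges k \<Lambda>" for \<mu> using s[OF that] by (rule scale_closed)
  qed (rule src square; assumption)+
qed

lemma CK_algebra_generators_closed:
  "CK_p k \<Lambda> \<phi> ` vertices \<Lambda> \<union> CK_s k \<Lambda> \<phi> ` edges k \<Lambda> \<subseteq> carrier (CK_algebra k \<Lambda> \<phi>)"
  using CK_universal(2)[of \<phi>] by (auto simp: CK_family_def projection_def)

lemma kgraph_generators_closed: "kgraph_t k \<Lambda> ` mor \<Lambda> \<subseteq> carrier (kgraph_algebra k \<Lambda>)"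
  using kgraph_universal(2) by (auto simp: kgraph_family_def)

text \<open>The hypothesis is symmetric in the two cocycles after replacing \<open>\<alpha>\<close> by its inverse, so
  \<open>CK_family_twist\<close> applies in both directions.\<close>

lemma CK_algebra_cohomologous:
  assumes \<phi>: "\<phi> \<in> cochains k \<Lambda> 2" and \<alpha>: "\<alpha> \<in> cochains k \<Lambda> 1"
    and coh: "\<And>\<xi>. \<xi> \<in> cubes k \<Lambda> 2 \<Longrightarrow> \<phi> \<xi> = coboundary k \<Lambda> 1 \<alpha> \<xi> * \<psi> \<xi>"
  shows "\<exists>\<pi>. star_iso (CK_algebra k \<Lambda> \<psi>) (CK_algebra k \<Lambda> \<phi>) \<pi> \<and>
     (\<forall>v\<in>vertices \<Lambda>. \<pi> (CK_p k \<Lambda> \<psi> v) = CK_p k \<Lambda> \<phi> v) \<and>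
     (\<forall>\<mu>\<in>edges k \<Lambda>. \<pi> (CK_s k \<Lambda> \<psi> \<mu>) = \<alpha> \<mu> \<odot>\<^bsub>CK_algebra k \<Lambda> \<phi>\<^esub> CK_s k \<Lambda> \<phi> \<mu>)"
proof -
  let ?A = "CK_algebra k \<Lambda> \<psi>" and ?B = "CK_algebra k \<Lambda> \<phi>"
  interpret A: cstar_algebra ?A by (rule CK_universal(1))
  interpret B: cstar_algebra ?B by (rule CK_universal(1))
  define \<beta> where "\<beta> = (\<lambda>\<mu>. inverse (\<alpha> \<mu>))"
  have \<alpha>1: "cmod (\<alpha> \<mu>) = 1" if "\<mu> \<in> edges k \<Lambda>" for \<mu>
    using \<alpha> that by (auto simp: cochains_def edges_eq_cubes_1)
  have \<beta>1: "cmod (\<beta> \<mu>) = 1" "\<alpha> \<mu> * \<beta> \<mu> = 1" "\<beta> \<mu> * \<alpha> \<mu> = 1" if "\<mu> \<in> edges k \<Lambda>" for \<mu>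
  proof -
    have "\<alpha> \<mu> \<noteq> 0" using \<alpha>1[OF that] by auto
    then show "cmod (\<beta> \<mu>) = 1" "\<alpha> \<mu> * \<beta> \<mu> = 1" "\<beta> \<mu> * \<alpha> \<mu> = 1"
      using \<alpha>1[OF that] by (simp_all add: \<beta>_def norm_inverse)
  qed
  have coh': "\<psi> \<xi> = coboundary k \<Lambda> 1 \<beta> \<xi> * \<phi> \<xi>" if "\<xi> \<in> cubes k \<Lambda> 2" for \<xi>
  proof -
    have "coboundary k \<Lambda> 1 \<beta> \<xi> = inverse (coboundary k \<Lambda> 1 \<alpha> \<xi>)"
      by (simp add: coboundary_def \<beta>_def power_int_inverse prod_inversef)
    moreover have "\<phi> \<xi> \<noteq> 0" using \<phi> that by (force simp: cochains_def)
    ultimately show ?thesis using coh[OF that] by auto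
  qed
  have s: "CK_s k \<Lambda> \<psi> \<mu> \<in> carrier ?A" "CK_s k \<Lambda> \<phi> \<mu> \<in> carrier ?B" if "\<mu> \<in> edges k \<Lambda>" for \<mu>
    using that CK_algebra_generators_closed by blast+
  obtain f where f: "star_hom ?A ?B f" "\<forall>x\<in>carrier ?A. cnorm ?B (f x) \<le> cnorm ?A x"
    "\<forall>v\<in>vertices \<Lambda>. f (CK_p k \<Lambda> \<psi> v) = CK_p k \<Lambda> \<phi> v"
    "\<forall>\<mu>\<in>edges k \<Lambda>. f (CK_s k \<Lambda> \<psi> \<mu>) = \<alpha> \<mu> \<odot>\<^bsub>?B\<^esub> CK_s k \<Lambda> \<phi> \<mu>"
    using CK_universal(4)[OF CK_universal(1)
        CK_family_twist[OF B.star_algebra_axioms CK_universal(2) \<alpha>1 coh]] by blast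
  obtain g where g: "star_hom ?B ?A g" "\<forall>x\<in>carrier ?B. cnorm ?A (g x) \<le> cnorm ?B x"
    "\<forall>v\<in>vertices \<Lambda>. g (CK_p k \<Lambda> \<phi> v) = CK_p k \<Lambda> \<psi> v"
    "\<forall>\<mu>\<in>edges k \<Lambda>. g (CK_s k \<Lambda> \<phi> \<mu>) = \<beta> \<mu> \<odot>\<^bsub>?A\<^esub> CK_s k \<Lambda> \<psi> \<mu>"
    using CK_universal(4)[OF CK_universal(1)
        CK_family_twist[OF A.star_algebra_axioms CK_universal(2) \<beta>1(1) coh']] by blast
  have "star_iso ?A ?B f"
  proof (rule star_iso_from_inverse_on_generators[OF CK_universal(1) CK_universal(1) f(1) _ g(1) _
        CK_algebra_generators_closed CK_universal(3) _ CK_algebra_generators_closed CK_universal(3)])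
    fix x assume "x \<in> CK_p k \<Lambda> \<psi> ` vertices \<Lambda> \<union> CK_s k \<Lambda> \<psi> ` edges k \<Lambda>"
    then show "g (f x) = x"
      using f(3,4) g(3,4) s by (auto simp: star_homD(4)[OF g(1)] A.scale_scale A.scale_one \<beta>1)
  next
    fix y assume "y \<in> CK_p k \<Lambda> \<phi> ` vertices \<Lambda> \<union> CK_s k \<Lambda> \<phi> ` edges k \<Lambda>"
    then show "f (g y) = y"
      using f(3,4) g(3,4) s by (auto simp: star_homD(4)[OF f(1)] B.scale_scale B.scale_one \<beta>1)
  qed (use f(2) g(2) in blast)+
  then show ?thesis using f by blast
qed

text \<open>When \<open>v\<close> is the range of an edge in direction \<open>i\<close>, the set \<open>v\<Lambda>\<^sup>\<le>\<^sup>m\<close> for \<open>m = e\<^sub>i\<close> consists precisely of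
  all such edges, so
  the edge summation relation is a case of the path summation relation.\<close>

lemma kgraph_family_restricts:
  assumes A: "star_algebra A" and fam: "kgraph_family k \<Lambda> A t"
  shows "CK_family k \<Lambda> (\<lambda>_. 1) A t t"
proof -
  interpret star_algebra A by fact
  note F = fam[unfolded kgraph_family_def]
  have t: "t \<mu> \<in> carrier A" if "\<mu> \<in> mor \<Lambda>" for \<mu> using F that by blast
  have mult: "t \<mu> \<otimes>\<^bsub>A\<^esub> t \<nu> = t (cmp \<Lambda> \<mu> \<nu>)"
    if "\<mu> \<in> mor \<Lambda>" "\<nu> \<in> mor \<Lambda>" "src \<Lambda> \<mu> = rng \<Lambda> \<nu>" for \<mu> \<nu> using F that by blast
  have sum: "t v = (\<Oplus>\<^bsub>A\<^esub>\<mu>\<in>of_deg_at \<Lambda> v (unit_deg i). t \<mu> \<otimes>\<^bsub>A\<^esub> (t \<mu>)\<^sup>\<star>\<^bsub>A\<^esub>)"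
    if v: "v \<in> vertices \<Lambda>" and i: "i \<in> {1..k}" and ne: "of_deg_at \<Lambda> v (unit_deg i) \<noteq> {}" for v i
  proof -
    have no: "\<not> unit_deg i + unit_deg j \<le> unit_deg i" for j
    proof
      assume "unit_deg i + unit_deg j \<le> unit_deg i"
      then have "(unit_deg i + unit_deg j) j \<le> unit_deg i j" by (rule le_funD)
      then show False by (simp add: plus_fun_def unit_deg_def)
    qed
    have full: "deg \<Lambda> \<xi> = unit_deg i" if \<xi>: "\<xi> \<in> paths_le k \<Lambda> v (unit_deg i)" for \<xi>
    proof (cases "deg \<Lambda> \<xi> i = 0")
      case True
      have le: "deg \<Lambda> \<xi> \<le> unit_deg i" and \<xi>m: "\<xi> \<in> mor \<Lambda>" "rng \<Lambda> \<xi> = v"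
        using \<xi> by (auto simp: paths_le_def)
      have "deg \<Lambda> \<xi> j = 0" for j using le_funD[OF le, of j] True by (cases "j = i") (auto simp: unit_deg_def)
      then have "deg \<Lambda> \<xi> = 0" by (simp add: fun_eq_iff zero_fun_def)
      moreover from this have "\<xi> = v" using \<xi>m vertexD[of \<xi>] by (simp add: vertices_def of_deg_def)
      ultimately show ?thesis using \<xi> ne i v by (auto simp: paths_le_def vertexD)
    next
      case False
      have le: "deg \<Lambda> \<xi> \<le> unit_deg i" using \<xi> by (auto simp: paths_le_def)
      have "deg \<Lambda> \<xi> j = unit_deg i j" for j
        using le_funD[OF le, of j] False by (cases "j = i") (auto simp: unit_deg_def)
      then show ?thesis by (simp add: fun_eq_iff)
    qed
    have "paths_le k \<Lambda> v (unit_deg i) = of_deg_at \<Lambda> v (unit_deg i)"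
      using full no by (auto simp: paths_le_def of_deg_at_def of_deg_def)
    then show ?thesis using F v unit_deg_multi_nat[OF i] by metis
  qed
  have square: "t \<nu>' \<otimes>\<^bsub>A\<^esub> t \<mu>' = 1 \<odot>\<^bsub>A\<^esub> (t \<mu> \<otimes>\<^bsub>A\<^esub> t \<nu>)"
    if "\<mu> \<in> mor \<Lambda>" "\<mu>' \<in> mor \<Lambda>" "\<nu> \<in> mor \<Lambda>" "\<nu>' \<in> mor \<Lambda>"
      "src \<Lambda> \<mu> = rng \<Lambda> \<nu>" "src \<Lambda> \<nu>' = rng \<Lambda> \<mu>'" "cmp \<Lambda> \<mu> \<nu> = cmp \<Lambda> \<nu>' \<mu>'" for \<mu> \<mu>' \<nu> \<nu>'
    using that mult t by (simp add: scale_one cmp_closed)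
  show ?thesis
    unfolding CK_family_def
  proof (intro conjI ballI impI)
    show "t v \<otimes>\<^bsub>A\<^esub> t w = \<zero>\<^bsub>A\<^esub>" if "v \<in> vertices \<Lambda>" "w \<in> vertices \<Lambda>" "v \<noteq> w" for v w
      using F that by blast
    show "projection A (t v)" if "v \<in> vertices \<Lambda>" for v using F that by blast
    show "t \<mu> \<in> carrier A" if "\<mu> \<in> edges k \<Lambda>" for \<mu> using t that edges_mor by blast
    show "(t \<mu>)\<^sup>\<star>\<^bsub>A\<^esub> \<otimes>\<^bsub>A\<^esub> t \<mu> = t (src \<Lambda> \<mu>)" if "\<mu> \<in> edges k \<Lambda>" for \<mu>
      using F edges_mor[OF that] by blast
  qed (rule square sum; auto dest: of_degD(1))+
qed

lemma CK_algebra_trivial_cocycle: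
  assumes "row_finite k \<Lambda>" "locally_convex k \<Lambda>"
  shows "\<exists>\<pi>. star_iso (CK_algebra k \<Lambda> (\<lambda>_. 1)) (kgraph_algebra k \<Lambda>) \<pi> \<and>
        (\<forall>v\<in>vertices \<Lambda>. \<pi> (CK_p k \<Lambda> (\<lambda>_. 1) v) = kgraph_t k \<Lambda> v) \<and>
        (\<forall>\<mu>\<in>edges k \<Lambda>. \<pi> (CK_s k \<Lambda> (\<lambda>_. 1) \<mu>) = kgraph_t k \<Lambda> \<mu>)"
proof -
  let ?A = "CK_algebra k \<Lambda> (\<lambda>_. 1)" and ?B = "kgraph_algebra k \<Lambda>"
  let ?p = "CK_p k \<Lambda> (\<lambda>_. 1)" and ?s = "CK_s k \<Lambda> (\<lambda>_. 1)" and ?t = "kgraph_t k \<Lambda>"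
  interpret B: cstar_algebra ?B by (rule kgraph_universal(1))
  interpret T: untwisted_family k \<Lambda> ?A ?p ?s
    by (intro untwisted_family.intro untwisted_family_axioms.intro k_graph_axioms CK_universal assms)
  note tB = kgraph_universal(2)[unfolded kgraph_family_def]
  obtain f where f: "star_hom ?A ?B f" "\<forall>x\<in>carrier ?A. cnorm ?B (f x) \<le> cnorm ?A x"
    "\<forall>v\<in>vertices \<Lambda>. f (?p v) = ?t v" "\<forall>\<mu>\<in>edges k \<Lambda>. f (?s \<mu>) = ?t \<mu>"
    using CK_universal(4)[OF kgraph_universal(1)
        kgraph_family_restricts[OF B.star_algebra_axioms kgraph_universal(2)]] by blast
  obtain g where g: "star_hom ?B ?A g" "\<forall>x\<in>carrier ?B. cnorm ?A (g x) \<le> cnorm ?B x"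
    "\<forall>\<mu>\<in>mor \<Lambda>. g (?t \<mu>) = T.path_op \<mu>"
    using kgraph_universal(4)[OF CK_universal(1) T.path_op_family] by blast
  have ft: "f (T.path_op \<xi>) = ?t \<xi>" if "\<xi> \<in> mor \<Lambda>" for \<xi>
    using that
  proof (induction rule: path_induct)
    case (vertex v)
    then show ?case using f(3) by (simp add: T.path_op_vertex)
  next
    case (edge \<mu> \<nu>)
    have "f (?s \<mu> \<otimes>\<^bsub>?A\<^esub> T.path_op \<nu>) = ?t \<mu> \<otimes>\<^bsub>?B\<^esub> ?t \<nu>"
      using edge f(4) T.s_closed T.path_op_closed by (simp add: star_homD(3)[OF f(1)])
    also have "\<dots> = ?t (cmp \<Lambda> \<mu> \<nu>)" using tB edge edges_mor by blast
    finally show ?case using edge by (simp add: T.path_op_cmp_edge)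
  qed
  have "star_iso ?A ?B f"
  proof (rule star_iso_from_inverse_on_generators[OF CK_universal(1) kgraph_universal(1) f(1) _ g(1) _
        CK_algebra_generators_closed CK_universal(3) _ kgraph_generators_closed kgraph_universal(3)])
    fix x assume "x \<in> ?p ` vertices \<Lambda> \<union> ?s ` edges k \<Lambda>"
    then show "g (f x) = x"
      using f(3,4) g(3) by (auto simp: T.path_op_vertex T.path_op_edge vertices_mor edges_mor)
  next
    fix y assume "y \<in> ?t ` mor \<Lambda>"
    then show "f (g y) = y" using g(3) ft by auto
  qed (use f(2) g(2) in blast)+
  then show ?thesis using f by blast
qed

end

theorem proposition7p6:
  fixes k :: nat and \<Lambda> :: "'e kgraph"
  assumes "k_graph k \<Lambda>" and "row_finite k \<Lambda>" and "locally_convex k \<Lambda>"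
  shows
    "(\<exists>\<pi>. star_iso (CK_algebra k \<Lambda> (\<lambda>_. 1)) (kgraph_algebra k \<Lambda>) \<pi> \<and>
        (\<forall>v\<in>vertices \<Lambda>. \<pi> (CK_p k \<Lambda> (\<lambda>_. 1) v) = kgraph_t k \<Lambda> v) \<and>
        (\<forall>\<mu>\<in>edges k \<Lambda>. \<pi> (CK_s k \<Lambda> (\<lambda>_. 1) \<mu>) = kgraph_t k \<Lambda> \<mu>)) \<and>
     (\<forall>\<psi>\<in>cocycles2 k \<Lambda>. \<forall>\<phi>\<in>cocycles2 k \<Lambda>. \<forall>\<alpha>\<in>cochains k \<Lambda> 1.
        (\<forall>\<mu>\<in>cubes k \<Lambda> 2. \<phi> \<mu> = coboundary k \<Lambda> 1 \<alpha> \<mu> * \<psi> \<mu>) \<longrightarrow>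
        (\<exists>\<pi>. star_iso (CK_algebra k \<Lambda> \<psi>) (CK_algebra k \<Lambda> \<phi>) \<pi> \<and>
           (\<forall>v\<in>vertices \<Lambda>. \<pi> (CK_p k \<Lambda> \<psi> v) = CK_p k \<Lambda> \<phi> v) \<and>
           (\<forall>\<mu>\<in>edges k \<Lambda>.
              \<pi> (CK_s k \<Lambda> \<psi> \<mu>) = \<alpha> \<mu> \<odot>\<^bsub>CK_algebra k \<Lambda> \<phi>\<^esub> CK_s k \<Lambda> \<phi> \<mu>)))"
proof -
  interpret k_graph k \<Lambda> by fact
  show ?thesis
    using CK_algebra_trivial_cocycle[OF assms(2,3)] CK_algebra_cohomologous
    by (simp add: cocycles2_def)
qed

end
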